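(* Let $\bar p(x,y)$ be a quasi-symmetric, irreducible transition kernel on the countable set $\mathcal S$ (a perturbation of a symmetric irreducible kernel $p(x,y)$), and suppose that $\bar p(x,y)$ corresponds to a transient Markov chain on $\mathcal S$. Assume in addition that $\bar p(x,y)=p(x,y)$ for all ordered pairs $(x,y)$ except for exactly one ordered pair $(u,v)$. Let $\mathcal I$ be the set of invariant measures of the exclusion process with the symmetric kernel $p(x,y)$, and let $\bar S(t)$ and $\bar{\mathcal I}$ be the semigroup and the set of invariant measures of the exclusion process with kernel $\bar p(x,y)$. Then $$\bar{\mathcal I}=\Bigl\{\lim_{t\to\infty}\mu\bar S(t):\ \mu\in\mathcal I\Bigr\},$$ where the limits are weak limits of probability measures on $X=\{0,1\}^{\mathcal S}$ (and exist for every $\mu\in\mathcal I$).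
   Context: $\mathcal S$ is a countable set and $X=\{0,1\}^{\mathcal S}$. A transition kernel is a function $p(x,y)\ge0$ on $\mathcal S\times\mathcal S$ (jump rates) with $\sup_y\sum_x p(x,y)<\infty$ and $\sup_x\sum_y p(x,y)<\infty$. It corresponds to the continuous-time Markov chain on $\mathcal S$ jumping from $x$ to $y$ at rate $p(x,y)$; irreducibility, transience and recurrence refer to this chain. The exclusion process with kernel $p$ is the Feller process on $X$ whose generator is the closure of the operator $$\Omega f(\eta)=\sum_{x,y}p(x,y)\,\eta(x)(1-\eta(y))\,[f(\eta_{xy})-f(\eta)],$$ defined for $f$ depending on finitely many coordinates, where $\eta_{xy}$ is obtained from $\eta$ by interchanging the values $\eta(x)$ and $\eta(y)$. A probability measure $\mu$ on $X$ is invariant if $\mu S(t)=\mu$ for all $t\ge0$, where $S(t)$ is the semigroup of the process and $\mu S(t)$ is the law at time $t$ of the process started from $\mu$. Perturbation: given an irreducible kernel $p$, a perturbation of $p$ is a kernel $\bar p$ with $\bar p(x,y)=p(x,y)$ for all $(x,y)$ except for finitely many ordered pairs $(x_1,y_1),\dots,(x_n,y_n)$, where $\bar p(x_i,y_i)=p(x_i,y_i)+\epsilon_i$ with $\epsilon_i>-p(x_i,y_i)$; moreover $\bar p(x,y)>0$ if and only if $p(x,y)>0$. The $x_i$'s and $y_i$'s need not be distinct. If $p$ is symmetric, $p(x,y)=p(y,x)$ for all $x,y$, then $\bar p$ is called quasi-symmetric. *)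

theory Defs
  imports "HOL-Probability.Probability" "HOL-Analysis.Bounded_Continuous_Function"
begin

section \<open>Transition kernels and their perturbations\<close>

definition transition_kernel :: "('s \<Rightarrow> 's \<Rightarrow> real) \<Rightarrow> bool" where
  "transition_kernel p \<longleftrightarrow>
     (\<forall>x y. 0 \<le> p x y) \<and>
     (\<exists>C. \<forall>y. (\<lambda>x. p x y) summable_on UNIV \<and> (\<Sum>\<^sub>\<infinity>x. p x y) \<le> C) \<and>
     (\<exists>C. \<forall>x. (\<lambda>y. p x y) summable_on UNIV \<and> (\<Sum>\<^sub>\<infinity>y. p x y) \<le> C)"

definition irreducible_kernel :: "('s \<Rightarrow> 's \<Rightarrow> real) \<Rightarrow> bool" where
  "irreducible_kernel p \<longleftrightarrow> (\<forall>x y. (x, y) \<in> {(a, b). p a b > 0}\<^sup>*)"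

definition symmetric_kernel :: "('s \<Rightarrow> 's \<Rightarrow> real) \<Rightarrow> bool" where
  "symmetric_kernel p \<longleftrightarrow> (\<forall>x y. p x y = p y x)"

definition perturbation :: "('s \<Rightarrow> 's \<Rightarrow> real) \<Rightarrow> ('s \<Rightarrow> 's \<Rightarrow> real) \<Rightarrow> bool" where
  "perturbation p pbar \<longleftrightarrow>
     transition_kernel p \<and> irreducible_kernel p \<and> transition_kernel pbar \<and>
     (\<exists>F \<epsilon>. finite F \<and>
        (\<forall>x y. (x, y) \<notin> F \<longrightarrow> pbar x y = p x y) \<and>
        (\<forall>x y. (x, y) \<in> F \<longrightarrow> pbar x y = p x y + \<epsilon> x y \<and> \<epsilon> x y > - p x y)) \<and>
     (\<forall>x y. pbar x y > 0 \<longleftrightarrow> p x y > 0)"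

definition quasi_symmetric :: "('s \<Rightarrow> 's \<Rightarrow> real) \<Rightarrow> ('s \<Rightarrow> 's \<Rightarrow> real) \<Rightarrow> bool" where
  "quasi_symmetric p pbar \<longleftrightarrow> symmetric_kernel p \<and> perturbation p pbar"


section \<open>The Markov chain of a kernel and its transience\<close>

text \<open>A diagonal rate \<open>p x x\<close> describes a jump from \<open>x\<close> to itself, so it does not enter the Q-matrix.\<close>

definition rate_matrix :: "('s \<Rightarrow> 's \<Rightarrow> real) \<Rightarrow> 's \<Rightarrow> 's \<Rightarrow> real" where
  "rate_matrix p x y = (if x = y then - (\<Sum>\<^sub>\<infinity>z\<in>- {x}. p x z) else p x y)"

definition chain_transition_function ::
    "('s \<Rightarrow> 's \<Rightarrow> real) \<Rightarrow> (real \<Rightarrow> 's \<Rightarrow> 's pmf) \<Rightarrow> bool" where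
  "chain_transition_function p K \<longleftrightarrow>
     (\<forall>x. K 0 x = return_pmf x) \<and>
     (\<forall>s\<ge>0. \<forall>t\<ge>0. \<forall>x. K (s + t) x = bind_pmf (K s x) (K t)) \<and>
     (\<forall>x y. ((\<lambda>t. pmf (K t x) y) has_real_derivative rate_matrix p x y) (at 0 within {0..}))"

text \<open>\<open>path_prob K x s [(t\<^sub>1, y\<^sub>1), \<dots>, (t\<^sub>n, y\<^sub>n)]\<close>, for \<open>s \<le> t\<^sub>1 \<le> \<dots> \<le> t\<^sub>n\<close>, is the probability
  that the chain with transition function \<open>K\<close> that is in \<open>x\<close> at time \<open>s\<close>
  is in \<open>y\<^sub>i\<close> at time \<open>t\<^sub>i\<close> for every \<open>i\<close>.\<close>

fun path_prob :: "(real \<Rightarrow> 's \<Rightarrow> 's pmf) \<Rightarrow> 's \<Rightarrow> real \<Rightarrow> (real \<times> 's) list \<Rightarrow> real" where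
  "path_prob K x s [] = 1"
| "path_prob K x s ((t, y) # r) = pmf (K (t - s) x) y * path_prob K y t r"

text \<open>\<open>M x\<close> is the law of the chain started from \<open>x\<close>, on the space of right-continuous paths
  for the discrete topology of the state space. Paths are functions on all of \<^typ>\<open>real\<close>;
  only their values at nonnegative times matter.\<close>

definition markov_chain ::
    "('s \<Rightarrow> 's \<Rightarrow> real) \<Rightarrow> ('s \<Rightarrow> (real \<Rightarrow> 's) measure) \<Rightarrow> bool" where
  "markov_chain p M \<longleftrightarrow>
     (\<exists>K. chain_transition_function p K \<and>
       (\<forall>x. prob_space (M x) \<and>
         (\<forall>t\<ge>0. (\<lambda>\<omega>. \<omega> t) \<in> M x \<rightarrow>\<^sub>M count_space UNIV) \<and>
         (\<forall>\<omega>\<in>space (M x). \<forall>t\<ge>0. \<exists>e>0. \<forall>s. t \<le> s \<and> s < t + e \<longrightarrow> \<omega> s = \<omega> t) \<and>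
         (\<forall>r. sorted (0 # map fst r) \<longrightarrow>
            measure (M x) {\<omega> \<in> space (M x). \<forall>(t, y)\<in>set r. \<omega> t = y} = path_prob K x 0 r)))"

text \<open>Every state is transient: almost surely, the set of times spent in the initial state is
  bounded. The law of the chain is determined by \<open>p\<close>, so the choice of \<open>M\<close> does not matter.\<close>

definition transient_kernel :: "('s \<Rightarrow> 's \<Rightarrow> real) \<Rightarrow> bool" where
  "transient_kernel p \<longleftrightarrow>
     (\<exists>M. markov_chain p M \<and> (\<forall>x. AE \<omega> in M x. bdd_above {t. 0 \<le> t \<and> \<omega> t = x}))"


section \<open>Feller processes\<close>

text \<open>A time-homogeneous Feller process on a compact space is given by its transition
  probabilities: \<open>P t \<eta>\<close> is the law at time \<open>t\<close> of the process started from \<open>\<eta>\<close>.\<close>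

definition feller_semigroup ::
    "(real \<Rightarrow> 'a::topological_space \<Rightarrow> 'a measure) \<Rightarrow> real \<Rightarrow> ('a \<Rightarrow>\<^sub>C real) \<Rightarrow> ('a \<Rightarrow>\<^sub>C real)" where
  "feller_semigroup P t f = Bcontfun (\<lambda>\<eta>. \<integral>\<zeta>. apply_bcontfun f \<zeta> \<partial>P t \<eta>)"

text \<open>By the continuity clause, the function inside \<^const>\<open>Bcontfun\<close> in \<^const>\<open>feller_semigroup\<close> is a
  bounded continuous one (it is bounded since \<open>f\<close> is).\<close>

definition feller_process :: "(real \<Rightarrow> 'a::topological_space \<Rightarrow> 'a measure) \<Rightarrow> bool" where
  "feller_process P \<longleftrightarrow>
     (\<forall>t\<ge>0. P t \<in> borel \<rightarrow>\<^sub>M prob_algebra borel) \<and>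
     (\<forall>\<eta>. P 0 \<eta> = return borel \<eta>) \<and>
     (\<forall>s\<ge>0. \<forall>t\<ge>0. \<forall>\<eta>. P (s + t) \<eta> = P s \<eta> \<bind> P t) \<and>
     (\<forall>t\<ge>0. \<forall>f :: 'a \<Rightarrow>\<^sub>C real. continuous_on UNIV (\<lambda>\<eta>. \<integral>\<zeta>. apply_bcontfun f \<zeta> \<partial>P t \<eta>)) \<and>
     (\<forall>f. ((\<lambda>t. feller_semigroup P t f) \<longlongrightarrow> f) (at_right 0))"

text \<open>The generator of the semigroup, as a graph.\<close>

definition generator ::
    "(real \<Rightarrow> 'a::topological_space \<Rightarrow> 'a measure) \<Rightarrow> (('a \<Rightarrow>\<^sub>C real) \<times> ('a \<Rightarrow>\<^sub>C real)) set" where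
  "generator P = {(f, g). ((\<lambda>t. (feller_semigroup P t f - f) /\<^sub>R t) \<longlongrightarrow> g) (at_right 0)}"

text \<open>\<open>law_at P \<mu> t\<close> is the measure \<open>\<mu>S(t)\<close>.\<close>

definition law_at :: "(real \<Rightarrow> 'a \<Rightarrow> 'a measure) \<Rightarrow> 'a measure \<Rightarrow> real \<Rightarrow> 'a measure" where
  "law_at P \<mu> t = \<mu> \<bind> P t"

definition invariant_measures ::
    "(real \<Rightarrow> 'a::topological_space \<Rightarrow> 'a measure) \<Rightarrow> 'a measure set" where
  "invariant_measures P =
     {\<mu>. prob_space \<mu> \<and> sets \<mu> = sets borel \<and> (\<forall>t\<ge>0. law_at P \<mu> t = \<mu>)}"

definition weak_limit ::
    "('i \<Rightarrow> 'a::topological_space measure) \<Rightarrow> 'a measure \<Rightarrow> 'i filter \<Rightarrow> bool" where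
  "weak_limit m \<nu> F \<longleftrightarrow>
     prob_space \<nu> \<and> sets \<nu> = sets borel \<and>
     (\<forall>f :: 'a \<Rightarrow>\<^sub>C real.
        ((\<lambda>i. \<integral>\<eta>. apply_bcontfun f \<eta> \<partial>m i) \<longlongrightarrow> (\<integral>\<eta>. apply_bcontfun f \<eta> \<partial>\<nu>)) F)"


section \<open>The exclusion process\<close>

text \<open>The configuration space \<open>{0,1}\<^sup>S\<close> is \<^typ>\<open>'s \<Rightarrow> bool\<close> with the product topology;
  \<^term>\<open>\<eta> x\<close> means that \<open>x\<close> is occupied.\<close>

definition exchange :: "'s \<Rightarrow> 's \<Rightarrow> ('s \<Rightarrow> bool) \<Rightarrow> ('s \<Rightarrow> bool)" where
  "exchange x y \<eta> = \<eta>(x := \<eta> y, y := \<eta> x)"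

definition finitely_dependent :: "(('s \<Rightarrow> bool) \<Rightarrow> real) \<Rightarrow> bool" where
  "finitely_dependent f \<longleftrightarrow>
     (\<exists>A. finite A \<and> (\<forall>\<eta> \<zeta>. (\<forall>x\<in>A. \<eta> x = \<zeta> x) \<longrightarrow> f \<eta> = f \<zeta>))"

definition exclusion_operator ::
    "('s \<Rightarrow> 's \<Rightarrow> real) \<Rightarrow> (('s \<Rightarrow> bool) \<Rightarrow> real) \<Rightarrow> ('s \<Rightarrow> bool) \<Rightarrow> real" where
  "exclusion_operator p f \<eta> =
     (\<Sum>\<^sub>\<infinity>(x, y)\<in>UNIV. p x y * of_bool (\<eta> x) * (1 - of_bool (\<eta> y)) * (f (exchange x y \<eta>) - f \<eta>))"

definition exclusion_pregenerator ::
    "('s \<Rightarrow> 's \<Rightarrow> real) \<Rightarrow> ((('s \<Rightarrow> bool) \<Rightarrow>\<^sub>C real) \<times> (('s \<Rightarrow> bool) \<Rightarrow>\<^sub>C real)) set" where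
  "exclusion_pregenerator p =
     {(f, g). finitely_dependent (apply_bcontfun f) \<and>
              apply_bcontfun g = exclusion_operator p (apply_bcontfun f)}"

definition exclusion_process ::
    "('s \<Rightarrow> 's \<Rightarrow> real) \<Rightarrow> (real \<Rightarrow> ('s \<Rightarrow> bool) \<Rightarrow> ('s \<Rightarrow> bool) measure) \<Rightarrow> bool" where
  "exclusion_process p P \<longleftrightarrow>
     feller_process P \<and> generator P = closure (exclusion_pregenerator p)"

end

theory Submission
  imports Defs
begin

text \<open>Write \<open>S\<close> and \<open>S'\<close> for the symmetric and the perturbed semigroup, \<open>\<epsilon>\<close> for the change of the rate at
  \<open>(u, v)\<close>, and \<open>D f (\<eta>, x)\<close> for the difference of \<open>f\<close> between the configurations with and without a
  particle at \<open>x\<close>. The generators differ by the bounded operator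
  \<open>B f (\<eta>) = \<epsilon> \<eta>(u) (1 - \<eta>(v)) (f(\<eta>\<^sub>u\<^sub>v) - f(\<eta>))\<close>, so that for \<open>\<mu>\<close> invariant under \<open>S\<close>
  \<open>\<mu> S'(t) f - \<mu> f = \<mu> (B (\<integral>\<^sub>0\<^sup>t S'(r) f dr))\<close>,
  and the right-hand side only involves \<open>D\<close> of the time integral at \<open>u\<close> and \<open>v\<close>. The evolution of
  \<open>D f\<close> is that of a single discrepancy, which performs the walk with rates \<open>p\<close> except for extra jumps
  between \<open>u\<close> and \<open>v\<close> at rates depending on the environment. Hence a maximum principle bounds
  the integral by any function \<open>W\<close> on the sites that is superharmonic for this walk in every
  environment; such \<open>W\<close> are built from the Green function \<open>G\<close> of \<open>p\<close>, which is finite since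
  transience passes from the perturbed chain to \<open>p\<close>. For monotone \<open>f\<close> the integral is increasing and
  bounded, so \<open>\<mu> S'(t)\<close> converges; exchanging the roles, \<open>\<nu> S(s)\<close> converges to some \<open>\<mu>\<close> for \<open>\<nu>\<close> invariant
  under \<open>S'\<close>. To see that then \<open>\<mu> S'(t)\<close> tends to \<open>\<nu>\<close>, take \<open>g\<close> to be the mean of \<open>S'(r) f\<close> over \<open>r \<le> t\<close>.
  Since \<open>\<nu> g = \<nu> f\<close>, the difference \<open>\<mu> g - \<nu> f\<close> is controlled by the potential of \<open>D g\<close>, and \<open>D g\<close> is at
  most a multiple of \<open>G\<^sub>\<lambda> / t\<close> with \<open>\<lambda> = 1/t\<close>. By the resolvent equation \<open>\<lambda> G G\<^sub>\<lambda> = G - G\<^sub>\<lambda>\<close>, this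
  potential vanishes as \<open>t\<close> tends to infinity.\<close>

section \<open>The Green function of a symmetric kernel\<close>

text \<open>The argument stays at the level of generators: a maximum principle takes the place of a
  coupling of exclusion processes, and the Green function enters through the resolvents
  \<open>green l\<close> with \<open>0 < l \<le> 1\<close>, with bounds uniform in \<open>l\<close>.
  A horizon \<open>t\<close> corresponds to \<open>l = 1 / t\<close>, at the price of a factor
  \<open>exp 1\<close>. Two obstacles shape the proof. First, the perturbed chain need not be
  symmetric, so transience is not transferred by comparing symmetric forms; instead
  \<open>green l x u\<close>, as a function of \<open>x\<close>, is tested as a subsolution for the
  perturbed chain. Second, a discrepancy crosses the modified bond at a rate that depends on the
  environment, so one supersolution has to survive every environment at once. For a decreased rate
  the margin left over is \<open>(p u v + \<epsilon>) / p u v\<close>, and this is where positivity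
  of the modified rate enters. The averaging in the last step supplies the missing decay: the
  argument has no pointwise bound on the discrepancy of S'(t) f that vanishes with time, while that
  of the mean is at most a resolvent divided by \<open>t\<close>, whose potential is the tail of a
  convergent monotone family.\<close>

lemma infsum_single:
  fixes f :: "'a \<Rightarrow> real"
  assumes "\<And>x. x \<noteq> a \<Longrightarrow> f x = 0"
  shows "f summable_on UNIV" "infsum f UNIV = f a"
proof -
  have "(f has_sum f a) UNIV \<longleftrightarrow> (f has_sum f a) {a}"
    by (rule has_sum_cong_neutral) (use assms in auto)
  then have "(f has_sum f a) UNIV" using has_sum_finiteI[of "{a}" "f a" f] by simp
  then show "f summable_on UNIV" "infsum f UNIV = f a"
    by (auto simp: summable_on_def infsumI)
qed

lemma summable_on_weighted:
  fixes q W :: "'a \<Rightarrow> real"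
  assumes "q summable_on A" "\<And>y. 0 \<le> q y" "\<And>y. \<bar>W y\<bar> \<le> K"
  shows "(\<lambda>y. q y * W y) summable_on A"
proof -
  have "(\<lambda>y. norm (q y * W y)) summable_on A"
  proof (rule Infinite_Sum.abs_summable_on_comparison_test')
    show "(\<lambda>y. K * q y) summable_on A" using assms(1) by (rule summable_on_cmult_right)
    show "norm (q y * W y) \<le> K * q y" for y
      using mult_left_mono[OF assms(3)[of y] assms(2)[of y]] assms(2)[of y]
      by (simp add: abs_mult mult.commute)
  qed
  then show ?thesis by (rule summable_on_iff_abs_summable_on_real[THEN iffD2])
qed

section \<open>Drift operators and the maximum principle on a countable set\<close>

definition drift :: "('s \<Rightarrow> 's \<Rightarrow> real) \<Rightarrow> ('s \<Rightarrow> real) \<Rightarrow> 's \<Rightarrow> real" where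
  "drift p W x = (\<Sum>\<^sub>\<infinity>y. p x y * (W y - W x))"

locale bounded_rates =
  fixes p :: "'s \<Rightarrow> 's \<Rightarrow> real" and C :: real
  assumes rate_nonneg: "0 \<le> p x y"
    and row_summable: "p x summable_on UNIV"
    and row_sum_le: "(\<Sum>\<^sub>\<infinity>y. p x y) \<le> C"
begin

definition total_rate where "total_rate x = (\<Sum>\<^sub>\<infinity>y. p x y)"

lemma total_rate_nonneg: "0 \<le> total_rate x"
  unfolding total_rate_def by (intro infsum_nonneg rate_nonneg)

lemma total_rate_le: "total_rate x \<le> C"
  using row_sum_le unfolding total_rate_def .

lemma C_nonneg: "0 \<le> C"
  using total_rate_nonneg total_rate_le by (rule order_trans)

lemma row_weighted_summable:
  assumes "\<And>y. \<bar>W y\<bar> \<le> K"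
  shows "(\<lambda>y. p x y * W y) summable_on UNIV"
  using row_summable rate_nonneg assms by (rule summable_on_weighted)

lemma drift_terms_summable:
  assumes "\<And>y. \<bar>W y\<bar> \<le> K"
  shows "(\<lambda>y. p x y * (W y - W x)) summable_on UNIV"
proof (rule row_weighted_summable[of _ "K + K"])
  show "\<bar>W y - W x\<bar> \<le> K + K" for y
    using assms[of y] assms[of x] by linarith
qed

lemma drift_eq:
  assumes "\<And>y. \<bar>W y\<bar> \<le> K"
  shows "drift p W x = (\<Sum>\<^sub>\<infinity>y. p x y * W y) - total_rate x * W x"
proof -
  have "drift p W x = (\<Sum>\<^sub>\<infinity>y. p x y * W y + p x y * - W x)"
    unfolding drift_def by (simp add: algebra_simps)
  also have "\<dots> = (\<Sum>\<^sub>\<infinity>y. p x y * W y) + (\<Sum>\<^sub>\<infinity>y. p x y * - W x)"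
    by (intro infsum_add row_weighted_summable[OF assms] summable_on_cmult_left row_summable)
  also have "(\<Sum>\<^sub>\<infinity>y. p x y * - W x) = total_rate x * - W x"
    unfolding total_rate_def by (rule infsum_cmult_left) (use row_summable in auto)
  finally show ?thesis by simp
qed

text \<open>The disjunction exempts points where \<open>W\<close> is already known to be
  nonnegative, such as the source of a Green function. On an infinite set the infimum need not be
  attained; bounded total rates allow the usual argument to be run at a point whose value is merely
  close to it.\<close>

lemma maximum_principle:
  assumes bounded: "\<And>y. \<bar>W y\<bar> \<le> K" and "0 < l"
    and super: "\<And>x. 0 \<le> W x \<or> 0 \<le> l * W x - drift p W x"
  shows "0 \<le> W x"
proof (rule ccontr)
  assume neg: "\<not> 0 \<le> W x"
  define m where "m = Inf (range W)"
  have bdd: "bdd_below (range W)"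
    using bounded by (intro bdd_belowI2[of _ "- K"]) (simp add: abs_le_iff minus_le_iff)
  have mle: "m \<le> W y" for y unfolding m_def using bdd by (intro cInf_lower) auto
  have "m < 0" using mle[of x] neg by simp
  \<comment> \<open>The threshold \<open>C / (l + C) * m\<close> is the value of \<open>W z\<close>
    at which \<open>C * (m - W z) \<le> l * W z\<close> becomes an equality. As
    \<open>m < 0\<close>, it lies strictly above the infimum, so some point falls below it.\<close>
  have "C / (l + C) < 1" using \<open>0 < l\<close> C_nonneg by (simp add: field_simps)
  with \<open>m < 0\<close> have "1 * m < C / (l + C) * m" by (intro mult_strict_right_mono_neg)
  then have "m < C / (l + C) * m" by simp
  then obtain z where z: "W z < C / (l + C) * m"
    using cInf_lessD[of "range W" "C / (l + C) * m"] unfolding m_def by auto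
  have "C / (l + C) * m \<le> 0"
    using \<open>0 < l\<close> C_nonneg \<open>m < 0\<close> by (intro mult_nonneg_nonpos divide_nonneg_pos) auto
  with z have "W z < 0" by simp
  with super[of z] have 1: "drift p W z \<le> l * W z" by simp
  have "(\<Sum>\<^sub>\<infinity>y. p z y * (m - W z)) \<le> drift p W z"
    unfolding drift_def
  proof (rule infsum_mono)
    show "(\<lambda>y. p z y * (m - W z)) summable_on UNIV"
      using row_summable by (rule summable_on_cmult_left)
    show "(\<lambda>y. p z y * (W y - W z)) summable_on UNIV"
      using bounded by (rule drift_terms_summable)
    show "p z y * (m - W z) \<le> p z y * (W y - W z)" for y
      by (intro mult_left_mono rate_nonneg) (simp add: mle)
  qed
  moreover have "(\<Sum>\<^sub>\<infinity>y. p z y * (m - W z)) = total_rate z * (m - W z)"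
    unfolding total_rate_def by (rule infsum_cmult_left) (use row_summable in auto)
  moreover have "C * (m - W z) \<le> total_rate z * (m - W z)"
    using mle[of z] total_rate_le[of z] by (intro mult_right_mono_neg) auto
  ultimately have "C * (m - W z) \<le> l * W z" using 1 by linarith
  then have "C * m \<le> (l + C) * W z" by (simp add: algebra_simps)
  moreover have "(l + C) * W z < C * m"
    using z \<open>0 < l\<close> C_nonneg by (simp add: field_simps)
  ultimately show False by simp
qed

lemma drift_add:
  assumes "\<And>y. \<bar>V y\<bar> \<le> K" "\<And>y. \<bar>W y\<bar> \<le> K'"
  shows "drift p (\<lambda>x. V x + W x) x = drift p V x + drift p W x"
proof -
  have "drift p (\<lambda>x. V x + W x) x = (\<Sum>\<^sub>\<infinity>y. p x y * (V y - V x) + p x y * (W y - W x))"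
    unfolding drift_def by (simp add: algebra_simps)
  also have "\<dots> = drift p V x + drift p W x"
    unfolding drift_def by (intro infsum_add drift_terms_summable[OF assms(1)] drift_terms_summable[OF assms(2)])
  finally show ?thesis .
qed

lemma drift_cmult: "drift p (\<lambda>x. c * W x) x = c * drift p W x"
proof -
  have "drift p (\<lambda>x. c * W x) x = (\<Sum>\<^sub>\<infinity>y. c * (p x y * (W y - W x)))"
    unfolding drift_def by (simp add: algebra_simps)
  also have "\<dots> = c * drift p W x" unfolding drift_def by (rule infsum_cmult_right')
  finally show ?thesis .
qed

lemma drift_const [simp]: "drift p (\<lambda>_. c) x = 0"
  by (simp add: drift_def)

lemma drift_sum:
  assumes "finite A" "\<And>a y. \<bar>W a y\<bar> \<le> K"
  shows "drift p (\<lambda>x. \<Sum>a\<in>A. W a x) x = (\<Sum>a\<in>A. drift p (W a) x)"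
  using assms(1)
proof (induction A rule: finite_induct)
  case (insert b A)
  have "\<bar>\<Sum>a\<in>A. W a y\<bar> \<le> card A * K" for y
    using sum_norm_bound[of A "\<lambda>a. W a y" K] assms(2) by simp
  from drift_add[where V = "W b", OF assms(2) this, where x = x] insert show ?case by simp
qed simp

end

section \<open>The resolvent Green function, expanded by the number of jumps\<close>

locale symmetric_rates = bounded_rates p C
  for p :: "'s::countable \<Rightarrow> 's \<Rightarrow> real" and C +
  assumes sym: "p x y = p y x"
begin

text \<open>\<open>hop l k x a\<close> is the contribution to the Green function of the trajectories with \<open>k\<close> jumps.\<close>

fun hop :: "real \<Rightarrow> nat \<Rightarrow> 's \<Rightarrow> 's \<Rightarrow> real" where
  "hop l 0 x a = (if x = a then 1 / (l + total_rate x) else 0)"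
| "hop l (Suc k) x a = (\<Sum>\<^sub>\<infinity>y. p x y * hop l k y a) / (l + total_rate x)"

text \<open>The resolvent kernel of the drift: the expected time spent in \<open>a\<close> before
  killing at rate \<open>l\<close>. Killing alone keeps it below \<open>1 / l\<close>; transience
  will appear as a bound that persists as \<open>l\<close> tends to 0.\<close>

definition green :: "real \<Rightarrow> 's \<Rightarrow> 's \<Rightarrow> real" where
  "green l x a = (\<Sum>k. hop l k x a)"

context
  fixes l :: real
  assumes l_pos: "0 < l"
begin

lemma denom_pos: "0 < l + total_rate x"
  using l_pos total_rate_nonneg[of x] by simp

lemma hop_nonneg: "0 \<le> hop l k x a"
proof (induction k arbitrary: x)
  case (Suc k)
  then show ?case
    using denom_pos[of x] by (auto intro!: divide_nonneg_pos infsum_nonneg mult_nonneg_nonneg rate_nonneg)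
qed (simp add: less_imp_le[OF denom_pos])

text \<open>Bound and recursion are proved together: splitting the infinite sum for one more jump
  needs bounded partial sums, and the next bound comes from the recursion. The value
  \<open>1 / l\<close> reproduces itself, being the expected lifetime under killing at rate
  \<open>l\<close>.\<close>

lemma hop_partial_sums:
  "(\<Sum>k<n. hop l k x a) \<le> 1 / l
   \<and> (\<Sum>k<Suc n. hop l k x a) = hop l 0 x a + (\<Sum>\<^sub>\<infinity>y. p x y * (\<Sum>k<n. hop l k y a)) / (l + total_rate x)"
proof (induction n arbitrary: x)
  case 0
  then show ?case using l_pos by simp
next
  case (Suc n)
  have nn: "0 \<le> (\<Sum>k<n. hop l k y a)" for y
    by (intro sum_nonneg hop_nonneg)
  have bnd: "\<bar>\<Sum>k<n. hop l k y a\<bar> \<le> 1 / l" for y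
    using Suc[of y] nn[of y] by simp
  have le: "(\<Sum>k<Suc n. hop l k y a) \<le> 1 / l" for y
  proof -
    have "(\<Sum>\<^sub>\<infinity>z. p y z * (\<Sum>k<n. hop l k z a)) \<le> (\<Sum>\<^sub>\<infinity>z. p y z * (1 / l))"
    proof (rule infsum_mono[OF row_weighted_summable[OF bnd]])
      show "(\<lambda>z. p y z * (1 / l)) summable_on UNIV"
        using row_summable by (rule summable_on_cmult_left)
      show "p y z * (\<Sum>k<n. hop l k z a) \<le> p y z * (1 / l)" for z
        by (intro mult_left_mono rate_nonneg) (use Suc[of z] in simp)
    qed
    also have "\<dots> = total_rate y * (1 / l)"
      unfolding total_rate_def by (rule infsum_cmult_left) (use row_summable in auto)
    finally have "(\<Sum>\<^sub>\<infinity>z. p y z * (\<Sum>k<n. hop l k z a)) / (l + total_rate y)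
        \<le> total_rate y * (1 / l) / (l + total_rate y)"
      by (rule divide_right_mono) (rule less_imp_le[OF denom_pos])
    moreover have "hop l 0 y a \<le> 1 / (l + total_rate y)" using denom_pos[of y] by simp
    moreover have "1 / (l + total_rate y) + total_rate y * (1 / l) / (l + total_rate y) = 1 / l"
    proof -
      have "1 / (l + t) + t * (1 / l) / (l + t) = 1 / l" if "0 < l + t" for t
        using that l_pos by (simp add: divide_simps)
      then show ?thesis using denom_pos .
    qed
    ultimately show ?thesis using Suc[of y] by linarith
  qed
  have hb: "\<bar>hop l n y a\<bar> \<le> 1 / l" for y
    using hop_nonneg[of n y a] nn[of y] le[of y] by simp
  have "(\<Sum>\<^sub>\<infinity>y. p x y * (\<Sum>k<Suc n. hop l k y a))
      = (\<Sum>\<^sub>\<infinity>y. p x y * (\<Sum>k<n. hop l k y a) + p x y * hop l n y a)"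
    by (simp add: algebra_simps)
  also have "\<dots> = (\<Sum>\<^sub>\<infinity>y. p x y * (\<Sum>k<n. hop l k y a)) + (\<Sum>\<^sub>\<infinity>y. p x y * hop l n y a)"
    by (intro infsum_add row_weighted_summable[OF bnd] row_weighted_summable[OF hb])
  finally have "(\<Sum>k<Suc (Suc n). hop l k x a)
      = hop l 0 x a + (\<Sum>\<^sub>\<infinity>y. p x y * (\<Sum>k<Suc n. hop l k y a)) / (l + total_rate x)"
    using Suc[of x] by (simp add: add_divide_distrib)
  with le[of x] show ?case by blast
qed

lemma hop_le: "hop l k x a \<le> 1 / l"
proof -
  have "hop l k x a \<le> (\<Sum>j<Suc k. hop l j x a)"
    using sum_nonneg[of "{..<k}" "\<lambda>j. hop l j x a"] hop_nonneg by auto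
  also have "\<dots> \<le> 1 / l" using hop_partial_sums by blast
  finally show ?thesis .
qed

lemma hop_summable: "summable (\<lambda>k. hop l k x a)"
  by (rule summableI_nonneg_bounded[of _ "1 / l"]) (use hop_nonneg hop_partial_sums in auto)

lemma green_nonneg: "0 \<le> green l x a"
  unfolding green_def by (intro suminf_nonneg hop_summable hop_nonneg)

lemma green_le: "green l x a \<le> 1 / l"
  unfolding green_def by (intro suminf_le_const hop_summable) (use hop_partial_sums in auto)

lemma green_abs_le: "\<bar>green l x a\<bar> \<le> 1 / l"
  using green_nonneg green_le by auto

lemma hop_partial_le_green: "(\<Sum>k<n. hop l k x a) \<le> green l x a"
  unfolding green_def by (intro sum_le_suminf hop_summable) (auto simp: hop_nonneg)

text \<open>Monotone convergence is carried out by hand in both directions: partial sums over jumps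
  stay below the right-hand side, and sums over finitely many \<open>y\<close> stay below the
  left-hand side once the number of jumps tends to infinity.\<close>

lemma green_fixpoint:
  "(l + total_rate x) * green l x a = of_bool (x = a) + (\<Sum>\<^sub>\<infinity>y. p x y * green l y a)"
proof (rule antisym)
  have s: "(\<lambda>y. p x y * green l y a) summable_on UNIV"
    by (rule row_weighted_summable[OF green_abs_le])
  have b: "\<bar>\<Sum>k<n. hop l k y a\<bar> \<le> 1 / l" for y n
    using hop_partial_sums[of y a n] sum_nonneg[of "{..<n}" "\<lambda>k. hop l k y a"] hop_nonneg by auto
  have "(\<Sum>k<n. hop l k x a) \<le> (of_bool (x = a) + (\<Sum>\<^sub>\<infinity>y. p x y * green l y a)) / (l + total_rate x)" for n
  proof -
    have "(\<Sum>\<^sub>\<infinity>y. p x y * (\<Sum>k<n. hop l k y a)) \<le> (\<Sum>\<^sub>\<infinity>y. p x y * green l y a)"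
      by (rule infsum_mono[OF row_weighted_summable[OF b] s])
        (intro mult_left_mono hop_partial_le_green rate_nonneg)
    moreover have "(\<Sum>k<Suc n. hop l k x a)
        = hop l 0 x a + (\<Sum>\<^sub>\<infinity>y. p x y * (\<Sum>k<n. hop l k y a)) / (l + total_rate x)"
      using hop_partial_sums by blast
    moreover have "(\<Sum>k<n. hop l k x a) \<le> (\<Sum>k<Suc n. hop l k x a)" using hop_nonneg by simp
    moreover have "hop l 0 x a = of_bool (x = a) / (l + total_rate x)" by simp
    ultimately show ?thesis
      using denom_pos[of x] divide_right_mono[of "\<Sum>\<^sub>\<infinity>y. p x y * (\<Sum>k<n. hop l k y a)" _ "l + total_rate x"]
      unfolding add_divide_distrib by (smt (verit))
  qed
  then have "green l x a \<le> (of_bool (x = a) + (\<Sum>\<^sub>\<infinity>y. p x y * green l y a)) / (l + total_rate x)"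
    unfolding green_def[of l x a] by (intro suminf_le_const hop_summable) auto
  then show "(l + total_rate x) * green l x a \<le> of_bool (x = a) + (\<Sum>\<^sub>\<infinity>y. p x y * green l y a)"
    using denom_pos[of x] by (simp add: field_simps)
  have "(\<Sum>\<^sub>\<infinity>y. p x y * green l y a) \<le> (l + total_rate x) * green l x a - of_bool (x = a)"
  proof (rule infsum_le_finite_sums[OF s])
    fix F :: "'s set" assume F: "finite F"
    have "(\<Sum>y\<in>F. p x y * (\<Sum>k<n. hop l k y a)) \<le> (l + total_rate x) * green l x a - of_bool (x = a)" for n
    proof -
      have "(\<Sum>y\<in>F. p x y * (\<Sum>k<n. hop l k y a)) \<le> (\<Sum>\<^sub>\<infinity>y. p x y * (\<Sum>k<n. hop l k y a))"
        using F by (intro finite_sum_le_infsum row_weighted_summable[OF b])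
          (auto intro!: mult_nonneg_nonneg sum_nonneg rate_nonneg hop_nonneg)
      also have "\<dots> = (l + total_rate x) * ((\<Sum>k<Suc n. hop l k x a) - hop l 0 x a)"
        using hop_partial_sums[of x a n] denom_pos[of x] by (auto simp: field_simps)
      also have "\<dots> \<le> (l + total_rate x) * (green l x a - hop l 0 x a)"
        using denom_pos[of x] hop_partial_le_green[of x a "Suc n"] by (intro mult_left_mono) auto
      also have "\<dots> = (l + total_rate x) * green l x a - of_bool (x = a)"
        using less_imp_neq[OF denom_pos[of x]] by (auto simp: right_diff_distrib)
      finally show ?thesis .
    qed
    moreover have "(\<lambda>n. \<Sum>y\<in>F. p x y * (\<Sum>k<n. hop l k y a)) \<longlonglongrightarrow> (\<Sum>y\<in>F. p x y * green l y a)"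
      unfolding green_def by (intro tendsto_intros summable_LIMSEQ hop_summable)
    ultimately show "(\<Sum>y\<in>F. p x y * green l y a) \<le> (l + total_rate x) * green l x a - of_bool (x = a)"
      by (intro LIMSEQ_le_const2) auto
  qed
  then show "of_bool (x = a) + (\<Sum>\<^sub>\<infinity>y. p x y * green l y a) \<le> (l + total_rate x) * green l x a"
    by simp
qed

lemma green_equation: "l * green l x a - drift p (\<lambda>y. green l y a) x = of_bool (x = a)"
  using green_fixpoint[of x a] drift_eq[where W = "\<lambda>y. green l y a", OF green_abs_le, of x]
  by (simp add: algebra_simps)

text \<open>\<open>hop\<close> is defined by its first jump; this is the decomposition by the last
  one. Exchanging the sums needs joint summability, where symmetry of \<open>p\<close> controls the
  column sums. The two decompositions together turn symmetry of \<open>p\<close> into symmetry of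
  \<open>hop\<close>.\<close>

lemma hop_Suc_right: "hop l (Suc k) x a = (\<Sum>\<^sub>\<infinity>y. hop l k x y * p y a) / (l + total_rate a)"
proof (induction k arbitrary: x)
  case 0
  have "(\<Sum>\<^sub>\<infinity>y. p x y * hop l 0 y a) = p x a * hop l 0 a a"
    by (rule infsum_single) auto
  moreover have "(\<Sum>\<^sub>\<infinity>y. hop l 0 x y * p y a) = hop l 0 x x * p x a"
    by (rule infsum_single) auto
  ultimately show ?case by simp
next
  case (Suc k)
  have hb: "\<bar>hop l k y z\<bar> \<le> 1 / l" for y z using hop_nonneg hop_le by auto
  have cs: "(\<lambda>z. p z a * hop l k y z) summable_on UNIV" for y
  proof -
    have "(\<lambda>z. p a z * hop l k y z) summable_on UNIV" by (rule row_weighted_summable[OF hb])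
    moreover have "p a z = p z a" for z by (rule sym)
    ultimately show ?thesis by simp
  qed
  have inner: "((\<lambda>z. p x y * hop l k y z * p z a) has_sum p x y * (\<Sum>\<^sub>\<infinity>z. p z a * hop l k y z)) UNIV" for y
    using has_sum_cmult_right[OF has_sum_infsum[OF cs[of y]], of "p x y"] by (simp add: mult_ac)
  have le: "\<bar>\<Sum>\<^sub>\<infinity>z. p z a * hop l k y z\<bar> \<le> C / l" for y
  proof -
    have "(\<Sum>\<^sub>\<infinity>z. p z a * hop l k y z) \<le> (\<Sum>\<^sub>\<infinity>z. p a z * (1 / l))"
    proof (rule infsum_mono[OF cs])
      show "(\<lambda>z. p a z * (1 / l)) summable_on UNIV"
        using row_summable by (rule summable_on_cmult_left)
      show "p z a * hop l k y z \<le> p a z * (1 / l)" for z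
        unfolding sym[of z a] by (intro mult_left_mono rate_nonneg hop_le)
    qed
    also have "\<dots> = total_rate a * (1 / l)"
      unfolding total_rate_def by (rule infsum_cmult_left) (use row_summable in auto)
    also have "\<dots> \<le> C / l" using total_rate_le[of a] l_pos by (simp add: divide_right_mono)
    finally show ?thesis
      by (simp add: infsum_nonneg rate_nonneg hop_nonneg)
  qed
  have prod: "(\<lambda>(y, z). p x y * hop l k y z * p z a) summable_on UNIV \<times> UNIV"
    by (rule summable_on_SigmaI[where g = "\<lambda>y. p x y * (\<Sum>\<^sub>\<infinity>z. p z a * hop l k y z)"])
      (auto intro!: row_weighted_summable[OF le] mult_nonneg_nonneg rate_nonneg hop_nonneg inner)
  have "hop l (Suc (Suc k)) x a = (\<Sum>\<^sub>\<infinity>y. p x y * hop l (Suc k) y a) / (l + total_rate x)"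
    by simp
  also have "(\<Sum>\<^sub>\<infinity>y. p x y * hop l (Suc k) y a)
      = (\<Sum>\<^sub>\<infinity>y. (\<Sum>\<^sub>\<infinity>z. p x y * hop l k y z * p z a) / (l + total_rate a))"
    unfolding Suc by (simp add: infsum_cmult_right'[symmetric] mult.assoc)
  also have "\<dots> = (\<Sum>\<^sub>\<infinity>y. \<Sum>\<^sub>\<infinity>z. p x y * hop l k y z * p z a) / (l + total_rate a)"
    using infsum_cmult_left'[of _ "1 / (l + total_rate a)"] by simp
  also have "(\<Sum>\<^sub>\<infinity>y. \<Sum>\<^sub>\<infinity>z. p x y * hop l k y z * p z a)
      = (\<Sum>\<^sub>\<infinity>z. \<Sum>\<^sub>\<infinity>y. p x y * hop l k y z * p z a)"
    using prod by (rule infsum_swap_banach)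
  also have "\<dots> = (\<Sum>\<^sub>\<infinity>z. (l + total_rate x) * (hop l (Suc k) x z * p z a))"
    using denom_pos[of x] by (simp add: infsum_cmult_left')
  also have "\<dots> = (l + total_rate x) * (\<Sum>\<^sub>\<infinity>z. hop l (Suc k) x z * p z a)"
    by (rule infsum_cmult_right')
  finally show ?case using denom_pos[of x] by simp
qed

lemma hop_sym: "hop l k x a = hop l k a x"
proof (induction k arbitrary: x a)
  case (Suc k)
  have "hop l (Suc k) x a = (\<Sum>\<^sub>\<infinity>y. hop l k a y * p y x) / (l + total_rate x)"
    using Suc sym by (simp add: mult.commute)
  also have "\<dots> = hop l (Suc k) a x" by (rule hop_Suc_right[symmetric])
  finally show ?case .
qed auto

lemma green_sym: "green l x a = green l a x"
  unfolding green_def using hop_sym by simp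

text \<open>Away from \<open>a\<close> the difference is a supersolution with right-hand side
  \<open>l * green l a a\<close>, and at \<open>a\<close> it vanishes, so the maximum principle
  applies with the point \<open>a\<close> exempted.\<close>

lemma green_le_diag: "green l x a \<le> green l a a"
proof -
  have "0 \<le> green l a a + (-1) * green l x a"
  proof (rule maximum_principle[where l = l and K = "1 / l + 1 / l"
        and W = "\<lambda>x. green l a a + (-1) * green l x a"])
    show "\<bar>green l a a + (-1) * green l y a\<bar> \<le> 1 / l + 1 / l" for y
      using green_abs_le[of a a] green_abs_le[of y a] by linarith
    fix y
    have "drift p (\<lambda>x. green l a a + (-1) * green l x a) y = - drift p (\<lambda>x. green l x a) y"
      using drift_add[of "\<lambda>_. green l a a" "1 / l" "\<lambda>x. (-1) * green l x a" "1 / l" y]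
        drift_cmult[of "-1" "\<lambda>x. green l x a" y] green_abs_le by simp
    then show "0 \<le> green l a a + (-1) * green l y a \<or>
        0 \<le> l * (green l a a + (-1) * green l y a)
            - drift p (\<lambda>x. green l a a + (-1) * green l x a) y"
      using green_equation[of y a] green_nonneg[of a a] l_pos by (cases "y = a") (auto simp: algebra_simps)
  qed (rule l_pos)
  then show ?thesis by simp
qed

text \<open>In electrical terms, the current through one edge at \<open>a\<close> is at most the
  unit current injected there: on the diagonal \<open>green\<close> is maximal, so all terms of the
  drift at \<open>a\<close> have one sign and add up to at least -1. The bound is free of
  \<open>l\<close>, which lets a changed rate be absorbed uniformly.\<close>

lemma rate_mult_green_diff_le: "p a y * (green l a a - green l y a) \<le> 1"
proof -
  have "- (p a y * (green l y a - green l a a)) \<le> - drift p (\<lambda>y. green l y a) a"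
  proof -
    have "drift p (\<lambda>y. green l y a) a \<le> (\<Sum>\<^sub>\<infinity>z. if z = y then p a y * (green l y a - green l a a) else 0)"
      unfolding drift_def
      by (rule infsum_mono[OF drift_terms_summable[OF green_abs_le]])
        (auto intro!: infsum_single(1)[where a = y] mult_nonneg_nonpos rate_nonneg simp: green_le_diag)
    also have "\<dots> = p a y * (green l y a - green l a a)"
      using infsum_single(2)[where a = y and f = "\<lambda>z. if z = y then p a y * (green l y a - green l a a) else 0"]
      by auto
    finally show ?thesis by simp
  qed
  also have "\<dots> \<le> 1"
    using green_equation[of a a] mult_nonneg_nonneg[OF less_imp_le[OF l_pos] green_nonneg[of a a]] by simp
  finally show ?thesis by (simp add: algebra_simps)
qed

text \<open>Keeping a single term of the fixed-point equation at \<open>a\<close> carries a bound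
  for the target \<open>a\<close> over to the target \<open>b\<close>; symmetry exchanges starting
  point and target.\<close>

lemma green_neighbour_le: "p a b * green l x b \<le> (l + C) * green l x a"
proof -
  have "p a b * green l b x \<le> (\<Sum>\<^sub>\<infinity>y. p a y * green l y x)"
    using finite_sum_le_infsum[OF row_weighted_summable[where W = "\<lambda>y. green l y x", OF green_abs_le], of "{b}" a]
    by (simp add: rate_nonneg green_nonneg)
  also have "\<dots> \<le> (l + total_rate a) * green l a x"
    using green_fixpoint[of a x] by simp
  also have "\<dots> \<le> (l + C) * green l a x"
    using total_rate_le by (intro mult_right_mono) (auto simp: green_nonneg)
  finally show ?thesis using green_sym by metis
qed

end

text \<open>The difference solves the equation with parameter \<open>k\<close> and right-hand side
  \<open>(l - k) * green l x a\<close>: the resolvent identity, read as a sign.\<close>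

lemma green_antimono:
  assumes "0 < k" "k \<le> l"
  shows "green l x a \<le> green k x a"
proof -
  have "0 < l" using assms by simp
  have "0 \<le> green k x a + (-1) * green l x a"
  proof (rule maximum_principle[where l = k and K = "1 / k + 1 / l"
        and W = "\<lambda>x. green k x a + (-1) * green l x a"])
    show "\<bar>green k y a + (-1) * green l y a\<bar> \<le> 1 / k + 1 / l" for y
      using green_abs_le[OF \<open>0 < k\<close>, of y a] green_abs_le[OF \<open>0 < l\<close>, of y a] by linarith
    fix y
    have "drift p (\<lambda>x. green k x a + (-1) * green l x a) y
        = drift p (\<lambda>x. green k x a) y + drift p (\<lambda>x. (-1) * green l x a) y"
      by (rule drift_add[where K = "1/k" and K' = "1/l"])
        (use green_abs_le[OF \<open>0 < k\<close>] green_abs_le[OF \<open>0 < l\<close>] in auto)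
    also have "drift p (\<lambda>x. (-1) * green l x a) y = (-1) * drift p (\<lambda>x. green l x a) y"
      by (rule drift_cmult)
    finally have "k * (green k y a + (-1) * green l y a) - drift p (\<lambda>x. green k x a + (-1) * green l x a) y
        = (l - k) * green l y a"
      using green_equation[OF \<open>0 < k\<close>, of y a] green_equation[OF \<open>0 < l\<close>, of y a]
      by (simp add: algebra_simps)
    also have "0 \<le> \<dots>" using assms green_nonneg[OF \<open>0 < l\<close>] by simp
    finally show "0 \<le> green k y a + (-1) * green l y a \<or>
      0 \<le> k * (green k y a + (-1) * green l y a) - drift p (\<lambda>x. green k x a + (-1) * green l x a) y" ..
  qed (rule assms)
  then show ?thesis by simp
qed

definition green_sum :: "real \<Rightarrow> 's set \<Rightarrow> 's \<Rightarrow> real" where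
  "green_sum l A x = (\<Sum>a\<in>A. green l x a)"

lemma green_sum_nonneg: "0 < l \<Longrightarrow> 0 \<le> green_sum l A x"
  unfolding green_sum_def by (intro sum_nonneg green_nonneg)

lemma green_sum_le: "0 < l \<Longrightarrow> green_sum l A x \<le> card A * (1 / l)"
  unfolding green_sum_def using sum_bounded_above[of A "green l x" "1 / l"] green_le by simp

lemma green_sum_antimono: "0 < k \<Longrightarrow> k \<le> l \<Longrightarrow> green_sum l A x \<le> green_sum k A x"
  unfolding green_sum_def by (intro sum_mono green_antimono)

lemma green_sum_equation:
  assumes "0 < l" "finite A"
  shows "l * green_sum l A x - drift p (green_sum l A) x = of_bool (x \<in> A)"
proof -
  have "drift p (green_sum l A) x = (\<Sum>a\<in>A. drift p (\<lambda>y. green l y a) x)"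
    unfolding green_sum_def by (rule drift_sum[OF assms(2) green_abs_le[OF assms(1)]])
  also have "\<dots> = (\<Sum>a\<in>A. l * green l x a - of_bool (x = a))"
    using green_equation[OF assms(1)] by (intro sum.cong) (auto simp: algebra_simps)
  also have "\<dots> = l * green_sum l A x - of_bool (x \<in> A)"
    using assms(2) by (simp add: sum_subtractf green_sum_def sum_distrib_left of_bool_def)
  finally show ?thesis by simp
qed

end

section \<open>Transience of the perturbed chain\<close>

lemma path_prob_shift:
  "path_prob K x (s + c) (map (\<lambda>(t, y). (t + c, y)) r) = path_prob K x s r"
  by (induction K x s r rule: path_prob.induct) auto

text \<open>Decomposing according to the last visit to \<open>x\<close> at an integer time shows that the expected
  number of such visits is the reciprocal of the escape probability.\<close>

lemma summable_return_probabilities: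
  fixes M :: "(real \<Rightarrow> 's) measure"
  assumes "prob_space M"
    and meas: "\<And>t. 0 \<le> t \<Longrightarrow> (\<lambda>\<omega>. \<omega> t) \<in> M \<rightarrow>\<^sub>M count_space UNIV"
    and fdd: "\<And>r. sorted (0 # map fst r) \<Longrightarrow>
      measure M {\<omega> \<in> space M. \<forall>(t, y)\<in>set r. \<omega> t = y} = path_prob K x 0 r"
    and K0: "K 0 x = return_pmf x"
    and bdd: "AE \<omega> in M. bdd_above {t. 0 \<le> t \<and> \<omega> t = x}"
  shows "summable (\<lambda>n. pmf (K (real n) x) x)"
proof -
  interpret prob_space M by fact
  have [measurable]: "Measurable.pred M (\<lambda>\<omega>. \<omega> (real n) = x)" for n :: nat
    using measurable_sets[OF meas[of "real n"], of "{x}"]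
    by (simp add: pred_def vimage_def Int_def conj_commute)
  define visits where "visits V = map (\<lambda>j. (real j, x)) (sorted_list_of_set V)" for V :: "nat set"
  have prob_visits: "prob {\<omega> \<in> space M. \<forall>j\<in>V. \<omega> (real j) = x} = path_prob K x 0 (visits V)"
    if "finite V" for V
  proof -
    have "sorted (0 # map fst (visits V))"
      by (simp add: visits_def comp_def sorted_map)
    from fdd[OF this] show ?thesis using that by (simp add: visits_def)
  qed
  \<comment> \<open>The finite-dimensional laws give probabilities of being at \<open>x\<close>
    only; events with forbidden times \<open>B\<close> are reached from them by removing one time
    after another. The offset \<open>n\<close> compares an event with its copy after a restart at
    time \<open>n\<close>.\<close>
  define H where "H n V B = prob {\<omega> \<in> space M. (\<forall>j\<in>V. \<omega> (real (n + j)) = x) \<and> (\<forall>j\<in>B. \<omega> (real (n + j)) \<noteq> x)}"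
    for n :: nat and V B :: "nat set"
  have H_Suc: "H n V {1..Suc m} = H n V {1..m} - H n (insert (Suc m) V) {1..m}" for n V m
  proof -
    have "H n V {1..Suc m} = prob ({\<omega> \<in> space M. (\<forall>j\<in>V. \<omega> (real (n + j)) = x)
        \<and> (\<forall>j\<in>{1..m}. \<omega> (real (n + j)) \<noteq> x)} - {\<omega> \<in> space M.
        (\<forall>j\<in>insert (Suc m) V. \<omega> (real (n + j)) = x) \<and> (\<forall>j\<in>{1..m}. \<omega> (real (n + j)) \<noteq> x)})"
      unfolding H_def by (rule arg_cong[where f = prob]) (auto simp: atLeastAtMostSuc_conv)
    also have "\<dots> = H n V {1..m} - H n (insert (Suc m) V) {1..m}"
      unfolding H_def by (rule finite_measure_Diff) (measurable, auto)
    finally show ?thesis .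
  qed
  \<comment> \<open>The Markov property at time \<open>n\<close>. The induction runs over the number
    of forbidden times, with \<open>V\<close> arbitrary because \<open>H_Suc\<close> adds
    \<open>Suc m\<close> to the required visits.\<close>
  have H_renewal: "H n (insert 0 V) {1..m} = pmf (K (real n) x) x * H 0 V {1..m}" if "finite V" "0 \<notin> V" for n V m
    using that
  proof (induction m arbitrary: V)
    case 0
    have "sorted_list_of_set (insert n ((+) n ` V)) = n # map ((+) n) (sorted_list_of_set V)"
    proof (rule sorted_list_of_set.idem_if_sorted_distinct[symmetric, THEN trans, symmetric])
      show "sorted_list_of_set (set (n # map ((+) n) (sorted_list_of_set V))) = sorted_list_of_set (insert n ((+) n ` V))"
        using 0 by simp
      show "sorted (n # map ((+) n) (sorted_list_of_set V))"
        by (auto simp: sorted_map intro: sorted_wrt_mono_rel[OF _ sorted_sorted_list_of_set])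
      show "distinct (n # map ((+) n) (sorted_list_of_set V))"
        using 0 by (auto simp: distinct_map)
    qed
    then have "visits (insert n ((+) n ` V))
        = (real n, x) # map (\<lambda>(t, y). (t + real n, y)) (visits V)"
      by (simp add: visits_def comp_def add.commute)
    then have "path_prob K x 0 (visits (insert n ((+) n ` V)))
        = pmf (K (real n) x) x * path_prob K x 0 (visits V)"
      using path_prob_shift[of K x 0 "real n" "visits V"] by simp
    with prob_visits[of V] prob_visits[of "insert n ((+) n ` V)"] 0
    show ?case by (simp add: H_def)
  next
    case (Suc m)
    then show ?case
      using H_Suc[of n "insert 0 V" m] H_Suc[of 0 V m] Suc.IH[of "insert (Suc m) V"]
      by (simp add: insert_commute right_diff_distrib)
  qed
  define last where "last n = {\<omega> \<in> space M. \<omega> (real n) = x \<and> (\<forall>j\<ge>1. \<omega> (real (n + j)) \<noteq> x)}" for n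
  define \<theta> where "\<theta> = prob {\<omega> \<in> space M. \<forall>j\<ge>1. \<omega> (real j) \<noteq> x}"
  have all_iff: "(\<forall>m. \<forall>j\<in>{1..m}. P j) \<longleftrightarrow> (\<forall>j\<ge>1. P j)" for P :: "nat \<Rightarrow> bool"
    by (meson atLeastAtMost_iff order_refl)
  have last_sets: "last n \<in> sets M" for n
    unfolding last_def by measurable
  have H_lim: "(\<lambda>m. H n V {1..m}) \<longlonglongrightarrow>
      prob {\<omega> \<in> space M. (\<forall>j\<in>V. \<omega> (real (n + j)) = x) \<and> (\<forall>j\<ge>1. \<omega> (real (n + j)) \<noteq> x)}" for n V
  proof -
    define S where "S m = {\<omega> \<in> space M. (\<forall>j\<in>V. \<omega> (real (n + j)) = x) \<and> (\<forall>j\<in>{1..m}. \<omega> (real (n + j)) \<noteq> x)}" for m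
    have "S m \<in> sets M" for m unfolding S_def by measurable
    then have "(\<lambda>m. prob (S m)) \<longlonglongrightarrow> prob (\<Inter>m. S m)"
      by (intro finite_Lim_measure_decseq) (auto simp: decseq_def S_def)
    also have "(\<Inter>m. S m) = {\<omega> \<in> space M. (\<forall>j\<in>V. \<omega> (real (n + j)) = x) \<and> (\<forall>j\<ge>1. \<omega> (real (n + j)) \<noteq> x)}"
      unfolding all_iff[symmetric] by (auto simp: S_def)
    finally show ?thesis by (simp add: H_def S_def)
  qed
  have "(\<lambda>m. H n {0} {1..m}) \<longlonglongrightarrow> prob (last n)" for n
    using H_lim[of n "{0}"] by (simp add: last_def)
  moreover have "(\<lambda>m. H n {0} {1..m}) \<longlonglongrightarrow> pmf (K (real n) x) x * \<theta>" for n
    using tendsto_mult_left[OF H_lim[of 0 "{}"], of "pmf (K (real n) x) x"] H_renewal[of "{}" n]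
    by (simp add: \<theta>_def)
  ultimately have prob_last: "prob (last n) = pmf (K (real n) x) x * \<theta>" for n
    using LIMSEQ_unique by blast
  have "disjoint_family last"
  proof -
    have False if "\<omega> \<in> last m" "\<omega> \<in> last n" "m < n" for \<omega> m n
      using that by (auto simp: last_def dest!: spec[of _ "n - m"])
    then have "last m \<inter> last n = {}" if "m \<noteq> n" for m n
      using that by (meson disjoint_iff linorder_neqE_nat)
    then show ?thesis by (auto simp: disjoint_family_on_def)
  qed
  then have "(\<lambda>n. prob (last n)) sums prob (\<Union>n. last n)"
    using last_sets by (intro finite_measure_UNION) auto
  moreover have "prob (\<Union>n. last n) = 1"
  proof -
    have start: "AE \<omega> in M. \<omega> 0 = x"
    proof -
      have "prob {\<omega> \<in> space M. \<forall>(t, y)\<in>set [(0, x)]. \<omega> t = y} = 1"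
        using fdd[of "[(0, x)]"] K0 by simp
      from AE_prob_1[OF this] show ?thesis by (rule AE_mp) auto
    qed
    have "AE \<omega> in M. \<omega> \<in> (\<Union>n. last n)"
      using bdd start AE_space
    proof eventually_elim
      case (elim \<omega>)
      define N where "N = {n::nat. \<omega> (real n) = x}"
      obtain b where b: "\<And>t. 0 \<le> t \<Longrightarrow> \<omega> t = x \<Longrightarrow> t \<le> b"
        using elim(1) by (auto simp: bdd_above_def)
      have "finite N"
      proof (rule finite_subset)
        have "n \<le> nat \<lceil>b\<rceil>" if "n \<in> N" for n
        proof -
          have "real n \<le> b" using b that by (simp add: N_def)
          then show ?thesis using real_nat_ceiling_ge[of b] by linarith
        qed
        then show "N \<subseteq> {..nat \<lceil>b\<rceil>}" by auto
      qed simp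
      moreover have "0 \<in> N" using elim(2) by (simp add: N_def)
      ultimately have "Max N \<in> N" "\<And>j. j \<in> N \<Longrightarrow> j \<le> Max N" by (auto intro: Max_in)
      then have "\<omega> \<in> last (Max N)"
      proof -
        have "\<omega> (real (Max N + j)) \<noteq> x" if "1 \<le> j" for j
        proof
          assume "\<omega> (real (Max N + j)) = x"
          then have "Max N + j \<in> N" unfolding N_def by blast
          then have "Max N + j \<le> Max N" by (rule \<open>\<And>j. j \<in> N \<Longrightarrow> j \<le> Max N\<close>)
          with that show False by simp
        qed
        then show ?thesis using elim(3) \<open>Max N \<in> N\<close> by (simp add: last_def N_def)
      qed
      then show ?case by blast
    qed
    then show ?thesis using last_sets by (subst prob_eq_1) auto
  qed
  ultimately have sums: "(\<lambda>n. pmf (K (real n) x) x * \<theta>) sums 1" by (simp add: prob_last)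
  \<comment> \<open>The last-visit events partition almost all paths, so the series multiplied by
    the escape probability \<open>\<theta>\<close> has sum 1. This excludes
    \<open>\<theta> = 0\<close> and lets it be divided out.\<close>
  then have "\<theta> \<noteq> 0" using sums_unique2[OF sums sums_0] by auto
  then show ?thesis using sums_mult2[OF sums, of "1 / \<theta>"] by (auto simp: summable_def)
qed

lemma integrable_pmf_bounded:
  assumes "\<And>y. \<bar>f y\<bar> \<le> (b::real)"
  shows "integrable (measure_pmf M) f"
  by (rule measure_pmf.integrable_const_bound[where B = b]) (use assms in auto)

text \<open>Continuous induction. The chain provides its derivative only from the right at time 0,
  so growth is known just for some small step to the right of each time; continuity makes the set of
  times reached closed, and a step from its supremum would leave it.\<close>

lemma growth_from_right_increments:
  fixes y :: "real \<Rightarrow> real"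
  assumes cont: "continuous_on {0..1} y"
    and incr: "\<And>t. 0 \<le> t \<Longrightarrow> t < 1 \<Longrightarrow> \<exists>h>0. t + h \<le> 1 \<and> y t - c * h \<le> y (t + h)"
  shows "y 0 - c \<le> y 1"
proof -
  define A where "A = {t \<in> {0..1}. y 0 - c * t \<le> y t}"
  have "closed A"
    unfolding A_def by (intro continuous_on_closed_Collect_le continuous_intros cont)
  moreover have "0 \<in> A" by (simp add: A_def)
  moreover have bdd: "bdd_above A" by (auto simp: A_def intro: bdd_aboveI[of _ 1])
  ultimately have s: "Sup A \<in> A" using closed_contains_Sup by blast
  have "Sup A = 1"
  proof (rule ccontr)
    assume "Sup A \<noteq> 1"
    with s have "0 \<le> Sup A" "Sup A < 1" by (auto simp: A_def)
    from incr[OF this] obtain h where h: "0 < h" "Sup A + h \<le> 1" "y (Sup A) - c * h \<le> y (Sup A + h)"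
      by blast
    with s have "Sup A + h \<in> A" by (auto simp: A_def algebra_simps)
    from cSup_upper[OF this bdd] h(1) show False by simp
  qed
  with s show ?thesis by (simp add: A_def)
qed

lemma continuous_on_forward_Lipschitz:
  fixes f :: "real \<Rightarrow> real"
  assumes "\<And>s h. 0 \<le> s \<Longrightarrow> 0 \<le> h \<Longrightarrow> \<bar>f (s + h) - f s\<bar> \<le> D * h"
  shows "continuous_on {0..1} f"
proof -
  have *: "\<bar>f s - f t\<bar> \<le> \<bar>D\<bar> * \<bar>s - t\<bar>" if "0 \<le> t" "t \<le> s" for s t
    using assms[of t "s - t"] that by (simp add: order_trans[OF _ mult_right_mono[OF abs_ge_self]])
  have "\<bar>D\<bar>-lipschitz_on {0..1} f"
  proof (rule lipschitz_onI)
    show "dist (f s) (f t) \<le> \<bar>D\<bar> * dist s t" if "s \<in> {0..1}" "t \<in> {0..1}" for s t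
      using *[of s t] *[of t s] that by (cases "t \<le> s") (auto simp: dist_real_def abs_minus_commute)
  qed simp
  then show ?thesis by (rule lipschitz_on_continuous_on)
qed

section \<open>Estimates for a transition function with bounded rates\<close>

locale chain_semigroup = bounded_rates q C
  for q :: "'s::countable \<Rightarrow> 's \<Rightarrow> real" and C +
  fixes K :: "real \<Rightarrow> 's \<Rightarrow> 's pmf"
  assumes chain: "chain_transition_function q K"
begin

lemma K_0: "K 0 x = return_pmf x"
  using chain by (simp add: chain_transition_function_def)

lemma K_add: "0 \<le> s \<Longrightarrow> 0 \<le> t \<Longrightarrow> K (s + t) x = bind_pmf (K s x) (K t)"
  using chain by (simp add: chain_transition_function_def)

lemma K_mult_le:
  assumes "0 \<le> s" "0 \<le> t"
  shows "pmf (K s x) z * pmf (K t z) y \<le> pmf (K (s + t) x) y"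
proof -
  have "pmf (K s x) z * pmf (K t z) y = measure_pmf.expectation (K s x) (\<lambda>w. indicat_real {z} w * pmf (K t z) y)"
    by (simp add: measure_pmf_single)
  also have "\<dots> \<le> measure_pmf.expectation (K s x) (\<lambda>w. pmf (K t w) y)"
    by (intro integral_mono measure_pmf.integrable_const_bound[where B = 1])
      (auto simp: pmf_le_1 indicator_def)
  also have "\<dots> = pmf (K (s + t) x) y" by (simp add: K_add[OF assms] pmf_bind)
  finally show ?thesis .
qed

lemma holding_power_le: "0 \<le> s \<Longrightarrow> pmf (K s x) x ^ n \<le> pmf (K (of_nat n * s) x) x"
proof (induction n)
  case (Suc n)
  have "pmf (K s x) x ^ Suc n \<le> pmf (K s x) x * pmf (K (of_nat n * s) x) x"
    using Suc by (simp add: mult_left_mono)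
  also have "\<dots> \<le> pmf (K (s + of_nat n * s) x) x" using Suc.prems by (intro K_mult_le) auto
  finally show ?case by (simp add: algebra_simps)
qed (simp add: K_0)

lemma K_quotient_tendsto:
  assumes "h \<longlonglongrightarrow> 0" "\<And>n. 0 < h n"
  shows "(\<lambda>n. (pmf (K (h n) x) y - of_bool (x = y)) / h n) \<longlonglongrightarrow> rate_matrix q x y"
proof -
  have "((\<lambda>t. pmf (K t x) y) has_real_derivative rate_matrix q x y) (at 0 within {0..})"
    using chain by (simp add: chain_transition_function_def)
  then have "((\<lambda>t. (pmf (K t x) y - pmf (K 0 x) y) / (t - 0)) \<longlongrightarrow> rate_matrix q x y) (at 0 within {0..})"
    by (simp add: has_field_derivative_iff)
  moreover have "filterlim h (at 0 within {0..}) sequentially"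
    unfolding filterlim_at using assms by (auto intro!: always_eventually simp: less_imp_le less_imp_neq[symmetric])
  ultimately have "(\<lambda>n. (pmf (K (h n) x) y - pmf (K 0 x) y) / (h n - 0)) \<longlonglongrightarrow> rate_matrix q x y"
    by (rule filterlim_compose)
  then show ?thesis by (auto simp: K_0 pmf_return of_bool_def)
qed

lemma rate_matrix_diag_ge: "- C \<le> rate_matrix q x x"
proof -
  have "(\<Sum>\<^sub>\<infinity>z\<in>- {x}. q x z) \<le> (\<Sum>\<^sub>\<infinity>z. q x z)"
    by (intro infsum_mono2 row_summable summable_on_subset_banach[OF row_summable]) (auto simp: rate_nonneg)
  then show ?thesis using row_sum_le[of x] by (simp add: rate_matrix_def)
qed

text \<open>The derivative at time 0 is a limit that is not given uniformly in the state. Cutting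
  \<open>s\<close> into many equal pieces and applying Bernoulli's inequality turns it into a bound
  valid for all times and states, with the common rate bound \<open>C\<close>.\<close>

lemma holding_ge:
  assumes "0 \<le> s" shows "1 - C * s \<le> pmf (K s x) x"
proof (cases "s = 0")
  case False
  with assms have "0 < s" by simp
  define h where "h n = s / real (Suc n)" for n
  have h: "h \<longlonglongrightarrow> 0" "\<And>n. 0 < h n"
    using \<open>0 < s\<close> LIMSEQ_Suc[OF lim_const_over_n[of s]] by (auto simp: h_def[abs_def])
  have "1 + s * ((pmf (K (h n) x) x - 1) / h n) \<le> pmf (K s x) x" for n
  proof -
    have "1 + s * ((pmf (K (h n) x) x - 1) / h n) = 1 + real (Suc n) * (pmf (K (h n) x) x - 1)"
      using \<open>0 < s\<close> by (simp add: h_def field_simps)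
    also have "\<dots> \<le> (1 + (pmf (K (h n) x) x - 1)) ^ Suc n"
      by (rule Bernoulli_inequality) simp
    also have "\<dots> \<le> pmf (K (of_nat (Suc n) * h n) x) x"
      using holding_power_le[of "h n" x "Suc n"] h(2)[of n] by simp
    also have "of_nat (Suc n) * h n = s" by (simp add: h_def)
    finally show ?thesis .
  qed
  moreover have "(\<lambda>n. 1 + s * ((pmf (K (h n) x) x - 1) / h n)) \<longlonglongrightarrow> 1 + s * rate_matrix q x x"
    using K_quotient_tendsto[OF h, of x x] by (intro tendsto_intros) simp
  ultimately have "1 + s * rate_matrix q x x \<le> pmf (K s x) x"
    by (intro LIMSEQ_le_const2) auto
  moreover have "s * (- C) \<le> s * rate_matrix q x x"
    using rate_matrix_diag_ge assms by (intro mult_left_mono) auto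
  ultimately show ?thesis by (simp add: mult.commute)
qed (simp add: K_0)

text \<open>The linear bound says nothing once \<open>C * t\<close> exceeds 1, so the time is cut
  into \<open>n > C\<close> pieces and the bound for one piece is raised to the power
  \<open>n\<close>.\<close>

lemma holding_bounded_below: "\<exists>\<kappa>>0. \<forall>t\<in>{0..1}. \<forall>x. \<kappa> \<le> pmf (K t x) x"
proof -
  obtain n :: nat where n: "C < real n" using reals_Archimedean2 by blast
  with C_nonneg have "0 < real n" by linarith
  have pos: "0 < 1 - C / n" using n \<open>0 < real n\<close> by simp
  have "(1 - C / n) ^ n \<le> pmf (K t x) x" if "t \<in> {0..1}" for t x
  proof -
    have "C * (t / n) \<le> C / n"
      using that C_nonneg \<open>0 < real n\<close> by (simp add: divide_right_mono mult_left_le)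
    then have "1 - C / n \<le> pmf (K (t / n) x) x"
      using holding_ge[of "t / n" x] that by simp
    then have "(1 - C / n) ^ n \<le> pmf (K (t / n) x) x ^ n"
      using pos by (intro power_mono) auto
    also have "\<dots> \<le> pmf (K (of_nat n * (t / n)) x) x"
      using that by (intro holding_power_le) auto
    finally show ?thesis using \<open>0 < real n\<close> by simp
  qed
  moreover have "0 < (1 - C / n) ^ n" using pos by simp
  ultimately show ?thesis by blast
qed

definition act :: "real \<Rightarrow> ('s \<Rightarrow> real) \<Rightarrow> 's \<Rightarrow> real" where
  "act t g x = measure_pmf.expectation (K t x) g"

context
  fixes g :: "'s \<Rightarrow> real" and B :: real
  assumes g: "\<And>x. 0 \<le> g x" "\<And>x. g x \<le> B"
begin

lemma g_integrable: "integrable (measure_pmf M) g"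
  by (rule measure_pmf.integrable_const_bound[where B = B]) (use g in auto)

lemma act_bounds: "0 \<le> act t g x" "act t g x \<le> B"
proof -
  show "0 \<le> act t g x" unfolding act_def by (intro integral_nonneg_AE always_eventually allI g)
  have "act t g x \<le> measure_pmf.expectation (K t x) (\<lambda>_. B)"
    unfolding act_def by (intro integral_mono g_integrable) (use g in auto)
  then show "act t g x \<le> B" by simp
qed

lemma act_add: "0 \<le> s \<Longrightarrow> 0 \<le> t \<Longrightarrow> act (s + t) g x = act s (act t g) x"
  unfolding act_def K_add measure_pmf_bind
  by (rule integral_bind[where B = B and K = "count_space UNIV" and B' = 1])
    (use g in \<open>auto simp: measure_pmf_in_subprob_algebra space_subprob_algebra measure_pmf.finite_measure_axioms measure_pmf.subprob_space_axioms\<close>)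

lemma act_0: "act 0 g x = g x"
  by (simp add: act_def K_0)

lemma act_diff_le:
  assumes "0 \<le> h"
  shows "\<bar>act h g x - g x\<bar> \<le> B * C * h"
proof -
  have ind: "measure_pmf.expectation (K h x) (\<lambda>y. c * indicat_real {x} y) = c * pmf (K h x) x" for c
    by (simp add: measure_pmf_single)
  have B: "0 \<le> B" using g[of x] by simp
  have "measure_pmf.expectation (K h x) (\<lambda>y. g x * indicat_real {x} y) \<le> act h g x"
    unfolding act_def
  proof (rule integral_mono[OF _ g_integrable])
    show "g x * indicat_real {x} y \<le> g y" for y
      using g(1)[of y] by (cases "y = x") auto
  qed (intro integrable_mult_right integrable_pmf_bounded[where b = 1]; simp)
  moreover have "act h g x \<le> measure_pmf.expectation (K h x) (\<lambda>y. (g x + B) + (- B) * indicat_real {x} y)"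
    unfolding act_def
  proof (rule integral_mono[OF g_integrable])
    show "g y \<le> (g x + B) + (- B) * indicat_real {x} y" for y
      using g(1)[of x] g(2)[of y] by (cases "y = x") auto
  qed (intro Bochner_Integration.integrable_add integrable_mult_right measure_pmf.integrable_const
      integrable_pmf_bounded[of "indicat_real {x}" 1]; simp)
  then have "act h g x \<le> g x + (B - B * pmf (K h x) x)"
    using ind[of "- B"]
    by (subst (asm) Bochner_Integration.integral_add)
      (auto intro!: integrable_mult_right integrable_pmf_bounded[where b = 1])
  moreover have "B - B * pmf (K h x) x \<le> B * C * h"
    using mult_left_mono[OF holding_ge[OF assms, of x] B] by (simp add: algebra_simps)
  moreover have "g x - g x * pmf (K h x) x \<le> B * C * h"
  proof -
    have "g x * (1 - pmf (K h x) x) \<le> B * (1 - pmf (K h x) x)"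
      using g[of x] by (intro mult_right_mono) (auto simp: pmf_le_1)
    then show ?thesis using \<open>B - B * pmf (K h x) x \<le> B * C * h\<close> by (simp add: algebra_simps)
  qed
  ultimately show ?thesis using ind[of "g x"] by linarith
qed

text \<open>Rates converge entrywise, so a finite set of targets recovers the drift up to
  \<open>e\<close>, and since \<open>g\<close> is nonnegative the remaining targets can only
  increase the expectation. Subsolutions need exactly this side.\<close>

lemma act_quotient_lower:
  assumes h: "h \<longlonglongrightarrow> 0" "\<And>n. 0 < h n" and "0 < e"
  shows "\<forall>\<^sub>F n in sequentially. drift q g x - e \<le> (act (h n) g x - g x) / h n"
proof -
  have gb: "\<bar>g y\<bar> \<le> B" for y using g[of y] by simp
  define r where "r = (\<lambda>y. q x y * g y)"
  have rs: "r summable_on - {x}"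
    unfolding r_def by (rule summable_on_subset_banach[OF row_weighted_summable[OF gb]]) auto
  obtain F where F: "finite F" "F \<subseteq> - {x}" and "dist (sum r F) (infsum r (- {x})) \<le> e / 2"
    using infsum_finite_approximation[OF rs, of "e / 2"] \<open>0 < e\<close> by auto
  then have rF: "infsum r (- {x}) - e < sum r F"
    using \<open>0 < e\<close> abs_le_D2[of "sum r F - infsum r (- {x})" "e / 2"] unfolding dist_real_def by linarith
  have dr: "drift q g x = infsum r (- {x}) + rate_matrix q x x * g x"
  proof -
    have s1: "q x summable_on - {x}" by (rule summable_on_subset_banach[OF row_summable]) auto
    have "drift q g x = (\<Sum>\<^sub>\<infinity>y\<in>- {x}. q x y * (g y - g x))"
      unfolding drift_def by (rule infsum_cong_neutral) auto
    also have "\<dots> = (\<Sum>\<^sub>\<infinity>y\<in>- {x}. r y + q x y * - g x)"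
      by (simp add: r_def algebra_simps)
    also have "\<dots> = infsum r (- {x}) + (\<Sum>\<^sub>\<infinity>y\<in>- {x}. q x y * - g x)"
      by (intro infsum_add rs summable_on_cmult_left s1)
    also have "(\<Sum>\<^sub>\<infinity>y\<in>- {x}. q x y * - g x) = rate_matrix q x x * g x"
      using infsum_cmult_left[of "- g x" "q x" "- {x}"] s1 by (simp add: rate_matrix_def)
    finally show ?thesis .
  qed
  have "(\<lambda>n. (\<Sum>y\<in>F. (pmf (K (h n) x) y - of_bool (x = y)) / h n * g y)
        + (pmf (K (h n) x) x - of_bool (x = x)) / h n * g x)
      \<longlonglongrightarrow> (\<Sum>y\<in>F. rate_matrix q x y * g y) + rate_matrix q x x * g x"
    by (intro tendsto_intros K_quotient_tendsto h)
  also have "(\<Sum>y\<in>F. rate_matrix q x y * g y) = sum r F"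
    using F(2) by (intro sum.cong) (auto simp: rate_matrix_def r_def)
  finally have "\<forall>\<^sub>F n in sequentially. drift q g x - e < (\<Sum>y\<in>F. (pmf (K (h n) x) y - of_bool (x = y)) / h n * g y)
        + (pmf (K (h n) x) x - of_bool (x = x)) / h n * g x"
    by (rule order_tendstoD(1)) (use rF dr in linarith)
  then show ?thesis
  proof eventually_elim
    case (elim n)
    have xF: "x \<notin> F" using F(2) by auto
    have "(\<Sum>y\<in>insert x F. pmf (K (h n) x) y * g y) = measure_pmf.expectation (K (h n) x) (\<lambda>y. g y * indicat_real (insert x F) y)"
      using F(1) by (subst integral_measure_pmf[of "insert x F"])
        (auto simp: mult_ac indicator_def split: if_splits intro!: sum.cong)
    also have "\<dots> \<le> act (h n) g x"
      unfolding act_def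
    proof (rule integral_mono[OF _ g_integrable])
      show "g y * indicat_real (insert x F) y \<le> g y" for y
        using g(1)[of y] by (auto simp: indicator_def)
      show "integrable (measure_pmf (K (h n) x)) (\<lambda>y. g y * indicat_real (insert x F) y)"
        using F(1) by (intro integrable_real_mult_indicator g_integrable) auto
    qed
    finally have *: "(\<Sum>y\<in>F. pmf (K (h n) x) y * g y) + pmf (K (h n) x) x * g x \<le> act (h n) g x"
      using xF F(1) by simp
    have eqF: "(\<Sum>y\<in>F. (pmf (K (h n) x) y - of_bool (x = y)) / h n * g y) = (\<Sum>y\<in>F. pmf (K (h n) x) y * g y) / h n"
      unfolding sum_divide_distrib using xF by (intro sum.cong) auto
    have "(\<Sum>y\<in>F. (pmf (K (h n) x) y - of_bool (x = y)) / h n * g y)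
        + (pmf (K (h n) x) x - of_bool (x = x)) / h n * g x
        = ((\<Sum>y\<in>F. pmf (K (h n) x) y * g y) + pmf (K (h n) x) x * g x - g x) / h n"
      unfolding eqF by (simp add: add_divide_distrib diff_divide_distrib algebra_simps)
    also have "\<dots> \<le> (act (h n) g x - g x) / h n"
      using * h(2)[of n] by (intro divide_right_mono) auto
    finally show ?case using elim by simp
  qed
qed


lemma drift_abs_le: "\<bar>drift q g x\<bar> \<le> B * C"
proof -
  have gb: "\<bar>g y\<bar> \<le> B" for y using g[of y] by simp
  have "0 \<le> B" using g[of x] by simp
  have "(\<Sum>\<^sub>\<infinity>y. q x y * g y) \<le> (\<Sum>\<^sub>\<infinity>y. q x y * B)"
    by (rule infsum_mono[OF row_weighted_summable[OF gb] summable_on_cmult_left[OF row_summable]])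
      (intro mult_left_mono rate_nonneg g)
  also have "\<dots> = total_rate x * B"
    unfolding total_rate_def by (rule infsum_cmult_left) (use row_summable in auto)
  also have "\<dots> \<le> C * B" using total_rate_le \<open>0 \<le> B\<close> by (intro mult_right_mono)
  finally have "(\<Sum>\<^sub>\<infinity>y. q x y * g y) \<le> B * C" by (simp add: mult.commute)
  moreover have "0 \<le> (\<Sum>\<^sub>\<infinity>y. q x y * g y)" by (intro infsum_nonneg mult_nonneg_nonneg rate_nonneg g)
  moreover have "total_rate x * g x \<le> C * B"
    using total_rate_le total_rate_nonneg C_nonneg by (intro mult_mono g) auto
  moreover have "0 \<le> total_rate x * g x" using total_rate_nonneg g by simp
  ultimately show ?thesis using drift_eq[OF gb, where x = x] by (simp add: mult.commute)
qed

text \<open>Formally the derivative of \<open>exp (- l * t) * act t g x\<close> is at least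
  \<open>- c * pmf (K t x) u\<close>. On the unit interval
  \<open>\<kappa> * pmf (K t x) u \<le> pmf (K 1 x) u\<close>, since a chain in \<open>u\<close> at
  time \<open>t\<close> may just be in \<open>u\<close> again at time 1; so the time integral is
  replaced by a value at an integer time, matching the discrete return probabilities.\<close>

lemma discounted_growth:
  assumes "0 < l" "0 \<le> c"
    and sub: "\<And>z. l * g z - drift q g z \<le> c * of_bool (z = u)"
    and \<kappa>: "0 < \<kappa>" "\<And>t x. t \<in> {0..1} \<Longrightarrow> \<kappa> \<le> pmf (K t x) x"
  shows "g x \<le> exp (- l) * act 1 g x + c / \<kappa> * pmf (K 1 x) u"
proof (rule field_le_epsilon)
  fix d :: real assume "0 < d"
  define y where "y t = exp (- l * t) * act t g x" for t
  define c' where "c' = c / \<kappa> * pmf (K 1 x) u"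
  have B: "0 \<le> B" using g[of x] by simp
  have incr: "\<exists>h>0. t + h \<le> 1 \<and> y t - (c' + d) * h \<le> y (t + h)" if t: "0 \<le> t" "t < 1" for t
  proof -
    define h where "h n = (1 - t) / real (Suc n)" for n
    have h: "h \<longlonglongrightarrow> 0" "\<And>n. 0 < h n"
      using t LIMSEQ_Suc[OF lim_const_over_n[of "1 - t"]] by (auto simp: h_def[abs_def])
    have h1: "t + h n \<le> 1" for n using t by (simp add: h_def field_simps mult_left_le_one_le)
    define v where "v n z = (act (h n) g z - g z) / h n" for n z
    \<comment> \<open>Only the negative part of the error of the difference quotient is kept, since
      only a lower bound on the quotient is known. It is bounded uniformly in the state, so
      dominated convergence under \<open>K t x\<close> applies.\<close>
    define e where "e n z = min 0 (v n z - drift q g z)" for n z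
    have v_le: "\<bar>v n z\<bar> \<le> B * C" for n z
      using act_diff_le[of "h n" z] h(2)[of n] by (simp add: v_def field_simps)
    have e_le: "\<bar>e n z\<bar> \<le> 2 * (B * C)" for n z
      using v_le[of n z] drift_abs_le[of z] B C_nonneg by (auto simp: e_def min_def abs_if split: if_splits)
    have "(\<lambda>n. e n z) \<longlonglongrightarrow> 0" for z
    proof (rule LIMSEQ_I)
      fix r :: real assume "0 < r"
      with act_quotient_lower[OF h, of "r / 2" z]
      have "\<forall>\<^sub>F n in sequentially. drift q g z - r / 2 \<le> v n z" by (simp add: v_def)
      then obtain N where N: "\<And>n. N \<le> n \<Longrightarrow> drift q g z - r / 2 \<le> v n z"
        unfolding eventually_sequentially by blast
      have "norm (e n z - 0) < r" if "N \<le> n" for n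
        using N[OF that] \<open>0 < r\<close> by (simp add: e_def min_def)
      then show "\<exists>N. \<forall>n\<ge>N. norm (e n z - 0) < r" by blast
    qed
    then have lim1: "(\<lambda>n. act t (e n) x) \<longlonglongrightarrow> measure_pmf.expectation (K t x) (\<lambda>_. 0)"
      unfolding act_def by (intro integral_dominated_convergence[where w = "\<lambda>_. 2 * (B * C)"]) (use e_le in auto)
    have lim2: "(\<lambda>n. l * (B * C) * h n) \<longlonglongrightarrow> l * (B * C) * 0"
      by (intro tendsto_intros h)
    have "(\<lambda>n. act t (e n) x - l * (B * C) * h n) \<longlonglongrightarrow> 0"
      using tendsto_diff[OF lim1 lim2] by simp
    then have "\<forall>\<^sub>F n in sequentially. - d < act t (e n) x - l * (B * C) * h n"
      by (rule order_tendstoD(1)) (use \<open>0 < d\<close> in simp)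
    \<comment> \<open>One index is enough: continuous induction asks for a single admissible step.
      The slack \<open>d\<close> absorbs the error of the quotient together with the second-order
      term of the discount.\<close>
    then obtain n where n: "- d < act t (e n) x - l * (B * C) * h n"
      by (auto simp: eventually_sequentially)
    define P where "P = pmf (K t x) u"
    define a where "a = act t g x"
    have step: "act (t + h n) g x = a + h n * act t (v n) x"
    proof -
      have "act (t + h n) g x = measure_pmf.expectation (K t x) (\<lambda>z. g z + h n * v n z)"
        using act_add[of t "h n" x] t h(2)[of n] by (simp add: act_def[of t] v_def)
      also have "\<dots> = a + h n * act t (v n) x"
        unfolding a_def act_def
        by (subst Bochner_Integration.integral_add) (auto intro!: g_integrable integrable_pmf_bounded v_le)
      finally show ?thesis .
    qed
    have "measure_pmf.expectation (K t x) (\<lambda>z. (l * g z + (- c) * indicat_real {u} z) + e n z)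
        \<le> act t (v n) x"
      unfolding act_def
    proof (rule integral_mono)
      show "(l * g z + (- c) * indicat_real {u} z) + e n z \<le> v n z" for z
        using sub[of z] by (auto simp: e_def min_def indicator_def)
      show "integrable (measure_pmf (K t x)) (v n)" by (rule integrable_pmf_bounded[OF v_le])
      show "integrable (measure_pmf (K t x)) (\<lambda>z. (l * g z + (- c) * indicat_real {u} z) + e n z)"
        by (intro Bochner_Integration.integrable_add integrable_mult_right g_integrable
            integrable_pmf_bounded[of "e n", OF e_le] integrable_pmf_bounded[of "indicat_real {u}" 1])
          (auto simp: indicator_def)
    qed
    also have "measure_pmf.expectation (K t x) (\<lambda>z. (l * g z + (- c) * indicat_real {u} z) + e n z)
        = l * a - c * P + act t (e n) x"
    proof -
      have "integrable (measure_pmf (K t x)) (\<lambda>z. l * g z)"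
        "integrable (measure_pmf (K t x)) (\<lambda>z. (- c) * indicat_real {u} z)"
        "integrable (measure_pmf (K t x)) (e n)"
        by (intro integrable_mult_right g_integrable integrable_pmf_bounded[of "e n", OF e_le]
            integrable_pmf_bounded[of "indicat_real {u}" 1]; simp)+
      then have "measure_pmf.expectation (K t x) (\<lambda>z. (l * g z + (- c) * indicat_real {u} z) + e n z)
          = (measure_pmf.expectation (K t x) (\<lambda>z. l * g z)
            + measure_pmf.expectation (K t x) (\<lambda>z. (- c) * indicat_real {u} z))
            + act t (e n) x"
        by (simp only: act_def Bochner_Integration.integral_add Bochner_Integration.integrable_add)
      then show ?thesis by (simp add: a_def act_def P_def measure_pmf_single)
    qed
    finally have vlow: "l * a - c * P + act t (e n) x
        \<le> act t (v n) x" .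
    have P: "c * P \<le> c'"
    proof -
      have "P * \<kappa> \<le> P * pmf (K (1 - t) u) u"
        unfolding P_def using \<kappa>(2)[of "1 - t" u] t by (intro mult_left_mono) auto
      also have "\<dots> \<le> pmf (K 1 x) u" using K_mult_le[of t "1 - t" x u u] t by (simp add: P_def)
      finally have "c * (P * \<kappa>) \<le> c * pmf (K 1 x) u" using \<open>0 \<le> c\<close> by (rule mult_left_mono)
      then show ?thesis using \<kappa>(1) by (simp add: c'_def field_simps)
    qed
    define A where "A = act (t + h n) g x"
    have "A \<le> a + B * C * h n"
    proof -
      have "h n * act t (v n) x \<le> h n * measure_pmf.expectation (K t x) (\<lambda>_. B * C)"
        unfolding act_def using h(2)[of n] v_le by (intro mult_left_mono integral_mono integrable_pmf_bounded[OF v_le])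
          (auto simp: abs_le_iff)
      then show ?thesis using step by (simp add: A_def algebra_simps)
    qed
    have "0 \<le> A" unfolding A_def by (rule act_bounds)
    have "a - (c' + d) * h n \<le> A - l * h n * A"
    proof -
      have "h n * (l * a - c * P + act t (e n) x) \<le> h n * act t (v n) x"
        using vlow h(2)[of n] by (intro mult_left_mono) auto
      moreover have "l * h n * A \<le> l * h n * (a + B * C * h n)"
        using \<open>A \<le> a + B * C * h n\<close> \<open>0 < l\<close> h(2)[of n] by (intro mult_left_mono) auto
      moreover have "h n * (- c' - d) \<le> h n * (- (c * P) + (act t (e n) x - l * (B * C) * h n))"
        using n P h(2)[of n] by (intro mult_left_mono) auto
      ultimately show ?thesis using step unfolding A_def[symmetric] by (simp add: algebra_simps)
    qed
    also have "A - l * h n * A = (1 + (- l * h n)) * A" by (simp add: algebra_simps)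
    also have "\<dots> \<le> exp (- l * h n) * A" using \<open>0 \<le> A\<close> by (intro mult_right_mono exp_ge_add_one_self) auto
    finally have scaled: "exp (- l * t) * (a - (c' + d) * h n) \<le> exp (- l * t) * (exp (- l * h n) * A)"
      by (intro mult_left_mono) auto
    have "exp (- l * t) * a - exp (- l * t) * ((c' + d) * h n) \<le> y (t + h n)"
    proof -
      have eq: "exp (- l * t) * exp (- l * h n) = exp (- l * (t + h n))"
        by (simp add: exp_add[symmetric] algebra_simps)
      from scaled show ?thesis
        unfolding y_def A_def[symmetric] eq[symmetric] by (simp add: right_diff_distrib mult.assoc)
    qed
    moreover have "exp (- l * t) * ((c' + d) * h n) \<le> 1 * ((c' + d) * h n)"
    proof (rule mult_right_mono)
      show "exp (- l * t) \<le> 1" using t \<open>0 < l\<close> by simp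
      have "0 \<le> c'" using \<open>0 \<le> c\<close> \<kappa>(1) by (simp add: c'_def)
      then show "0 \<le> (c' + d) * h n" using \<open>0 < d\<close> h(2)[of n] by simp
    qed
    ultimately show ?thesis using h(2)[of n] h1[of n] by (intro exI[of _ "h n"]) (simp add: y_def a_def)
  qed
  have "continuous_on {0..1} (\<lambda>t. act t g x)"
  proof (rule continuous_on_forward_Lipschitz)
    show "\<bar>act (s + h) g x - act s g x\<bar> \<le> B * C * h" if "0 \<le> s" "0 \<le> h" for s h
    proof -
      have "act (s + h) g x - act s g x = measure_pmf.expectation (K s x) (\<lambda>z. act h g z - g z)"
        unfolding act_add[OF that] unfolding act_def[of s]
        by (subst Bochner_Integration.integral_diff)
          (auto intro!: g_integrable integrable_pmf_bounded[where b = B] simp: act_bounds)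
      also have "\<bar>\<dots>\<bar> \<le> measure_pmf.expectation (K s x) (\<lambda>_. B * C * h)"
        using act_diff_le[OF that(2)] B C_nonneg that(2)
        by (intro integral_abs_bound[THEN order_trans] integral_mono integrable_pmf_bounded[where b = "B * C * h"]) auto
      finally show ?thesis by simp
    qed
  qed
  then have "continuous_on {0..1} y" unfolding y_def by (intro continuous_intros)
  from growth_from_right_increments[OF this incr] have "y 0 - (c' + d) \<le> y 1" by simp
  then show "g x \<le> exp (- l) * act 1 g x + c / \<kappa> * pmf (K 1 x) u + d"
    by (simp add: y_def act_0 c'_def)
qed

text \<open>Iterating over integer times sums the return probabilities, while the discount removes
  the boundary term. The bound obtained contains neither \<open>l\<close> nor \<open>B\<close>, so
  it survives as \<open>l\<close> tends to 0.\<close>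

lemma green_bound:
  assumes "0 < l" "0 \<le> c"
    and sub: "\<And>z. l * g z - drift q g z \<le> c * of_bool (z = u)"
    and \<kappa>: "0 < \<kappa>" "\<And>t x. t \<in> {0..1} \<Longrightarrow> \<kappa> \<le> pmf (K t x) x"
    and summ: "summable (\<lambda>n. pmf (K (real n) u) u)"
  shows "g u \<le> c / \<kappa> * (\<Sum>n. pmf (K (real n) u) u)"
proof -
  have step: "g x \<le> exp (- l) * act 1 g x + c / \<kappa> * pmf (K 1 x) u" for x
    by (rule discounted_growth[OF assms(1-5)])
  have iter: "g x \<le> exp (- l * real N) * act (real N) g x + c / \<kappa> * (\<Sum>n\<in>{1..N}. pmf (K (real n) x) u)" for N x
  proof (induction N)
    case 0
    then show ?case by (simp add: act_0)
  next
    case (Suc N)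
    have int: "integrable (measure_pmf (K (real N) x)) (act 1 g)"
        "integrable (measure_pmf (K (real N) x)) (\<lambda>z. pmf (K 1 z) u)"
      by (rule integrable_pmf_bounded[where b = B], simp add: act_bounds)
        (rule integrable_pmf_bounded[where b = 1], simp add: pmf_le_1)
    have "act (real N) g x \<le> measure_pmf.expectation (K (real N) x)
        (\<lambda>z. exp (- l) * act 1 g z + c / \<kappa> * pmf (K 1 z) u)"
      unfolding act_def[of "real N"]
      by (intro integral_mono g_integrable step Bochner_Integration.integrable_add integrable_mult_right int)
    also have "\<dots> = exp (- l) * act (real (Suc N)) g x + c / \<kappa> * pmf (K (real (Suc N)) x) u"
      using act_add[of "real N" 1 x] K_add[of "real N" 1 x]
      by (subst Bochner_Integration.integral_add)
        (auto intro!: integrable_mult_right int simp: act_def[of "real N"] pmf_bind add.commute)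
    finally have "exp (- l * real N) * act (real N) g x
      \<le> exp (- l * real N) * (exp (- l) * act (real (Suc N)) g x + c / \<kappa> * pmf (K (real (Suc N)) x) u)"
      by (intro mult_left_mono) auto
    also have "\<dots> \<le> exp (- l * real (Suc N)) * act (real (Suc N)) g x + c / \<kappa> * pmf (K (real (Suc N)) x) u"
    proof -
      have "exp (- l * real N) * (c / \<kappa> * pmf (K (real (Suc N)) x) u) \<le> 1 * (c / \<kappa> * pmf (K (real (Suc N)) x) u)"
        using assms(1,2) \<kappa>(1) by (intro mult_right_mono) auto
      moreover have "exp (- l * real N) * exp (- l) = exp (- l * real (Suc N))"
        by (simp add: exp_add[symmetric] algebra_simps)
      ultimately show ?thesis unfolding distrib_left mult.assoc[symmetric] by simp
    qed
    finally show ?case using Suc by (simp add: algebra_simps)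
  qed
  define S where "S = (\<Sum>n. pmf (K (real n) u) u)"
  have "g u \<le> exp (- l * real N) * B + c / \<kappa> * S" for N
  proof -
    have "(\<Sum>n\<in>{1..N}. pmf (K (real n) u) u) \<le> S"
      unfolding S_def by (rule sum_le_suminf[OF summ]) auto
    then have "c / \<kappa> * (\<Sum>n\<in>{1..N}. pmf (K (real n) u) u) \<le> c / \<kappa> * S"
      using assms(2) \<kappa>(1) by (intro mult_left_mono) auto
    moreover have "exp (- l * real N) * act (real N) g u \<le> exp (- l * real N) * B"
      by (intro mult_left_mono act_bounds) auto
    ultimately show ?thesis using iter[of u N] by linarith
  qed
  moreover have "(\<lambda>N. exp (- l * real N) * B + c / \<kappa> * S) \<longlonglongrightarrow> 0 * B + c / \<kappa> * S"
  proof (intro tendsto_intros)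
    have "(\<lambda>N. exp (- l) ^ N) \<longlonglongrightarrow> 0" using assms(1) by (intro LIMSEQ_power_zero) simp
    then show "(\<lambda>N. exp (- l * real N)) \<longlonglongrightarrow> 0" by (simp add: exp_of_nat2_mult[symmetric])
  qed
  ultimately show ?thesis unfolding S_def by (intro LIMSEQ_le_const) auto
qed

end
end

section \<open>Superharmonic functions of a discrepancy\<close>

text \<open>The drift of a discrepancy: with \<open>\<eta>\<close> the common configuration off \<open>x\<close>, the discrepancy moves
  from \<open>x\<close> to an empty site \<open>y\<close> when its particle jumps, and to an occupied site \<open>y\<close> when the
  particle at \<open>y\<close> jumps into the hole at \<open>x\<close>.\<close>

definition discrepancy_drift ::
    "('s \<Rightarrow> 's \<Rightarrow> real) \<Rightarrow> ('s \<Rightarrow> bool) \<Rightarrow> ('s \<Rightarrow> real) \<Rightarrow> 's \<Rightarrow> real" where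
  "discrepancy_drift q \<eta> W x = (\<Sum>\<^sub>\<infinity>y. (q x y * of_bool (\<not> \<eta> y) + q y x * of_bool (\<eta> y)) * (W y - W x))"

lemma discrepancy_drift_cmult:
  "discrepancy_drift q \<eta> (\<lambda>x. c * W x) x = c * discrepancy_drift q \<eta> W x"
proof -
  have "discrepancy_drift q \<eta> (\<lambda>x. c * W x) x
      = (\<Sum>\<^sub>\<infinity>y. c * ((q x y * of_bool (\<not> \<eta> y) + q y x * of_bool (\<eta> y)) * (W y - W x)))"
    unfolding discrepancy_drift_def by (rule infsum_cong) (simp add: algebra_simps)
  also have "\<dots> = c * discrepancy_drift q \<eta> W x"
    unfolding discrepancy_drift_def by (rule infsum_cmult_right')
  finally show ?thesis .
qed

text \<open>A discrepancy at \<open>x\<close> moves to \<open>y\<close> at rate \<open>p x y\<close>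
  if \<open>y\<close> is empty and \<open>p y x\<close> if it is occupied. For symmetric rates it is
  a walk that does not see the environment, which reduces the symmetric process to the Green
  function of \<open>p\<close>.\<close>

lemma (in symmetric_rates) discrepancy_drift_symmetric: "discrepancy_drift p \<eta> W x = drift p W x"
  unfolding discrepancy_drift_def drift_def
proof (rule infsum_cong)
  fix y
  show "(p x y * of_bool (\<not> \<eta> y) + p y x * of_bool (\<eta> y)) * (W y - W x) = p x y * (W y - W x)"
    unfolding sym[of y x] by (cases "\<eta> y") auto
qed

section \<open>One modified bond\<close>

locale single_perturbation = symmetric_rates p C
  for p :: "'s::countable \<Rightarrow> 's \<Rightarrow> real" and C +
  fixes pbar :: "'s \<Rightarrow> 's \<Rightarrow> real" and u v :: 's and \<epsilon> :: real
  assumes pbar_eq: "pbar x y = p x y + (if x = u \<and> y = v then \<epsilon> else 0)"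
    and p_uv: "0 < p u v"
    and pbar_uv: "0 < p u v + \<epsilon>"
    and pbar_rates: "bounded_rates pbar C"
begin

lemma drift_pbar:
  assumes "\<And>y. \<bar>W y\<bar> \<le> B"
  shows "drift pbar W x = drift p W x + (if x = u then \<epsilon> * (W v - W u) else 0)"
proof -
  define s where "s y = (if x = u \<and> y = v then \<epsilon> * (W v - W u) else 0)" for y
  have s: "s summable_on UNIV" "infsum s UNIV = (if x = u then \<epsilon> * (W v - W u) else 0)"
    using infsum_single[of v s] by (auto simp: s_def)
  have "drift pbar W x = (\<Sum>\<^sub>\<infinity>y. p x y * (W y - W x) + s y)"
    unfolding drift_def by (rule infsum_cong) (auto simp: pbar_eq s_def algebra_simps)
  also have "\<dots> = drift p W x + infsum s UNIV"
    unfolding drift_def by (intro infsum_add s(1) drift_terms_summable[OF assms])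
  finally show ?thesis using s(2) by simp
qed

text \<open>One changed rate gives two corrections: it moves a discrepancy from \<open>u\<close> to
  \<open>v\<close> when \<open>v\<close> is empty, and a discrepancy from \<open>v\<close> back to
  \<open>u\<close> when the particle at \<open>u\<close> jumps into its hole.\<close>

lemma discrepancy_drift_pbar:
  assumes "\<And>y. \<bar>W y\<bar> \<le> B"
  shows "discrepancy_drift pbar \<eta> W x = drift p W x
    + (if x = u then \<epsilon> * of_bool (\<not> \<eta> v) * (W v - W u) else 0)
    + (if x = v then \<epsilon> * of_bool (\<eta> u) * (W u - W v) else 0)"
proof -
  define s where "s y = (if x = u \<and> y = v then \<epsilon> * of_bool (\<not> \<eta> v) * (W v - W u) else 0)" for y
  define r where "r y = (if x = v \<and> y = u then \<epsilon> * of_bool (\<eta> u) * (W u - W v) else 0)" for y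
  have s: "s summable_on UNIV" "infsum s UNIV = (if x = u then \<epsilon> * of_bool (\<not> \<eta> v) * (W v - W u) else 0)"
    using infsum_single[of v s] by (auto simp: s_def)
  have r: "r summable_on UNIV" "infsum r UNIV = (if x = v then \<epsilon> * of_bool (\<eta> u) * (W u - W v) else 0)"
    using infsum_single[of u r] by (auto simp: r_def)
  have "discrepancy_drift pbar \<eta> W x = (\<Sum>\<^sub>\<infinity>y. (p x y * (W y - W x) + s y) + r y)"
    unfolding discrepancy_drift_def
  proof (rule infsum_cong)
    fix y
    show "(pbar x y * of_bool (\<not> \<eta> y) + pbar y x * of_bool (\<eta> y)) * (W y - W x)
        = (p x y * (W y - W x) + s y) + r y"
    proof -
      define \<alpha> where "\<alpha> = (if x = u \<and> y = v then \<epsilon> else 0)"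
      define \<beta> where "\<beta> = (if y = u \<and> x = v then \<epsilon> else 0)"
      have "s y = \<alpha> * of_bool (\<not> \<eta> y) * (W y - W x)" by (simp add: s_def \<alpha>_def)
      moreover have "r y = \<beta> * of_bool (\<eta> y) * (W y - W x)" by (simp add: r_def \<beta>_def)
      moreover have "pbar x y = p x y + \<alpha>" by (simp add: pbar_eq \<alpha>_def)
      moreover have "pbar y x = p x y + \<beta>" using pbar_eq[of y x] sym[of y x] by (simp add: \<beta>_def)
      ultimately show ?thesis by (cases "\<eta> y") (simp_all add: distrib_right)
    qed
  qed
  also have "\<dots> = (\<Sum>\<^sub>\<infinity>y. p x y * (W y - W x) + s y) + infsum r UNIV"
    by (rule infsum_add[OF summable_on_add[OF drift_terms_summable[OF assms] s(1)] r(1)])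
  also have "(\<Sum>\<^sub>\<infinity>y. p x y * (W y - W x) + s y) = drift p W x + infsum s UNIV"
    unfolding drift_def by (rule infsum_add[OF drift_terms_summable[OF assms] s(1)])
  finally show ?thesis using s(2) r(2) by simp
qed

text \<open>The changed rate leaves from \<open>u\<close>, so for the perturbed chain
  \<open>green l x u\<close> still has its only source at \<open>u\<close>, altered by at most
  \<open>\<bar>\<epsilon>\<bar> / p u v\<close>. Return probabilities of the transient chain then
  bound \<open>green l u u\<close> uniformly in \<open>l\<close>; diagonal domination extends this
  to all starting points, and irreducibility carries it from \<open>u\<close> to any target.\<close>

lemma green_uniform_bound:
  assumes "transient_kernel pbar" "irreducible_kernel p"
  shows "\<exists>D. \<forall>l. 0 < l \<longrightarrow> l \<le> 1 \<longrightarrow> (\<forall>x. green l x a \<le> D)"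
proof -
  from assms(1) obtain M where "markov_chain pbar M"
    and AE: "\<And>x. AE \<omega> in M x. bdd_above {t. 0 \<le> t \<and> \<omega> t = x}"
    unfolding transient_kernel_def by blast
  then obtain K where K: "chain_transition_function pbar K"
    and M: "\<And>x. prob_space (M x)"
      "\<And>x t. 0 \<le> t \<Longrightarrow> (\<lambda>\<omega>. \<omega> t) \<in> M x \<rightarrow>\<^sub>M count_space UNIV"
      "\<And>x r. sorted (0 # map fst r) \<Longrightarrow>
        measure (M x) {\<omega> \<in> space (M x). \<forall>(t, y)\<in>set r. \<omega> t = y} = path_prob K x 0 r"
    unfolding markov_chain_def by blast
  interpret chain: chain_semigroup pbar C K
    by (rule chain_semigroup.intro[OF pbar_rates]) (simp add: chain_semigroup_axioms_def K)
  obtain \<kappa> where \<kappa>: "0 < \<kappa>" "\<And>t x. t \<in> {0..1} \<Longrightarrow> \<kappa> \<le> pmf (K t x) x"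
    using chain.holding_bounded_below by blast
  have summ: "summable (\<lambda>n. pmf (K (real n) u) u)"
    by (rule summable_return_probabilities[OF M(1)[of u] M(2) M(3) chain.K_0 AE])
  define c where "c = 1 + \<bar>\<epsilon>\<bar> / p u v"
  have c: "0 \<le> c" using p_uv by (simp add: c_def)
  have "green l u u \<le> c / \<kappa> * (\<Sum>n. pmf (K (real n) u) u)" if l: "0 < l" for l
  proof (rule chain.green_bound[where g = "\<lambda>x. green l x u" and B = "1 / l" and l = l])
    show "l * green l z u - drift pbar (\<lambda>x. green l x u) z \<le> c * of_bool (z = u)" for z
    proof -
      have "\<epsilon> * (green l u u - green l v u) \<le> \<bar>\<epsilon>\<bar> / p u v"
      proof -
        have "green l u u - green l v u \<le> 1 / p u v"
          using rate_mult_green_diff_le[OF l, of u v] p_uv by (simp add: field_simps)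
        moreover have "0 \<le> green l u u - green l v u" using green_le_diag[OF l, of v u] by simp
        ultimately have "\<epsilon> * (green l u u - green l v u) \<le> \<bar>\<epsilon>\<bar> * (1 / p u v)"
          by (intro mult_mono) auto
        then show ?thesis by simp
      qed
      then show ?thesis
        using green_equation[OF l, of z u] drift_pbar[where x = z and W = "\<lambda>y. green l y u", OF green_abs_le[OF l]]
        by (auto simp: c_def algebra_simps)
    qed
  qed (use l c \<kappa> summ green_nonneg[OF l] green_le[OF l] in auto)
  then have "\<exists>D. \<forall>l. 0 < l \<longrightarrow> l \<le> 1 \<longrightarrow> (\<forall>x. green l x u \<le> D)"
    using green_le_diag order_trans by meson
  moreover have "(u, a) \<in> {(x, y). 0 < p x y}\<^sup>*"
    using assms(2) by (simp add: irreducible_kernel_def)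
  then have "(\<exists>D. \<forall>l. 0 < l \<longrightarrow> l \<le> 1 \<longrightarrow> (\<forall>x. green l x u \<le> D)) \<longrightarrow>
      (\<exists>D. \<forall>l. 0 < l \<longrightarrow> l \<le> 1 \<longrightarrow> (\<forall>x. green l x a \<le> D))"
  proof (induction rule: rtrancl_induct)
    case (step a b)
    show ?case
    proof
      assume "\<exists>D. \<forall>l. 0 < l \<longrightarrow> l \<le> 1 \<longrightarrow> (\<forall>x. green l x u \<le> D)"
      with step.IH obtain D where D: "\<And>l x. 0 < l \<Longrightarrow> l \<le> 1 \<Longrightarrow> green l x a \<le> D" by blast
      have "green l x b \<le> (1 + C) * D / p a b" if l: "0 < l" "l \<le> 1" for l x
      proof -
        have "p a b * green l x b \<le> (l + C) * green l x a" by (rule green_neighbour_le[OF l(1)])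
        also have "\<dots> \<le> (1 + C) * D"
          using l C_nonneg green_nonneg[OF l(1), of x a] D[OF l, of x] by (intro mult_mono) auto
        finally show ?thesis using step.hyps(2) by (simp add: field_simps)
      qed
      then show "\<exists>D. \<forall>l. 0 < l \<longrightarrow> l \<le> 1 \<longrightarrow> (\<forall>x. green l x b \<le> D)" by blast
    qed
  qed simp
  ultimately show ?thesis by blast
qed

text \<open>Whatever the environment \<open>\<theta>\<close>, the extra drift along the bond must not outweigh the sources. The
  weights of the sources at \<open>u\<close> and \<open>v\<close> are chosen so that the difference of the potential between
  the two sites is just \<open>a - b\<close>.\<close>

lemma bond_potential:
  fixes l :: real
  assumes l: "0 < l"
  defines "a \<equiv> green l u u - green l v u" and "b \<equiv> green l v v - green l u v"
  defines "su \<equiv> 1 + max \<epsilon> 0 * b" and "sv \<equiv> 1 + max \<epsilon> 0 * a"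
  defines "\<delta> \<equiv> min 1 ((p u v + \<epsilon>) / p u v)"
  defines "w \<equiv> \<lambda>x. su * green l x u + sv * green l x v"
  assumes \<theta>: "0 \<le> \<theta>" "\<theta> \<le> 1"
  shows "\<delta> \<le> su - \<epsilon> * \<theta> * (w v - w u)" "\<delta> \<le> sv - \<epsilon> * \<theta> * (w u - w v)" "0 < \<delta>"
proof -
  have a: "0 \<le> a" using green_le_diag[OF l, of v u] by (simp add: a_def)
  have b: "0 \<le> b" using green_le_diag[OF l, of u v] by (simp add: b_def)
  have pa: "p u v * a \<le> 1" using rate_mult_green_diff_le[OF l, of u v] by (simp add: a_def)
  have pb: "p u v * b \<le> 1" using rate_mult_green_diff_le[OF l, of v u] by (simp add: b_def sym[of v u])
  have "w u - w v = a * su - b * sv" by (simp add: w_def a_def b_def algebra_simps)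
  \<comment> \<open>The products of \<open>a\<close> and \<open>b\<close> cancel. This is why the
    weight at \<open>u\<close> contains the potential drop \<open>b\<close> at the opposite end, and
    conversely.\<close>
  also have "\<dots> = a - b" by (simp add: su_def sv_def algebra_simps)
  finally have w: "w u - w v = a - b" .
  show "0 < \<delta>" using p_uv pbar_uv by (simp add: \<delta>_def)
  have "\<delta> \<le> s - \<epsilon> * \<theta> * (y - x)" if x: "0 \<le> x" "p u v * x \<le> 1" and y: "0 \<le> y" and s: "s = 1 + max \<epsilon> 0 * y" for x y s
  proof (cases "0 \<le> \<epsilon>")
    case True
    have "\<epsilon> * \<theta> * (y - x) \<le> \<epsilon> * \<theta> * y" using True \<theta> x by (intro mult_left_mono) auto
    also have "\<dots> \<le> \<epsilon> * 1 * y" using True \<theta> y by (intro mult_right_mono mult_left_mono) auto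
    finally show ?thesis using True s by (simp add: \<delta>_def max_def)
  next
    \<comment> \<open>For a decreased rate the loss is at most that of a full potential drop along
      the bond, which is bounded by \<open>1 / p u v\<close>. Of the unit source
      \<open>(p u v + \<epsilon>) / p u v\<close> is left, hence the second entry of the minimum in
      \<open>\<delta>\<close>.\<close>
    case False
    have "\<epsilon> * \<theta> * y \<le> 0" using False \<theta> y by (intro mult_nonpos_nonneg) auto
    moreover have "\<epsilon> * x \<le> \<epsilon> * (\<theta> * x)"
      using False \<theta> x by (intro mult_left_mono_neg mult_left_le_one_le) auto
    moreover have "\<epsilon> * (1 / p u v) \<le> \<epsilon> * x"
      using False x p_uv by (intro mult_left_mono_neg) (auto simp: field_simps)
    moreover have "(p u v + \<epsilon>) / p u v = 1 + \<epsilon> * (1 / p u v)" using p_uv by (simp add: field_simps)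
    moreover have "s = 1" using False s by simp
    ultimately have "(p u v + \<epsilon>) / p u v \<le> s - \<epsilon> * \<theta> * (y - x)"
      by (simp add: right_diff_distrib mult.assoc)
    then show ?thesis by (simp add: \<delta>_def min_le_iff_disj)
  qed
  from this[OF a pa b su_def[THEN meta_eq_to_obj_eq]] this[OF b pb a sv_def[THEN meta_eq_to_obj_eq]]
  show "\<delta> \<le> su - \<epsilon> * \<theta> * (w v - w u)" "\<delta> \<le> sv - \<epsilon> * \<theta> * (w u - w v)"
    using w by (metis minus_diff_eq)+
qed

text \<open>\<open>green_sum l A\<close> has the right source on \<open>A\<close>, but its
  difference across the bond may spoil the inequality at \<open>u\<close> and \<open>v\<close>; a
  multiple of the function from \<open>bond_potential\<close> adds enough source there.
  \<open>D\<close> is chosen before \<open>l\<close>, so the bound can be used as \<open>l\<close>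
  tends to 0.\<close>

lemma discrepancy_supersolution:
  assumes "transient_kernel pbar" "irreducible_kernel p" "finite A"
  shows "\<exists>D\<ge>0. \<forall>l. 0 < l \<longrightarrow> l \<le> 1 \<longrightarrow> (\<exists>W B. (\<forall>x. 0 \<le> W x \<and> W x \<le> B)
     \<and> (\<forall>\<eta> x. of_bool (x \<in> A) \<le> l * W x - discrepancy_drift pbar \<eta> W x)
     \<and> (\<forall>x. W x \<le> D * green_sum l (A \<union> {u, v}) x))"
proof -
  define A' where "A' = A \<union> {u, v}"
  have finA': "finite A'" using assms(3) by (simp add: A'_def)
  have "\<forall>a. \<exists>D. \<forall>l. 0 < l \<longrightarrow> l \<le> 1 \<longrightarrow> (\<forall>x. green l x a \<le> D)"
    using green_uniform_bound[OF assms(1,2)] by blast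
  then obtain D where D: "\<And>a l x. 0 < l \<Longrightarrow> l \<le> 1 \<Longrightarrow> green l x a \<le> D a" by metis
  have D0: "0 \<le> D a" for a using D[of 1 a a] green_nonneg[of 1 a a] by simp
  define \<delta> where "\<delta> = min 1 ((p u v + \<epsilon>) / p u v)"
  define H where "H = (\<Sum>a\<in>A. D a)"
  have H0: "0 \<le> H" unfolding H_def by (intro sum_nonneg D0)
  \<comment> \<open>\<open>green_sum l A\<close> takes values in \<open>[0, H]\<close>, so the bond
    costs at most \<open>\<bar>\<epsilon>\<bar> * H\<close>, while \<open>bond_potential\<close>
    gains at least \<open>\<delta>\<close> per unit of \<open>m\<close>.\<close>
  define m where "m = \<bar>\<epsilon>\<bar> * H / \<delta>"
  have \<delta>: "0 < \<delta>" using p_uv pbar_uv by (simp add: \<delta>_def)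
  have m0: "0 \<le> m" using \<delta> H0 by (simp add: m_def)
  \<comment> \<open>A bound on both weights \<open>su\<close> and \<open>sv\<close>, uniform in
    \<open>l\<close>. Each of the two weighted Green functions contributes \<open>m * S\<close> to
    \<open>E\<close>.\<close>
  define S where "S = 1 + \<bar>\<epsilon>\<bar> * (D u + D v)"
  have S1: "1 \<le> S" using D0 by (simp add: S_def)
  define E where "E = 1 + m * S + m * S"
  have E0: "0 \<le> E" using m0 S1 by (simp add: E_def)
  show ?thesis
  proof (intro exI[of _ E] conjI allI impI)
    show "0 \<le> E" by fact
    fix l :: real assume l: "0 < l" "l \<le> 1"
    define su where "su = 1 + max \<epsilon> 0 * (green l v v - green l u v)"
    define sv where "sv = 1 + max \<epsilon> 0 * (green l u u - green l v u)"
    define w where "w = (\<lambda>x. su * green l x u + sv * green l x v)"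
    define k where "k = green_sum l A"
    have su: "0 \<le> su" "su \<le> S"
    proof -
      have "max \<epsilon> 0 * (green l v v - green l u v) \<le> \<bar>\<epsilon>\<bar> * (D u + D v)"
        using D[OF l, of v v] D0[of u] green_nonneg[OF l(1), of u v] green_le_diag[OF l(1), of u v]
        by (intro mult_mono) auto
      then show "su \<le> S" by (simp add: su_def S_def)
      show "0 \<le> su" using green_le_diag[OF l(1), of u v] by (simp add: su_def)
    qed
    have sv: "0 \<le> sv" "sv \<le> S"
    proof -
      have "max \<epsilon> 0 * (green l u u - green l v u) \<le> \<bar>\<epsilon>\<bar> * (D u + D v)"
        using D[OF l, of u u] D0[of v] green_nonneg[OF l(1), of v u] green_le_diag[OF l(1), of v u]
        by (intro mult_mono) auto
      then show "sv \<le> S" by (simp add: sv_def S_def)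
      show "0 \<le> sv" using green_le_diag[OF l(1), of v u] by (simp add: sv_def)
    qed
    note g0 = green_nonneg[OF l(1)] and gb = green_abs_le[OF l(1)]
    have k: "0 \<le> k x" "k x \<le> H" for x
      unfolding k_def H_def green_sum_def by (intro sum_nonneg g0) (intro sum_mono D[OF l])
    have w0: "0 \<le> w x" for x unfolding w_def using su sv g0 by simp
    have wS: "w x \<le> S * green l x u + S * green l x v" for x
      unfolding w_def using su sv g0 by (intro add_mono mult_right_mono) auto
    have wB: "w x \<le> S * D u + S * D v" for x
      by (rule order_trans[OF wS]) (intro add_mono mult_left_mono D[OF l]; use S1 in simp)
    define W where "W = (\<lambda>x. k x + m * w x)"
    have W0: "0 \<le> W x" for x unfolding W_def using k w0 m0 by simp
    have WB: "W x \<le> H + m * (S * D u + S * D v)" for x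
      unfolding W_def by (intro add_mono mult_left_mono k wB m0)
    have Wabs: "\<bar>W x\<bar> \<le> H + m * (S * D u + S * D v)" for x using W0 WB by simp
    have kabs: "\<bar>k x\<bar> \<le> H" for x using k by simp
    have dk: "drift p k x = l * k x - of_bool (x \<in> A)" for x
      using green_sum_equation[OF l(1) assms(3), of x] by (simp add: k_def)
    have dw: "drift p w x = l * w x - (su * of_bool (x = u) + sv * of_bool (x = v))" for x
    proof -
      have bnd: "\<bar>c * green l y a\<bar> \<le> \<bar>c\<bar> * (1 / l)" for c y a
        using mult_left_mono[OF gb, of "\<bar>c\<bar>" y a] by (simp add: abs_mult)
      have "drift p w x = su * drift p (\<lambda>y. green l y u) x + sv * drift p (\<lambda>y. green l y v) x"
        unfolding w_def by (subst drift_add[OF bnd bnd]) (simp add: drift_cmult)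
      moreover have "drift p (\<lambda>y. green l y a) x = l * green l x a - of_bool (x = a)" for a
        using green_equation[OF l(1), of x a] by simp
      ultimately show ?thesis by (simp only: w_def algebra_simps)
    qed
    have dW: "drift p W x = drift p k x + m * drift p w x" for x
    proof -
      have "\<bar>m * w y\<bar> \<le> m * (S * D u + S * D v)" for y
        using w0[of y] wB[of y] m0 by (simp add: abs_mult mult_left_mono)
      from drift_add[OF kabs this, where x = x] show ?thesis by (simp add: W_def drift_cmult)
    qed
    have kdiff: "\<epsilon> * \<theta> * (k y - k z) \<le> m * \<delta>" if "0 \<le> \<theta>" "\<theta> \<le> 1" for \<theta> y z
    proof -
      have "\<bar>k y - k z\<bar> \<le> H" using k[of y] k[of z] by auto
      then have "\<bar>\<epsilon>\<bar> * \<theta> * \<bar>k y - k z\<bar> \<le> \<bar>\<epsilon>\<bar> * 1 * H"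
        using that by (intro mult_mono) auto
      moreover have "\<epsilon> * \<theta> * (k y - k z) \<le> \<bar>\<epsilon> * \<theta> * (k y - k z)\<bar>" by simp
      moreover have "\<bar>\<epsilon> * \<theta> * (k y - k z)\<bar> = \<bar>\<epsilon>\<bar> * \<theta> * \<bar>k y - k z\<bar>" using that by (simp add: abs_mult)
      ultimately show ?thesis using \<delta> by (simp add: m_def)
    qed
    have "of_bool (x \<in> A) \<le> l * W x - discrepancy_drift pbar \<eta> W x" for \<eta> x
    proof -
      have bu: "\<epsilon> * \<theta> * (W v - W u) \<le> m * su" if \<theta>: "0 \<le> \<theta>" "\<theta> \<le> 1" for \<theta>
      proof -
        have "m * \<delta> \<le> m * (su - \<epsilon> * \<theta> * (w v - w u))"
          using bond_potential(1)[OF l(1) \<theta>] m0 by (intro mult_left_mono) (auto simp: \<delta>_def su_def sv_def w_def)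
        with kdiff[OF \<theta>, of v u] show ?thesis by (simp add: W_def algebra_simps)
      qed
      have bv: "\<epsilon> * \<theta> * (W u - W v) \<le> m * sv" if \<theta>: "0 \<le> \<theta>" "\<theta> \<le> 1" for \<theta>
      proof -
        have "m * \<delta> \<le> m * (sv - \<epsilon> * \<theta> * (w u - w v))"
          using bond_potential(2)[OF l(1) \<theta>] m0 by (intro mult_left_mono) (auto simp: \<delta>_def su_def sv_def w_def)
        with kdiff[OF \<theta>, of u v] show ?thesis by (simp add: W_def algebra_simps)
      qed
      have "l * W x - drift p W x = of_bool (x \<in> A) + m * (su * of_bool (x = u) + sv * of_bool (x = v))"
        unfolding dW dk dw by (simp add: W_def algebra_simps)
      then show ?thesis
        unfolding discrepancy_drift_pbar[OF Wabs]
        using bu[of "of_bool (\<not> \<eta> v)"] bv[of "of_bool (\<eta> u)"] by (auto simp: algebra_simps)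
    qed
    moreover have "W x \<le> E * green_sum l A' x" for x
    proof -
      have kA: "k x \<le> green_sum l A' x"
        unfolding k_def green_sum_def by (rule sum_mono2) (use finA' g0 in \<open>auto simp: A'_def\<close>)
      have uA: "green l x c \<le> green_sum l A' x" if "c \<in> {u, v}" for c
        unfolding green_sum_def using that finA' g0 by (intro member_le_sum) (auto simp: A'_def)
      have "W x \<le> green_sum l A' x + m * (S * green_sum l A' x + S * green_sum l A' x)"
        unfolding W_def
        by (intro add_mono mult_left_mono kA m0 order_trans[OF wS] uA) (use S1 in auto)
      then show ?thesis by (simp add: E_def algebra_simps)
    qed
    ultimately show "\<exists>W B. (\<forall>x. 0 \<le> W x \<and> W x \<le> B)
     \<and> (\<forall>\<eta> x. of_bool (x \<in> A) \<le> l * W x - discrepancy_drift pbar \<eta> W x)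
     \<and> (\<forall>x. W x \<le> E * green_sum l (A \<union> {u, v}) x)"
      using W0 WB unfolding A'_def by blast
  qed
qed

end

section \<open>Contraction semigroups\<close>

lemma right_difference_quotient_integral:
  fixes f :: "real \<Rightarrow> 'b::banach"
  assumes "continuous_on {0..} f" "0 \<le> t"
  shows "((\<lambda>h. (integral {0..t + h} f - integral {0..t} f) /\<^sub>R h) \<longlongrightarrow> f t) (at_right 0)"
proof -
  have "((\<lambda>s. integral {0..s} f) has_vector_derivative f t) (at t within {0..t + 1})"
    using assms by (intro integral_has_vector_derivative) (auto intro: continuous_on_subset)
  then have "((\<lambda>s. (1 / norm (s - t)) *\<^sub>R (integral {0..s} f - (integral {0..t} f + (s - t) *\<^sub>R f t)))
      \<longlongrightarrow> 0) (at t within {0..t + 1})"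
    by (simp add: has_vector_derivative_def has_derivative_within)
  moreover have "filterlim (\<lambda>h. t + h) (at t within {0..t + 1}) (at_right 0)"
  proof -
    have "\<forall>\<^sub>F h in at_right 0. t + h \<in> {0..t + 1} \<and> t + h \<noteq> t"
      using eventually_at_right_less[of 0] eventually_at_right_field[of _ "0::real"] assms(2)
      by (auto simp: eventually_at_right_field intro!: exI[of _ 1])
    moreover have "((\<lambda>h. t + h) \<longlongrightarrow> t + 0) (at_right 0)" by (intro tendsto_intros)
    ultimately show ?thesis by (simp add: filterlim_at)
  qed
  ultimately have "((\<lambda>h. (1 / norm (t + h - t)) *\<^sub>R (integral {0..t + h} f - (integral {0..t} f + (t + h - t) *\<^sub>R f t)))
      \<longlongrightarrow> 0) (at_right 0)"
    by (rule filterlim_compose)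
  then have "((\<lambda>h. (1 / norm (t + h - t)) *\<^sub>R (integral {0..t + h} f - (integral {0..t} f + (t + h - t) *\<^sub>R f t))
      + f t) \<longlongrightarrow> 0 + f t) (at_right 0)"
    by (intro tendsto_intros)
  moreover have "\<forall>\<^sub>F h in at_right 0. (1 / norm (t + h - t)) *\<^sub>R (integral {0..t + h} f
      - (integral {0..t} f + (t + h - t) *\<^sub>R f t)) + f t = (integral {0..t + h} f - integral {0..t} f) /\<^sub>R h"
    using eventually_at_right_less[of 0]
    by eventually_elim (simp add: algebra_simps divide_inverse)
  ultimately show ?thesis by (auto intro: Lim_transform_eventually)
qed

definition semigroup_generator :: "(real \<Rightarrow> 'b::real_normed_vector \<Rightarrow> 'b) \<Rightarrow> ('b \<times> 'b) set" where
  "semigroup_generator T = {(f, g). ((\<lambda>t. (T t f - f) /\<^sub>R t) \<longlongrightarrow> g) (at_right 0)}"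

locale contraction_semigroup =
  fixes T :: "real \<Rightarrow> 'b::banach \<Rightarrow> 'b"
  assumes linear_T: "0 \<le> t \<Longrightarrow> linear (T t)"
    and norm_T: "0 \<le> t \<Longrightarrow> norm (T t f) \<le> norm f"
    and T_0: "T 0 f = f"
    and T_add: "0 \<le> s \<Longrightarrow> 0 \<le> t \<Longrightarrow> T (s + t) f = T s (T t f)"
    and T_cont: "((\<lambda>t. T t f) \<longlongrightarrow> f) (at_right 0)"
begin

lemma bounded_linear_T: "0 \<le> t \<Longrightarrow> bounded_linear (T t)"
  using linear_T norm_T
  by (intro bounded_linear.intro) (auto simp: bounded_linear_axioms_def intro!: exI[of _ 1])

lemma norm_T_diff:
  assumes "0 \<le> s" "0 \<le> t"
  shows "norm (T (s + t) f - T s f) \<le> norm (T t f - f)"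
proof -
  interpret bounded_linear "T s" using assms(1) by (rule bounded_linear_T)
  show ?thesis using norm_T[OF assms(1), of "T t f - f"] by (simp add: T_add[OF assms] diff)
qed

text \<open>Continuity is assumed from the right at 0 only; contractivity transports its modulus to
  every time, and exchanging the two times covers the left side.\<close>

lemma continuous_T: "continuous_on {0..} (\<lambda>t. T t f)"
proof (rule continuous_on_iff[THEN iffD2], intro ballI allI impI)
  fix s e :: real assume "s \<in> {0..}" "0 < e"
  from tendstoD[OF T_cont \<open>0 < e\<close>] obtain d where "0 < d"
    and d: "\<And>t. 0 < t \<Longrightarrow> t < d \<Longrightarrow> norm (T t f - f) < e"
    by (auto simp: eventually_at_right_field dist_norm)
  have *: "norm (T b f - T a f) < e" if "0 \<le> a" "a < b" "b < a + d" for a b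
    using norm_T_diff[of a "b - a" f] d[of "b - a"] that by simp
  show "\<exists>d>0. \<forall>t\<in>{0..}. dist t s < d \<longrightarrow> dist (T t f) (T s f) < e"
  proof (intro exI[of _ d] conjI ballI impI)
    fix t assume t: "t \<in> {0..}" "dist t s < d"
    show "dist (T t f) (T s f) < e"
      using *[of s t] *[of t s] t \<open>s \<in> {0..}\<close> \<open>0 < e\<close>
      by (cases t s rule: linorder_cases) (auto simp: dist_norm dist_real_def norm_minus_commute)
  qed fact
qed

definition cumulative :: "real \<Rightarrow> 'b \<Rightarrow> 'b" where
  "cumulative t f = integral {0..t} (\<lambda>r. T r f)"

lemma integrable_T: "0 \<le> a \<Longrightarrow> (\<lambda>r. T r f) integrable_on {a..b}"
  by (intro integrable_continuous_interval continuous_on_subset[OF continuous_T]) auto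

lemma T_cumulative:
  assumes "0 \<le> h" "0 \<le> t"
  shows "T h (cumulative t f) = cumulative (t + h) f - cumulative h f"
proof -
  have "T h (cumulative t f) = integral {0..t} (T h \<circ> (\<lambda>r. T r f))"
    unfolding cumulative_def by (rule integral_linear[symmetric, OF integrable_T bounded_linear_T]) (use assms in auto)
  also have "\<dots> = integral {0..t} ((\<lambda>r. T r f) \<circ> (+) h)"
    using assms by (intro integral_cong) (simp add: T_add)
  also have "\<dots> = integral {h..t + h} (\<lambda>r. T r f)"
    using integral_shift_cbox_plus[of 0 t "\<lambda>r. T r f" h] by simp
  also have "\<dots> = cumulative (t + h) f - cumulative h f"
    using Henstock_Kurzweil_Integration.integral_combine[of 0 h "t + h" "\<lambda>r. T r f"] integrable_T[of 0 f "t + h"] assms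
    by (simp add: cumulative_def algebra_simps)
  finally show ?thesis .
qed

lemma cumulative_0 [simp]: "cumulative 0 f = 0"
  by (simp add: cumulative_def)

lemma cumulative_quotient: "((\<lambda>h. cumulative h f /\<^sub>R h) \<longlongrightarrow> f) (at_right 0)"
  using right_difference_quotient_integral[OF continuous_T, of 0 f] by (simp add: cumulative_def T_0)

text \<open>Time integrals lie in the domain for every \<open>f\<close>, whereas
  \<open>T t f\<close> need not; they are the elements to which the generator is applied in all
  later estimates.\<close>

lemma cumulative_in_generator:
  assumes "0 \<le> t"
  shows "(cumulative t f, T t f - f) \<in> semigroup_generator T"
proof -
  have "((\<lambda>h. (cumulative (t + h) f - cumulative t f) /\<^sub>R h - cumulative h f /\<^sub>R h) \<longlongrightarrow> T t f - f) (at_right 0)"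
    unfolding cumulative_def[of "t + _"] cumulative_def[of t]
    by (intro tendsto_diff right_difference_quotient_integral continuous_T assms cumulative_quotient)
  moreover have "\<forall>\<^sub>F h in at_right 0. (cumulative (t + h) f - cumulative t f) /\<^sub>R h - cumulative h f /\<^sub>R h
      = (T h (cumulative t f) - cumulative t f) /\<^sub>R h"
    using eventually_at_right_less[of 0]
    by eventually_elim (simp add: T_cumulative assms scaleR_diff_right)
  ultimately show ?thesis
    by (auto simp: semigroup_generator_def intro: Lim_transform_eventually)
qed

lemma generator_scaleR: "(f, g) \<in> semigroup_generator T \<Longrightarrow> (c *\<^sub>R f, c *\<^sub>R g) \<in> semigroup_generator T"
proof -
  assume "(f, g) \<in> semigroup_generator T"
  then have "((\<lambda>h. c *\<^sub>R ((T h f - f) /\<^sub>R h)) \<longlongrightarrow> c *\<^sub>R g) (at_right 0)"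
    by (intro tendsto_intros) (simp add: semigroup_generator_def)
  moreover have "\<forall>\<^sub>F h in at_right 0. c *\<^sub>R ((T h f - f) /\<^sub>R h) = (T h (c *\<^sub>R f) - c *\<^sub>R f) /\<^sub>R h"
    using eventually_at_right_less[of 0]
  proof eventually_elim
    case (elim h)
    then show ?case using linear_T[of h] by (simp add: linear_scale scaleR_diff_right mult.commute)
  qed
  ultimately show ?thesis by (auto simp: semigroup_generator_def intro: Lim_transform_eventually)
qed

lemma generator_T:
  assumes "(f, g) \<in> semigroup_generator T" "0 \<le> s"
  shows "(T s f, T s g) \<in> semigroup_generator T"
proof -
  interpret bounded_linear "T s" using assms(2) by (rule bounded_linear_T)
  have "((\<lambda>h. T s ((T h f - f) /\<^sub>R h)) \<longlongrightarrow> T s g) (at_right 0)"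
    using assms(1) by (intro tendsto) (simp add: semigroup_generator_def)
  moreover have "\<forall>\<^sub>F h in at_right 0. T s ((T h f - f) /\<^sub>R h) = (T h (T s f) - T s f) /\<^sub>R h"
    using eventually_at_right_less[of 0]
  proof eventually_elim
    case (elim h)
    then show ?case using T_add[of s h f] T_add[of h s f] assms(2) by (simp add: scaleR diff add.commute)
  qed
  ultimately show ?thesis by (auto simp: semigroup_generator_def intro: Lim_transform_eventually)
qed

lemma discounted_semigroup:
  assumes "0 \<le> l"
  shows "contraction_semigroup (\<lambda>t f. exp (- l * t) *\<^sub>R T t f)"
proof (rule contraction_semigroup.intro)
  fix s t :: real and f :: 'b
  show "linear (\<lambda>f. exp (- l * t) *\<^sub>R T t f)" if "0 \<le> t"
    by (rule linear_compose_scale_right[OF linear_T[OF that]])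
  show "norm (exp (- l * t) *\<^sub>R T t f) \<le> norm f" if "0 \<le> t"
  proof -
    have "exp (- l * t) * norm (T t f) \<le> 1 * norm f"
      using assms that norm_T[OF that] by (intro mult_mono) auto
    then show ?thesis by simp
  qed
  show "exp (- l * 0) *\<^sub>R T 0 f = f" by (simp add: T_0)
  show "exp (- l * (s + t)) *\<^sub>R T (s + t) f = exp (- l * s) *\<^sub>R T s (exp (- l * t) *\<^sub>R T t f)"
    if "0 \<le> s" "0 \<le> t"
    using linear_T[OF that(1)] T_add[OF that] by (simp add: linear_scale exp_add[symmetric] algebra_simps)
  have "((\<lambda>t. exp (- l * t) *\<^sub>R T t f) \<longlongrightarrow> exp (- l * 0) *\<^sub>R f) (at_right 0)"
    by (intro tendsto_intros T_cont)
  then show "((\<lambda>t. exp (- l * t) *\<^sub>R T t f) \<longlongrightarrow> f) (at_right 0)" by simp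
qed

text \<open>The product rule: discounting shifts the generator by \<open>- l\<close>, and adding
  \<open>l *\<^sub>R f\<close> undoes the shift. It makes a discounted time integral solve a
  resolvent equation.\<close>

lemma discounted_generator:
  assumes "(f, g) \<in> semigroup_generator (\<lambda>t f. exp (- l * t) *\<^sub>R T t f)"
  shows "(f, g + l *\<^sub>R f) \<in> semigroup_generator T"
proof -
  have "((\<lambda>h. (exp (- l * h) *\<^sub>R T h f - f) /\<^sub>R h - ((exp (- l * h) - 1) / h) *\<^sub>R T h f)
      \<longlongrightarrow> g - (- l) *\<^sub>R f) (at_right 0)"
  proof (intro tendsto_diff tendsto_scaleR T_cont)
    show "((\<lambda>h. (exp (- l * h) *\<^sub>R T h f - f) /\<^sub>R h) \<longlongrightarrow> g) (at_right 0)"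
      using assms by (simp add: semigroup_generator_def)
    have "((\<lambda>h. exp (- l * h)) has_real_derivative - l) (at 0)"
      by (auto intro!: derivative_eq_intros)
    then have "((\<lambda>h. (exp (- l * h) - 1) / h) \<longlongrightarrow> - l) (at 0)"
      by (simp add: has_field_derivative_iff)
    then show "((\<lambda>h. (exp (- l * h) - 1) / h) \<longlongrightarrow> - l) (at_right 0)"
      by (rule tendsto_within_subset) simp
  qed
  moreover have "\<forall>\<^sub>F h in at_right 0. (exp (- l * h) *\<^sub>R T h f - f) /\<^sub>R h - ((exp (- l * h) - 1) / h) *\<^sub>R T h f
      = (T h f - f) /\<^sub>R h"
    using eventually_at_right_less[of 0]
    by eventually_elim (simp add: scaleR_diff_right scaleR_diff_left divide_inverse algebra_simps)
  ultimately show ?thesis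
    by (auto simp: semigroup_generator_def intro: Lim_transform_eventually)
qed

text \<open>An implicit Euler step bounds \<^term>\<open>T (s + h) f\<close> in terms of \<^term>\<open>T s f\<close> up to an error of order
  \<open>o(h)\<close>, uniformly in \<open>s\<close>.\<close>

lemma invariant_lower_bound_domain:
  fixes L :: "'i \<Rightarrow> 'b \<Rightarrow> real"
  assumes lin: "\<And>i. linear (L i)" and bound: "\<And>i f. \<bar>L i f\<bar> \<le> k * norm f" and "0 \<le> k"
    and diss: "\<And>f g h c. (f, g) \<in> semigroup_generator T \<Longrightarrow> 0 < h \<Longrightarrow> 0 \<le> c \<Longrightarrow>
      (\<And>i. - c \<le> L i (f - h *\<^sub>R g)) \<Longrightarrow> (\<And>i. - c \<le> L i f)"
    and fg: "(f, g) \<in> semigroup_generator T" and c: "0 \<le> c" "\<And>i. - c \<le> L i f" and t: "0 \<le> t"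
  shows "- c \<le> L i (T t f)"
proof (cases "t = 0")
  case False
  with t have "0 < t" by simp
  \<comment> \<open>The defect of one implicit Euler step. Since \<open>f\<close> lies in the domain
    it is \<open>o(h)\<close>, and contractivity bounds the defect of a step at any time
    \<open>s\<close> by the same number.\<close>
  define \<omega> where "\<omega> h = norm (f - T h f + h *\<^sub>R T h g)" for h
  have step: "- (c' + k * \<omega> h) \<le> L j (T (s + h) f)"
    if "0 < h" "0 \<le> s" "0 \<le> c'" "\<And>i. - c' \<le> L i (T s f)" for h s c' j
  \<comment> \<open>\<open>diss\<close> is applied to \<open>T (s + h) f\<close>, which already lies
    in the domain; its image under \<open>I - h A\<close>, with generator \<open>A\<close>, is
    \<open>T s f\<close> up to the defect \<open>e\<close>.\<close>
  proof (rule diss[OF generator_T[OF fg]])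
    show "0 \<le> s + h" "0 < h" "0 \<le> c' + k * \<omega> h" using that \<open>0 \<le> k\<close> by (auto simp: \<omega>_def)
    fix i
    interpret bounded_linear "T s" using that(2) by (rule bounded_linear_T)
    define e where "e = T (s + h) f - h *\<^sub>R T (s + h) g - T s f"
    have "e = - T s (f - T h f + h *\<^sub>R T h g)"
      using that by (simp add: e_def T_add add diff scaleR)
    then have "norm e \<le> \<omega> h" using norm_T[OF that(2)] by (simp add: \<omega>_def)
    then have "k * norm e \<le> k * \<omega> h" using \<open>0 \<le> k\<close> by (rule mult_left_mono)
    with bound[of i e] have "- (k * \<omega> h) \<le> L i e" by simp
    moreover have "L i (T (s + h) f - h *\<^sub>R T (s + h) g) = L i (T s f) + L i e"
      using linear_add[OF lin[of i], of "T s f" e] by (simp add: e_def)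
    ultimately show "- (c' + k * \<omega> h) \<le> L i (T (s + h) f - h *\<^sub>R T (s + h) g)"
      using that(4)[of i] by simp
  qed
  have iter: "- (c + real n * (k * \<omega> h)) \<le> L j (T (real n * h) f)" if "0 < h" for n h j
  proof (induction n arbitrary: j)
    case 0
    then show ?case using c by (simp add: T_0)
  next
    case (Suc n)
    have "- (c + real n * (k * \<omega> h) + k * \<omega> h) \<le> L j (T (real n * h + h) f)"
    proof (rule step[OF that])
      show "0 \<le> c + real n * (k * \<omega> h)" using c \<open>0 \<le> k\<close> by (simp add: \<omega>_def)
    qed (use that Suc in auto)
    then show ?case by (simp add: algebra_simps)
  qed
  have "((\<lambda>h. \<omega> h / h) \<longlongrightarrow> 0) (at_right 0)"
  proof -
    have "((\<lambda>h. norm (T h g - (T h f - f) /\<^sub>R h)) \<longlongrightarrow> norm (g - g)) (at_right 0)"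
      using fg by (intro tendsto_intros T_cont) (simp add: semigroup_generator_def)
    moreover have "\<forall>\<^sub>F h in at_right 0. norm (T h g - (T h f - f) /\<^sub>R h) = \<omega> h / h"
      using eventually_at_right_less[of 0]
    proof eventually_elim
      case (elim h)
      have "f - T h f + h *\<^sub>R T h g = h *\<^sub>R (T h g - (T h f - f) /\<^sub>R h)"
        using elim by (simp add: algebra_simps)
      then show ?case using elim by (simp add: \<omega>_def)
    qed
    ultimately show ?thesis by (auto intro: Lim_transform_eventually)
  qed
  moreover have "filterlim (\<lambda>n. t / real (Suc n)) (at_right 0) sequentially"
    using \<open>0 < t\<close> LIMSEQ_Suc[OF lim_const_over_n[of t]]
    by (auto simp: filterlim_at intro!: always_eventually)
  ultimately have "(\<lambda>n. \<omega> (t / real (Suc n)) / (t / real (Suc n))) \<longlonglongrightarrow> 0"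
    by (rule filterlim_compose)
  then have "(\<lambda>n. - (c + t * k * (\<omega> (t / real (Suc n)) / (t / real (Suc n))))) \<longlonglongrightarrow> - (c + t * k * 0)"
    by (intro tendsto_intros)
  moreover have "- (c + t * k * (\<omega> (t / real (Suc n)) / (t / real (Suc n)))) \<le> L i (T t f)" for n
  proof -
    define h where "h = t / real (Suc n)"
    have h: "0 < h" "real (Suc n) * h = t" using \<open>0 < t\<close> by (simp_all add: h_def)
    have "t * k * (\<omega> h / h) = real (Suc n) * (k * \<omega> h)"
      using h(1) unfolding h(2)[symmetric] by simp
    then show ?thesis using iter[OF h(1), of "Suc n" i] unfolding h(2) h_def[symmetric] by simp
  qed
  ultimately show ?thesis by (intro LIMSEQ_le_const2) auto
qed (use c in \<open>simp add: T_0\<close>)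

text \<open>An element of the cone is replaced by its time average, which lies in the domain but may
  leave the cone by as much as \<open>k * norm (d h)\<close>. This is why \<open>diss\<close> and
  \<open>invariant_lower_bound_domain\<close> carry a slack \<open>c\<close> in place of 0.\<close>

lemma invariant_cone:
  fixes L :: "'i \<Rightarrow> 'b \<Rightarrow> real"
  assumes lin: "\<And>i. linear (L i)" and bound: "\<And>i f. \<bar>L i f\<bar> \<le> k * norm f" and "0 \<le> k"
    and diss: "\<And>f g h c. (f, g) \<in> semigroup_generator T \<Longrightarrow> 0 < h \<Longrightarrow> 0 \<le> c \<Longrightarrow>
      (\<And>i. - c \<le> L i (f - h *\<^sub>R g)) \<Longrightarrow> (\<And>i. - c \<le> L i f)"
    and pos: "\<And>i. 0 \<le> L i f" and t: "0 \<le> t"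
  shows "0 \<le> L i (T t f)"
proof -
  define d where "d h = cumulative h f /\<^sub>R h - f" for h
  have "- (2 * (k * norm (d h))) \<le> L i (T t f)" if "0 < h" for h
  proof -
    interpret bounded_linear "T t" using t by (rule bounded_linear_T)
    define e where "e = k * norm (d h)"
    have e: "0 \<le> e" using \<open>0 \<le> k\<close> by (simp add: e_def)
    have "- e \<le> L j (cumulative h f /\<^sub>R h)" for j
    proof -
      have "L j (cumulative h f /\<^sub>R h) = L j f + L j (d h)"
        using linear_add[OF lin[of j], of f "d h"] by (simp add: d_def)
      then show ?thesis using pos[of j] bound[of j "d h"] by (simp add: e_def)
    qed
    then have "- e \<le> L i (T t (cumulative h f /\<^sub>R h))"
    proof (intro invariant_lower_bound_domain[where L = L, OF lin bound \<open>0 \<le> k\<close>])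
      show "(cumulative h f /\<^sub>R h, (T h f - f) /\<^sub>R h) \<in> semigroup_generator T"
        using that by (intro generator_scaleR cumulative_in_generator) simp
    qed (use e t diss in blast)+
    moreover have "L i (T t (cumulative h f /\<^sub>R h)) = L i (T t f) + L i (T t (d h))"
      using linear_add[OF lin[of i], of "T t f" "T t (d h)"] by (simp add: d_def diff)
    moreover have "L i (T t (d h)) \<le> e"
    proof -
      have "L i (T t (d h)) \<le> k * norm (T t (d h))" using bound[of i "T t (d h)"] by simp
      also have "\<dots> \<le> e" unfolding e_def using norm_T[OF t] \<open>0 \<le> k\<close> by (intro mult_left_mono)
      finally show ?thesis .
    qed
    ultimately show ?thesis by (simp add: e_def)
  qed
  then have ev: "\<forall>\<^sub>F h in at_right 0. - (2 * (k * norm (d h))) \<le> L i (T t f)"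
    using eventually_at_right_less[of 0] by (auto elim: eventually_mono)
  have "((\<lambda>h. - (2 * (k * norm (d h)))) \<longlongrightarrow> - (2 * (k * norm (f - f)))) (at_right 0)"
    unfolding d_def by (intro tendsto_intros cumulative_quotient)
  from tendsto_upperbound[OF this ev] show ?thesis by simp
qed

end

section \<open>Cylinder functions and weak limits\<close>

text \<open>One implication suffices, the two configurations being interchangeable. These sets form
  an algebra of clopen sets.\<close>

definition cylinder :: "('s \<Rightarrow> bool) set \<Rightarrow> bool" where
  "cylinder E \<longleftrightarrow> (\<exists>A. finite A \<and> (\<forall>\<eta> \<zeta>. (\<forall>x\<in>A. \<eta> x = \<zeta> x) \<longrightarrow> \<eta> \<in> E \<longrightarrow> \<zeta> \<in> E))"

lemma open_contains_cylinder:
  fixes U :: "('s \<Rightarrow> bool) set"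
  assumes "open U" "\<eta> \<in> U"
  obtains A where "finite A" "{\<zeta>. \<forall>x\<in>A. \<zeta> x = \<eta> x} \<subseteq> U"
proof -
  have "openin (product_topology (\<lambda>i. euclidean) UNIV) U"
    using assms(1) by (simp add: open_fun_def)
  from product_topology_open_contains_basis[OF this assms(2)]
  obtain X where X: "\<eta> \<in> Pi\<^sub>E UNIV X" "finite {i. X i \<noteq> topspace euclidean}" "Pi\<^sub>E UNIV X \<subseteq> U"
    by blast
  show thesis
  proof (rule that)
    show "finite {i. X i \<noteq> UNIV}" using X(2) by simp
    have "\<zeta> \<in> Pi\<^sub>E UNIV X" if "\<forall>x\<in>{i. X i \<noteq> UNIV}. \<zeta> x = \<eta> x" for \<zeta>
    proof (rule PiE_I)
      fix i
      show "\<zeta> i \<in> X i" using that X(1) by (cases "X i = UNIV") (auto simp: PiE_iff)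
    qed simp
    then show "{\<zeta>. \<forall>x\<in>{i. X i \<noteq> UNIV}. \<zeta> x = \<eta> x} \<subseteq> U" using X(3) by blast
  qed
qed

lemma open_bool_singleton: "open {b :: bool}"
proof -
  have "{True} = {False<..}" "{False} = {..<True}" by auto
  then show ?thesis by (cases b) (metis open_greaterThan, metis open_lessThan)
qed

lemma open_agreeing:
  fixes \<eta> :: "'s \<Rightarrow> bool"
  assumes "finite A"
  shows "open {\<zeta>. \<forall>x\<in>A. \<zeta> x = \<eta> x}"
proof -
  have "open {\<zeta>. \<forall>x\<in>A. \<zeta> x \<in> {\<eta> x}}"
    by (rule product_topology_basis'[where x = "\<lambda>x. x"]) (auto simp: assms intro: open_bool_singleton)
  then show ?thesis by simp
qed

lemma open_cylinder: "cylinder E \<Longrightarrow> open E"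
proof (subst open_subopen, intro ballI)
  fix \<eta> assume "cylinder E" "\<eta> \<in> E"
  then obtain A where A: "finite A" "\<forall>\<eta> \<zeta>. (\<forall>x\<in>A. \<eta> x = \<zeta> x) \<longrightarrow> \<eta> \<in> E \<longrightarrow> \<zeta> \<in> E"
    unfolding cylinder_def by blast
  have "{\<zeta>. \<forall>x\<in>A. \<zeta> x = \<eta> x} \<subseteq> E"
  proof
    fix \<zeta> assume "\<zeta> \<in> {\<zeta>. \<forall>x\<in>A. \<zeta> x = \<eta> x}"
    then have "\<forall>x\<in>A. \<eta> x = \<zeta> x" by simp
    with A(2) \<open>\<eta> \<in> E\<close> show "\<zeta> \<in> E" by blast
  qed
  then show "\<exists>T. open T \<and> \<eta> \<in> T \<and> T \<subseteq> E"
    using open_agreeing[OF A(1), of \<eta>] by blast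
qed

lemma cylinder_Compl: "cylinder E \<Longrightarrow> cylinder (- E)"
  unfolding cylinder_def by (metis ComplD ComplI)

lemma cylinder_Int:
  assumes "cylinder E" "cylinder F"
  shows "cylinder (E \<inter> F)"
proof -
  from assms obtain A B where "finite A" "\<forall>\<eta> \<zeta>. (\<forall>x\<in>A. \<eta> x = \<zeta> x) \<longrightarrow> \<eta> \<in> E \<longrightarrow> \<zeta> \<in> E"
      "finite B" "\<forall>\<eta> \<zeta>. (\<forall>x\<in>B. \<eta> x = \<zeta> x) \<longrightarrow> \<eta> \<in> F \<longrightarrow> \<zeta> \<in> F"
    unfolding cylinder_def by blast
  then show ?thesis
    unfolding cylinder_def by (intro exI[of _ "A \<union> B"]) (simp add: ball_Un, blast)
qed

lemma cylinder_empty: "cylinder {}"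
  unfolding cylinder_def by (intro exI[of _ "{}"]) simp

lemma cylinder_Un: "cylinder E \<Longrightarrow> cylinder F \<Longrightarrow> cylinder (E \<union> F)"
  using cylinder_Compl[OF cylinder_Int[OF cylinder_Compl cylinder_Compl]] by simp

lemma cylinder_Diff: "cylinder E \<Longrightarrow> cylinder F \<Longrightarrow> cylinder (E - F)"
  using cylinder_Int[OF _ cylinder_Compl] by (simp add: Diff_eq)

lemma cylinder_vimage: "finitely_dependent f \<Longrightarrow> cylinder (f -` V)"
  unfolding finitely_dependent_def cylinder_def by (metis vimage_eq)

lemma finitely_dependent_indicator:
  assumes "cylinder E" shows "finitely_dependent (indicat_real E)"
proof -
  from assms obtain A where A: "finite A" "\<forall>\<eta> \<zeta>. (\<forall>x\<in>A. \<eta> x = \<zeta> x) \<longrightarrow> \<eta> \<in> E \<longrightarrow> \<zeta> \<in> E"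
    unfolding cylinder_def by blast
  then have iff: "\<eta> \<in> E \<longleftrightarrow> \<zeta> \<in> E" if "\<forall>x\<in>A. \<eta> x = \<zeta> x" for \<eta> \<zeta> using that by metis
  show ?thesis
    unfolding finitely_dependent_def
  proof (intro exI conjI allI impI)
    show "indicat_real E \<eta> = indicat_real E \<zeta>" if "\<forall>x\<in>A. \<eta> x = \<zeta> x" for \<eta> \<zeta>
      using iff[OF that] by (simp add: indicator_def)
  qed fact
qed

lemma finitely_dependent_continuous:
  fixes f :: "('s \<Rightarrow> bool) \<Rightarrow> real"
  shows "finitely_dependent f \<Longrightarrow> continuous_on UNIV f"
  by (simp add: continuous_on_open_vimage open_cylinder cylinder_vimage)

lemma finitely_dependentE:
  assumes "finitely_dependent f"
  obtains A where "finite A" "\<And>\<eta> \<zeta>. (\<And>x. x \<in> A \<Longrightarrow> \<eta> x = \<zeta> x) \<Longrightarrow> f \<eta> = f \<zeta>"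
proof -
  obtain A where "finite A" and A: "\<forall>\<eta> \<zeta>. (\<forall>x\<in>A. \<eta> x = \<zeta> x) \<longrightarrow> f \<eta> = f \<zeta>"
    using assms unfolding finitely_dependent_def by blast
  show thesis
    by (rule that[OF \<open>finite A\<close>]) (rule A[rule_format])
qed

lemma finite_range_finitely_dependent:
  assumes "finitely_dependent f"
  shows "finite (range f)"
proof -
  obtain A where A: "finite A" "\<And>\<eta> \<zeta>. (\<And>x. x \<in> A \<Longrightarrow> \<eta> x = \<zeta> x) \<Longrightarrow> f \<eta> = f \<zeta>"
    by (rule finitely_dependentE[OF assms]) blast
  have "range f \<subseteq> (\<lambda>B. f (\<lambda>x. x \<in> B)) ` Pow A"
  proof (rule image_subsetI)
    fix \<eta>
    have "f \<eta> = f (\<lambda>x. x \<in> {x \<in> A. \<eta> x})" by (rule A(2)) simp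
    then show "f \<eta> \<in> (\<lambda>B. f (\<lambda>x. x \<in> B)) ` Pow A" by (rule image_eqI) auto
  qed
  then show ?thesis using A(1) by (simp add: finite_subset)
qed

lemma finitely_dependent_bcontfun:
  fixes f :: "('s \<Rightarrow> bool) \<Rightarrow> real"
  assumes "finitely_dependent f" shows "f \<in> bcontfun"
  using finitely_dependent_continuous[OF assms] finite_imp_bounded[OF finite_range_finitely_dependent[OF assms]]
  by (simp add: bcontfun_def)

lemma compact_configurations: "compact (UNIV :: ('s \<Rightarrow> bool) set)"
proof -
  have "compact (UNIV :: bool set)" by (simp add: finite_imp_compact)
  then have "compactin (product_topology (\<lambda>i :: 's. euclidean :: bool topology) UNIV) (Pi\<^sub>E UNIV (\<lambda>_. UNIV))"
    by (subst compactin_PiE) (simp add: compactin_euclidean_iff)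
  then show ?thesis by (simp add: euclidean_product_topology compactin_euclidean_iff PiE_UNIV_domain)
qed

text \<open>By compactness finitely many neighbourhoods on which \<open>f\<close> varies little
  cover the space. If \<open>Z\<close> contains the sites that determine them, emptying all sites
  outside \<open>Z\<close> keeps a configuration in its neighbourhood.\<close>

lemma finitely_dependent_dense:
  fixes f :: "('s \<Rightarrow> bool) \<Rightarrow>\<^sub>C real"
  assumes "0 < e"
  obtains g where "finitely_dependent (apply_bcontfun g)" "norm (f - g) \<le> e"
proof -
  have "\<exists>A. finite A \<and> (\<forall>\<zeta>. (\<forall>x\<in>A. \<zeta> x = \<eta> x) \<longrightarrow> dist (f \<zeta>) (f \<eta>) < e / 2)" for \<eta>
  proof -
    have "open (apply_bcontfun f -` ball (f \<eta>) (e / 2))"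
      by (rule open_vimage) auto
    moreover have "\<eta> \<in> apply_bcontfun f -` ball (f \<eta>) (e / 2)" using \<open>0 < e\<close> by simp
    ultimately obtain A where "finite A" "{\<zeta>. \<forall>x\<in>A. \<zeta> x = \<eta> x} \<subseteq> apply_bcontfun f -` ball (f \<eta>) (e / 2)"
      by (rule open_contains_cylinder)
    show ?thesis
    proof (intro exI conjI allI impI)
      fix \<zeta> assume "\<forall>x\<in>A. \<zeta> x = \<eta> x"
      then have "\<zeta> \<in> apply_bcontfun f -` ball (f \<eta>) (e / 2)"
        using \<open>{\<zeta>. \<forall>x\<in>A. \<zeta> x = \<eta> x} \<subseteq> _\<close> by blast
      then show "dist (f \<zeta>) (f \<eta>) < e / 2" by (simp add: dist_commute)
    qed fact
  qed
  then have "\<exists>A. \<forall>\<eta>. finite (A \<eta>) \<and> (\<forall>\<zeta>. (\<forall>x\<in>A \<eta>. \<zeta> x = \<eta> x) \<longrightarrow> dist (f \<zeta>) (f \<eta>) < e / 2)"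
    by (intro choice allI)
  then obtain A where A': "\<forall>\<eta>. finite (A \<eta>) \<and> (\<forall>\<zeta>. (\<forall>x\<in>A \<eta>. \<zeta> x = \<eta> x) \<longrightarrow> dist (f \<zeta>) (f \<eta>) < e / 2)" ..
  have A: "finite (A \<eta>)" "(\<And>x. x \<in> A \<eta> \<Longrightarrow> \<zeta> x = \<eta> x) \<Longrightarrow> dist (f \<zeta>) (f \<eta>) < e / 2" for \<eta> \<zeta>
    using A'[rule_format, of \<eta>] by blast+
  define N where "N \<eta> = {\<zeta>. \<forall>x\<in>A \<eta>. \<zeta> x = \<eta> x}" for \<eta>
  have "open (N \<eta>)" for \<eta> unfolding N_def by (rule open_agreeing[OF A(1)])
  moreover have "UNIV \<subseteq> (\<Union>\<eta>. N \<eta>)" by (auto simp: N_def)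
  ultimately obtain H where H: "finite H" "UNIV \<subseteq> (\<Union>\<eta>\<in>H. N \<eta>)"
    using compactE_image[OF compact_configurations, of UNIV N] by auto
  define Z where "Z = (\<Union>\<eta>\<in>H. A \<eta>)"
  define g where "g \<zeta> = f (\<lambda>x. x \<in> Z \<and> \<zeta> x)" for \<zeta>
  have "finite Z" using H(1) A(1) by (simp add: Z_def)
  have fd: "finitely_dependent g"
    unfolding finitely_dependent_def
  proof (intro exI conjI allI impI)
    fix \<eta> \<zeta> :: "'s \<Rightarrow> bool" assume "\<forall>x\<in>Z. \<eta> x = \<zeta> x"
    then have "(\<lambda>x. x \<in> Z \<and> \<eta> x) = (\<lambda>x. x \<in> Z \<and> \<zeta> x)" by auto
    then show "g \<eta> = g \<zeta>" by (simp add: g_def)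
  qed fact
  have app: "apply_bcontfun (Bcontfun g) = g"
    using finitely_dependent_bcontfun[OF fd] by (rule Bcontfun_inverse)
  show thesis
  proof (rule that)
    show "finitely_dependent (apply_bcontfun (Bcontfun g))" using fd by (simp add: app)
    show "norm (f - Bcontfun g) \<le> e"
    proof (rule norm_bound)
      fix \<zeta>
      obtain \<eta> where \<eta>: "\<eta> \<in> H" "\<zeta> \<in> N \<eta>" using H(2) by auto
      have "dist (f \<zeta>) (f \<eta>) < e / 2" by (rule A(2)) (use \<eta> in \<open>simp add: N_def\<close>)
      moreover have "dist (g \<zeta>) (f \<eta>) < e / 2"
        unfolding g_def by (rule A(2)) (use \<eta> in \<open>auto simp: N_def Z_def\<close>)
      moreover have "norm (apply_bcontfun (f - Bcontfun g) \<zeta>) = \<bar>f \<zeta> - g \<zeta>\<bar>" by (simp add: app)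
      ultimately show "norm (apply_bcontfun (f - Bcontfun g) \<zeta>) \<le> e"
        unfolding dist_real_def by linarith
    qed
  qed
qed

section \<open>Borel probabilities determined by cylinders\<close>

lemma borel_eq_sigma_cylinder:
  "sets (borel :: ('s::countable \<Rightarrow> bool) measure) = sigma_sets UNIV (Collect cylinder)"
proof -
  have "sigma_sets UNIV {S. open S} = sigma_sets UNIV (Collect (cylinder :: ('s \<Rightarrow> bool) set \<Rightarrow> bool))"
  proof (rule sigma_sets_eqI)
    fix E :: "('s \<Rightarrow> bool) set" assume "E \<in> Collect cylinder"
    then show "E \<in> sigma_sets UNIV {S. open S}" by (auto intro: open_cylinder)
  next
    fix U :: "('s \<Rightarrow> bool) set" assume "U \<in> {S. open S}"
    then have U: "open U" by simp
    define I where "I = {(A :: 's set, B :: 's set). finite A \<and> B \<subseteq> A}"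
    define E where "E = (\<lambda>(A, B). {\<zeta> :: 's \<Rightarrow> bool. \<forall>x\<in>A. \<zeta> x \<longleftrightarrow> x \<in> B})"
    have "countable I"
    proof (rule countable_subset)
      show "I \<subseteq> {A. finite A} \<times> {A. finite A}" by (auto simp: I_def intro: finite_subset)
      show "countable ({A :: 's set. finite A} \<times> {A :: 's set. finite A})"
        using countable_Collect_finite_subset[of "UNIV :: 's set"] by (auto intro!: countable_SIGMA)
    qed
    then have cI: "countable {i \<in> I. E i \<subseteq> U}" by (rule countable_subset[rotated]) auto
    have U_eq: "U = (\<Union>i\<in>{i \<in> I. E i \<subseteq> U}. E i)"
    proof (intro set_eqI iffI)
      fix \<eta> assume "\<eta> \<in> U"
      with U obtain A where A: "finite A" "{\<zeta>. \<forall>x\<in>A. \<zeta> x = \<eta> x} \<subseteq> U" by (rule open_contains_cylinder)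
      have "E (A, {x \<in> A. \<eta> x}) = {\<zeta>. \<forall>x\<in>A. \<zeta> x = \<eta> x}" by (auto simp: E_def)
      with A show "\<eta> \<in> (\<Union>i\<in>{i \<in> I. E i \<subseteq> U}. E i)"
        by (intro UN_I[of "(A, {x \<in> A. \<eta> x})"]) (auto simp: I_def)
    qed blast
    have E_in: "E i \<in> sigma_sets UNIV (Collect cylinder)" if "i \<in> {i \<in> I. E i \<subseteq> U}" for i
    proof -
      obtain A B where "i = (A, B)" "finite A" using \<open>i \<in> _\<close> by (auto simp: I_def)
      then have "cylinder (E i)" unfolding cylinder_def by (intro exI[of _ A]) (simp add: E_def)
      then show ?thesis by auto
    qed
    show "U \<in> sigma_sets UNIV (Collect cylinder)"
      by (subst U_eq, rule sigma_sets_UNION) (use cI E_in in auto)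
  qed
  then show ?thesis by (simp add: borel_def)
qed

lemma cylinder_sets [measurable]: "cylinder E \<Longrightarrow> E \<in> sets (borel :: ('s::countable \<Rightarrow> bool) measure)"
  by (simp add: open_cylinder)

lemma measure_eqI_cylinder:
  fixes M N :: "('s::countable \<Rightarrow> bool) measure"
  assumes "prob_space M" "sets M = sets borel" "prob_space N" "sets N = sets borel"
    and eq: "\<And>E. cylinder E \<Longrightarrow> measure M E = measure N E"
  shows "M = N"
proof (rule measure_eqI_generator_eq[where E = "Collect cylinder" and \<Omega> = UNIV and A = "\<lambda>_. UNIV"])
  interpret M: prob_space M by fact
  interpret N: prob_space N by fact
  show "Int_stable (Collect (cylinder :: ('s \<Rightarrow> bool) set \<Rightarrow> bool))"
    by (auto simp: Int_stable_def cylinder_Int)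
  show "emeasure M E = emeasure N E" if "E \<in> Collect cylinder" for E
    using eq[of E] that by (simp add: M.emeasure_eq_measure N.emeasure_eq_measure)
  have "cylinder (UNIV :: ('s \<Rightarrow> bool) set)" using cylinder_Compl[OF cylinder_empty] by simp
  then show "range (\<lambda>_::nat. UNIV) \<subseteq> Collect (cylinder :: ('s \<Rightarrow> bool) set \<Rightarrow> bool)" by auto
qed (use assms in \<open>auto simp: borel_eq_sigma_cylinder prob_space.finite_measure finite_measure.emeasure_finite\<close>)

text \<open>By compactness, a finitely additive probability on the clopen sets is countably additive.\<close>

lemma probability_from_cylinders:
  fixes c :: "('s::countable \<Rightarrow> bool) set \<Rightarrow> real"
  assumes nonneg: "\<And>E. cylinder E \<Longrightarrow> 0 \<le> c E"
    and additive: "\<And>E F. cylinder E \<Longrightarrow> cylinder F \<Longrightarrow> E \<inter> F = {} \<Longrightarrow> c (E \<union> F) = c E + c F"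
    and one: "c UNIV = 1"
  obtains \<nu> where "prob_space \<nu>" "sets \<nu> = sets borel" "\<And>E. cylinder E \<Longrightarrow> measure \<nu> E = c E"
proof -
  have c0: "c {} = 0" using additive[OF cylinder_empty cylinder_empty] by simp
  interpret ring_of_sets UNIV "Collect (cylinder :: ('s \<Rightarrow> bool) set \<Rightarrow> bool)"
    by (rule ring_of_setsI) (auto simp: cylinder_empty cylinder_Un cylinder_Diff)
  have "\<exists>m. (\<forall>E\<in>Collect cylinder. m E = ennreal (c E)) \<and> measure_space UNIV (sigma_sets UNIV (Collect cylinder)) m"
  proof (rule caratheodory_empty_continuous)
    show "positive (Collect cylinder) (\<lambda>E. ennreal (c E))" by (simp add: positive_def c0)
    show "Measure_Space.additive (Collect cylinder) (\<lambda>E. ennreal (c E))"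
      by (auto simp: Measure_Space.additive_def additive nonneg ennreal_plus)
    show "(\<lambda>i. ennreal (c (A i))) \<longlonglongrightarrow> 0"
      if A: "range A \<subseteq> Collect cylinder" "decseq A" "(\<Inter>i. A i) = {}" for A
    proof -
      have "\<exists>n. A n = {}"
      proof (rule ccontr)
        assume "\<nexists>n. A n = {}"
        have "UNIV \<inter> \<Inter> (range A) \<noteq> {}"
        proof (rule compact_imp_fip[OF compact_configurations])
          show "closed T" if "T \<in> range A" for T
            using that A(1) cylinder_Compl open_cylinder by (auto simp: closed_def)
          fix F assume F: "finite F" "F \<subseteq> range A"
          then obtain I where I: "finite I" "F = A ` I" by (meson finite_subset_image)
          define n where "n = Max (insert 0 I)"
          have "A n \<subseteq> A i" if "i \<in> I" for i
            unfolding n_def by (rule decseqD[OF A(2) Max_ge]) (use I(1) that in auto)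
          then have "A n \<subseteq> \<Inter> F" unfolding I(2) by blast
          moreover have "A n \<noteq> {}" using \<open>\<nexists>n. A n = {}\<close> by blast
          ultimately show "UNIV \<inter> \<Inter> F \<noteq> {}" by blast
        qed
        with A(3) show False by simp
      qed
      then obtain n where n: "A n = {}" ..
      have "A m = {}" if "n \<le> m" for m using decseqD[OF A(2) that] n by auto
      then have "\<forall>\<^sub>F m in sequentially. ennreal (c (A m)) = 0"
        unfolding eventually_sequentially by (intro exI[of _ n]) (simp add: c0)
      then show ?thesis by (rule tendsto_eventually)
    qed
  qed simp
  then obtain m where m: "\<And>E. cylinder E \<Longrightarrow> m E = ennreal (c E)"
      "measure_space UNIV (sigma_sets UNIV (Collect cylinder)) m" by blast
  define \<nu> where "\<nu> = measure_of UNIV (Collect cylinder) m"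
  have sets: "sets \<nu> = sets borel" by (simp add: \<nu>_def borel_eq_sigma_cylinder)
  have em: "emeasure \<nu> E = ennreal (c E)" if "cylinder E" for E
  proof -
    have "emeasure \<nu> E = m E"
      using m(2) that
      by (intro emeasure_measure_of[OF \<nu>_def]) (auto simp: sets borel_eq_sigma_cylinder measure_space_def)
    then show ?thesis using m(1)[OF that] by simp
  qed
  have UNIV: "cylinder (UNIV :: ('s \<Rightarrow> bool) set)" using cylinder_Compl[OF cylinder_empty] by simp
  have "space \<nu> = UNIV" by (simp add: \<nu>_def)
  show thesis
  proof (rule that[OF _ sets])
    show "prob_space \<nu>" by (rule prob_spaceI) (simp add: \<open>space \<nu> = UNIV\<close> em[OF UNIV] one)
    show "measure \<nu> E = c E" if "cylinder E" for E
      using em[OF that] nonneg[OF that] by (simp add: measure_def)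
  qed
qed

lemma integrable_bcontfun:
  assumes "prob_space M" "sets M = sets borel"
  shows "integrable M (apply_bcontfun f :: _ \<Rightarrow> real)"
proof -
  interpret prob_space M by fact
  have "apply_bcontfun f \<in> borel_measurable borel"
    by (intro borel_measurable_continuous_onI) simp
  then show ?thesis
    using norm_bounded[of f] assms(2)
    by (intro integrable_const_bound[where B = "norm f"]) (auto cong: measurable_cong_sets)
qed

lemma integral_bcontfun_bound:
  assumes "prob_space M" "sets M = sets borel"
  shows "\<bar>\<integral>\<eta>. apply_bcontfun f \<eta> \<partial>M\<bar> \<le> norm (f :: _ \<Rightarrow>\<^sub>C real)"
proof -
  interpret prob_space M by fact
  have "norm (\<integral>\<eta>. apply_bcontfun f \<eta> \<partial>M) \<le> (\<integral>\<eta>. norm f \<partial>M)"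
    using norm_bounded[of f]
    by (intro integral_norm_bound[THEN order_trans] integral_mono integrable_norm integrable_bcontfun assms) auto
  then show ?thesis by (simp add: prob_space)
qed

lemma bounded_linear_integral_bcontfun:
  assumes "prob_space M" "sets M = sets borel"
  shows "bounded_linear (\<lambda>f. \<integral>\<eta>. apply_bcontfun f \<eta> \<partial>M :: real)"
proof (rule bounded_linear_intro[where K = 1])
  fix f g :: "'a \<Rightarrow>\<^sub>C real" and r :: real
  show "(\<integral>\<eta>. apply_bcontfun (f + g) \<eta> \<partial>M) = (\<integral>\<eta>. apply_bcontfun f \<eta> \<partial>M) + (\<integral>\<eta>. apply_bcontfun g \<eta> \<partial>M)"
    by (simp add: integrable_bcontfun[OF assms])
  show "(\<integral>\<eta>. apply_bcontfun (r *\<^sub>R f) \<eta> \<partial>M) = r *\<^sub>R (\<integral>\<eta>. apply_bcontfun f \<eta> \<partial>M)" by simp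
  show "norm (\<integral>\<eta>. apply_bcontfun f \<eta> \<partial>M) \<le> norm f * 1"
    using integral_bcontfun_bound[OF assms, of f] by simp
qed

lemma integral_finitely_dependent:
  fixes M :: "('s::countable \<Rightarrow> bool) measure"
  assumes "prob_space M" "sets M = sets borel" "finitely_dependent f"
  shows "(\<integral>\<eta>. f \<eta> \<partial>M) = (\<Sum>v\<in>range f. v * measure M (f -` {v}))"
proof -
  interpret prob_space M by fact
  note fin = finite_range_finitely_dependent[OF assms(3)]
  have sets: "f -` {v} \<in> sets M" for v
    using cylinder_sets[OF cylinder_vimage[OF assms(3)]] assms(2) by blast
  have f_eq: "f \<eta> = (\<Sum>v\<in>range f. v * indicator (f -` {v}) \<eta>)" for \<eta>
  proof -
    have "(\<Sum>v\<in>range f. v * indicator (f -` {v}) \<eta>) = (\<Sum>v\<in>range f. if v = f \<eta> then v else 0)"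
      by (intro sum.cong) (auto simp: indicator_def)
    also have "\<dots> = f \<eta>" using fin by simp
    finally show ?thesis by simp
  qed
  have "(\<integral>\<eta>. f \<eta> \<partial>M) = (\<integral>\<eta>. (\<Sum>v\<in>range f. v * indicator (f -` {v}) \<eta>) \<partial>M)"
    by (rule Bochner_Integration.integral_cong[OF refl]) (rule f_eq)
  also have "\<dots> = (\<Sum>v\<in>range f. (\<integral>\<eta>. v * indicator (f -` {v}) \<eta> \<partial>M))"
    using sets by (intro Bochner_Integration.integral_sum) (simp add: emeasure_eq_measure)
  also have "\<dots> = (\<Sum>v\<in>range f. v * measure M (f -` {v}))"
    using sets sets_eq_imp_space_eq[OF assms(2)] by (intro sum.cong) auto
  finally show ?thesis .
qed

lemma weak_limit_finitely_dependent:
  fixes m :: "'i \<Rightarrow> ('s::countable \<Rightarrow> bool) measure"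
  assumes \<nu>: "prob_space \<nu>" "sets \<nu> = sets borel"
    and m: "\<forall>\<^sub>F i in F. prob_space (m i) \<and> sets (m i) = sets borel"
    and conv: "\<And>f :: ('s \<Rightarrow> bool) \<Rightarrow>\<^sub>C real. finitely_dependent f \<Longrightarrow>
      ((\<lambda>i. \<integral>\<eta>. f \<eta> \<partial>m i) \<longlongrightarrow> (\<integral>\<eta>. f \<eta> \<partial>\<nu>)) F"
  shows "weak_limit m \<nu> F"
  unfolding weak_limit_def
proof (intro conjI allI \<nu>)
  fix f :: "('s \<Rightarrow> bool) \<Rightarrow>\<^sub>C real"
  show "((\<lambda>i. \<integral>\<eta>. f \<eta> \<partial>m i) \<longlongrightarrow> (\<integral>\<eta>. f \<eta> \<partial>\<nu>)) F"
  proof (rule tendstoI)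
    fix e :: real assume "0 < e"
    then obtain g where g: "finitely_dependent (apply_bcontfun g)" "norm (f - g) \<le> e / 4"
      using finitely_dependent_dense[of "e / 4" f] by auto
    have close: "\<bar>(\<integral>\<eta>. f \<eta> \<partial>M) - (\<integral>\<eta>. g \<eta> \<partial>M)\<bar> \<le> e / 4"
      if "prob_space M" "sets M = sets borel" for M
      using integral_bcontfun_bound[OF that, of "f - g"] g(2)
      by (simp add: integrable_bcontfun[OF that])
    have "\<forall>\<^sub>F i in F. dist (\<integral>\<eta>. g \<eta> \<partial>m i) (\<integral>\<eta>. g \<eta> \<partial>\<nu>) < e / 4"
      by (rule tendstoD[OF conv[OF g(1)]]) (use \<open>0 < e\<close> in simp)
    then show "\<forall>\<^sub>F i in F. dist (\<integral>\<eta>. f \<eta> \<partial>m i) (\<integral>\<eta>. f \<eta> \<partial>\<nu>) < e"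
      using m
    proof eventually_elim
      case (elim i)
      then show ?case using close[of "m i"] close[OF \<nu>] \<open>0 < e\<close> unfolding dist_real_def by linarith
    qed
  qed
qed

text \<open>The limits of the cylinder probabilities are finitely additive, and compactness makes
  them a measure, so no subsequence has to be extracted. Finitely dependent functions have finite
  range, hence their integrals follow the cylinder probabilities.\<close>

lemma weak_limit_exists:
  fixes m :: "'i \<Rightarrow> ('s::countable \<Rightarrow> bool) measure"
  assumes F: "F \<noteq> bot"
    and m: "\<forall>\<^sub>F i in F. prob_space (m i) \<and> sets (m i) = sets borel"
    and conv: "\<And>f :: ('s \<Rightarrow> bool) \<Rightarrow>\<^sub>C real. finitely_dependent f \<Longrightarrow> \<exists>l. ((\<lambda>i. \<integral>\<eta>. f \<eta> \<partial>m i) \<longlongrightarrow> l) F"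
  shows "\<exists>\<nu>. weak_limit m \<nu> F"
proof -
  have "\<exists>l. ((\<lambda>i. measure (m i) E) \<longlongrightarrow> l) F" if E: "cylinder E" for E
  proof -
    have fd: "finitely_dependent (indicat_real E)" by (rule finitely_dependent_indicator[OF E])
    have app: "apply_bcontfun (Bcontfun (indicat_real E)) = indicat_real E"
      using finitely_dependent_bcontfun[OF fd] by (rule Bcontfun_inverse)
    obtain l where l: "((\<lambda>i. \<integral>\<eta>. indicat_real E \<eta> \<partial>m i) \<longlongrightarrow> l) F"
      using conv[of "Bcontfun (indicat_real E)"] fd by (auto simp: app)
    have "\<forall>\<^sub>F i in F. (\<integral>\<eta>. indicat_real E \<eta> \<partial>m i) = measure (m i) E"
      using m
    proof eventually_elim
      case (elim i)
      then show ?case using sets_eq_imp_space_eq[of "m i" borel] by simp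
    qed
    with l show ?thesis by (auto intro: Lim_transform_eventually)
  qed
  then obtain c where c: "\<And>E. cylinder E \<Longrightarrow> ((\<lambda>i. measure (m i) E) \<longlongrightarrow> c E) F" by metis
  have UNIV: "cylinder (UNIV :: ('s \<Rightarrow> bool) set)" using cylinder_Compl[OF cylinder_empty] by simp
  obtain \<nu> where \<nu>: "prob_space \<nu>" "sets \<nu> = sets borel" "\<And>E. cylinder E \<Longrightarrow> measure \<nu> E = c E"
  proof (rule probability_from_cylinders[of c])
    show "0 \<le> c E" if "cylinder E" for E
      by (rule tendsto_lowerbound[OF c[OF that] _ F]) simp
    show "c (E \<union> G) = c E + c G" if "cylinder E" "cylinder G" "E \<inter> G = {}" for E G
    proof (rule tendsto_unique[OF F c[OF cylinder_Un[OF that(1,2)]]])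
      have "((\<lambda>i. measure (m i) E + measure (m i) G) \<longlongrightarrow> c E + c G) F"
        by (intro tendsto_add c that)
      moreover have "\<forall>\<^sub>F i in F. measure (m i) E + measure (m i) G = measure (m i) (E \<union> G)"
        using m
      proof eventually_elim
        case (elim i)
        then interpret prob_space "m i" by simp
        show ?case using elim that by (intro finite_measure_Union[symmetric]) auto
      qed
      ultimately show "((\<lambda>i. measure (m i) (E \<union> G)) \<longlongrightarrow> c E + c G) F"
        by (auto intro: Lim_transform_eventually)
    qed
    show "c UNIV = 1"
    proof (rule tendsto_unique[OF F c[OF UNIV]])
      have "\<forall>\<^sub>F i in F. measure (m i) UNIV = 1"
        using m
      proof eventually_elim
        case (elim i)
        then interpret prob_space "m i" by simp
        show ?case using prob_space sets_eq_imp_space_eq[of "m i" borel] elim by simp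
      qed
      then show "((\<lambda>i. measure (m i) UNIV) \<longlongrightarrow> 1) F" by (rule tendsto_eventually)
    qed
  qed blast
  have "weak_limit m \<nu> F"
  proof (rule weak_limit_finitely_dependent[OF \<nu>(1,2) m])
    fix f :: "('s \<Rightarrow> bool) \<Rightarrow>\<^sub>C real" assume fd: "finitely_dependent (apply_bcontfun f)"
    have "((\<lambda>i. \<Sum>v\<in>range f. v * measure (m i) (f -` {v})) \<longlongrightarrow> (\<Sum>v\<in>range f. v * c (f -` {v}))) F"
      by (intro tendsto_intros c cylinder_vimage fd)
    also have "(\<Sum>v\<in>range f. v * c (f -` {v})) = (\<integral>\<eta>. f \<eta> \<partial>\<nu>)"
      unfolding integral_finitely_dependent[OF \<nu>(1,2) fd] by (simp add: \<nu>(3) cylinder_vimage[OF fd])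
    finally show "((\<lambda>i. \<integral>\<eta>. f \<eta> \<partial>m i) \<longlongrightarrow> (\<integral>\<eta>. f \<eta> \<partial>\<nu>)) F"
    proof (rule Lim_transform_eventually)
      show "\<forall>\<^sub>F i in F. (\<Sum>v\<in>range f. v * measure (m i) (f -` {v})) = (\<integral>\<eta>. f \<eta> \<partial>m i)"
        using m by eventually_elim (use integral_finitely_dependent[OF _ _ fd] in auto)
    qed
  qed
  then show ?thesis ..
qed

lemma measure_eqI_finitely_dependent:
  fixes M N :: "('s::countable \<Rightarrow> bool) measure"
  assumes M: "prob_space M" "sets M = sets borel" and N: "prob_space N" "sets N = sets borel"
    and eq: "\<And>f :: ('s \<Rightarrow> bool) \<Rightarrow>\<^sub>C real. finitely_dependent f \<Longrightarrow> (\<integral>\<eta>. f \<eta> \<partial>M) = (\<integral>\<eta>. f \<eta> \<partial>N)"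
  shows "M = N"
proof (rule measure_eqI_cylinder[OF M N])
  fix E :: "('s \<Rightarrow> bool) set" assume E: "cylinder E"
  have fd: "finitely_dependent (indicat_real E)" by (rule finitely_dependent_indicator[OF E])
  have app: "apply_bcontfun (Bcontfun (indicat_real E)) = indicat_real E"
    using finitely_dependent_bcontfun[OF fd] by (rule Bcontfun_inverse)
  from eq[of "Bcontfun (indicat_real E)"] fd show "measure M E = measure N E"
    using sets_eq_imp_space_eq[OF M(2)] sets_eq_imp_space_eq[OF N(2)] by (simp add: app)
qed

section \<open>The maximum principle for the exclusion process\<close>

text \<open>The library provides this instance for metric domains only.\<close>

instance bcontfun :: (topological_space, complete_space) complete_space
proof
  fix f :: "nat \<Rightarrow> ('a, 'b) bcontfun"
  assume f: "Cauchy f"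
  have "uniformly_Cauchy_on UNIV (\<lambda>n. apply_bcontfun (f n))"
    using f unfolding uniformly_Cauchy_on_def Cauchy_def by (metis dist_fun_lt_imp_dist_val_lt)
  then obtain g where "uniform_limit UNIV (\<lambda>n. apply_bcontfun (f n)) g sequentially"
    using Cauchy_uniformly_convergent uniformly_convergent_uniform_limit_iff by blast
  then show "convergent f"
    using uniform_limit_bcontfunE[OF _ sequentially_bot] by (metis convergentI)
qed

instance bcontfun :: (topological_space, banach) banach ..

lemma contraction_semigroup_feller:
  fixes P :: "real \<Rightarrow> 'a::topological_space \<Rightarrow> 'a measure"
  assumes P: "feller_process P"
  shows "contraction_semigroup (feller_semigroup P)"
    and "0 \<le> t \<Longrightarrow> apply_bcontfun (feller_semigroup P t f) \<eta> = (\<integral>\<zeta>. apply_bcontfun f \<zeta> \<partial>P t \<eta>)"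
    and "0 \<le> t \<Longrightarrow> prob_space (P t \<eta>)" and "0 \<le> t \<Longrightarrow> sets (P t \<eta>) = sets borel"
proof -
  have meas: "P t \<in> borel \<rightarrow>\<^sub>M prob_algebra borel" if "0 \<le> t" for t
    using P that by (simp add: feller_process_def)
  have prob: "prob_space (P t \<eta>)" and sets: "sets (P t \<eta>) = sets borel" if "0 \<le> t" for t \<eta>
    using measurable_space[OF meas[OF that], of \<eta>] by (simp_all add: space_prob_algebra)
  have fm: "apply_bcontfun f \<in> borel_measurable borel" for f :: "'a \<Rightarrow>\<^sub>C real"
    by (intro borel_measurable_continuous_onI) simp
  note int = integrable_bcontfun[OF prob sets] and bnd = integral_bcontfun_bound[OF prob sets]
  show app: "apply_bcontfun (feller_semigroup P t f) \<eta> = (\<integral>\<zeta>. apply_bcontfun f \<zeta> \<partial>P t \<eta>)"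
    if "0 \<le> t" for t f \<eta>
    unfolding feller_semigroup_def
    by (subst Bcontfun_inverse)
      (use P that bnd[OF that that] in \<open>auto simp: feller_process_def intro!: bcontfun_normI\<close>)
  show "0 \<le> t \<Longrightarrow> prob_space (P t \<eta>)" and "0 \<le> t \<Longrightarrow> sets (P t \<eta>) = sets borel"
    by (fact prob sets)+
  show "contraction_semigroup (feller_semigroup P)"
  proof (rule contraction_semigroup.intro)
    fix s t :: real and f :: "'a \<Rightarrow>\<^sub>C real"
    show "linear (feller_semigroup P t)" if "0 \<le> t"
    proof (rule linearI)
      show "feller_semigroup P t (f + g) = feller_semigroup P t f + feller_semigroup P t g" for f g
        by (rule bcontfun_eqI) (simp add: app that int)
      show "feller_semigroup P t (c *\<^sub>R f) = c *\<^sub>R feller_semigroup P t f" for c f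
        by (rule bcontfun_eqI) (simp add: app that)
    qed
    show "norm (feller_semigroup P t f) \<le> norm f" if "0 \<le> t"
      by (rule norm_bound) (simp add: app that bnd)
    show "feller_semigroup P 0 f = f"
      using P by (intro bcontfun_eqI) (simp add: app feller_process_def integral_return fm)
    show "feller_semigroup P (s + t) f = feller_semigroup P s (feller_semigroup P t f)"
      if st: "0 \<le> s" "0 \<le> t"
    proof (rule bcontfun_eqI)
      fix \<eta>
      interpret prob_space "P s \<eta>" using prob[OF st(1)] .
      have "P (s + t) \<eta> = P s \<eta> \<bind> P t" using P st by (simp add: feller_process_def)
      moreover have "(\<integral>\<zeta>. apply_bcontfun f \<zeta> \<partial>(P s \<eta> \<bind> P t)) = (\<integral>\<xi>. \<integral>\<zeta>. apply_bcontfun f \<zeta> \<partial>P t \<xi> \<partial>P s \<eta>)"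
      proof (rule integral_bind[where K = borel and B = "norm f" and B' = 1])
        show "P t \<in> P s \<eta> \<rightarrow>\<^sub>M subprob_algebra borel"
          using measurable_prob_algebraD[OF meas[OF st(2)]] sets[OF st(1), of \<eta>]
          by (simp cong: measurable_cong_sets)
        show "AE \<xi> in P s \<eta>. emeasure (P t \<xi>) (space (P t \<xi>)) \<le> ennreal 1"
          using prob_space.emeasure_space_1[OF prob[OF st(2)]] by simp
        show "finite_measure (P s \<eta>)" by (rule finite_measure_axioms)
      qed (use norm_bounded[of f] fm in auto)
      ultimately show "apply_bcontfun (feller_semigroup P (s + t) f) \<eta>
          = apply_bcontfun (feller_semigroup P s (feller_semigroup P t f)) \<eta>"
        using st by (simp add: app)
    qed
    show "((\<lambda>t. feller_semigroup P t f) \<longlongrightarrow> f) (at_right 0)"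
      using P by (simp add: feller_process_def)
  qed
qed

section \<open>Discrepancies and the exclusion generator\<close>

definition discrepancy :: "(('s \<Rightarrow> bool) \<Rightarrow> real) \<Rightarrow> ('s \<Rightarrow> bool) \<Rightarrow> 's \<Rightarrow> real" where
  "discrepancy f \<eta> x = f (\<eta>(x := True)) - f (\<eta>(x := False))"

lemma linear_discrepancy: "linear (\<lambda>f. discrepancy (apply_bcontfun f) \<eta> x)"
  by (rule linearI) (simp_all add: discrepancy_def algebra_simps)

lemma discrepancy_bound: "\<bar>discrepancy (apply_bcontfun f) \<eta> x\<bar> \<le> 2 * norm f"
  using norm_bounded[of f "\<eta>(x := True)"] norm_bounded[of f "\<eta>(x := False)"]
  by (simp add: discrepancy_def)

lemma bounded_linear_discrepancy: "bounded_linear (\<lambda>f. discrepancy (apply_bcontfun f) \<eta> x)"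
  using linear_discrepancy[of \<eta> x] discrepancy_bound
  by (intro bounded_linear.intro) (auto simp: bounded_linear_axioms_def mult.commute intro!: exI[of _ 2])

lemma discrepancy_outside:
  assumes "\<And>\<eta> \<zeta>. (\<And>x. x \<in> A \<Longrightarrow> \<eta> x = \<zeta> x) \<Longrightarrow> f \<eta> = f \<zeta>" "x \<notin> A"
  shows "discrepancy f \<eta> x = 0"
proof -
  have "f (\<eta>(x := True)) = f (\<eta>(x := False))" by (rule assms(1)) (use assms(2) in auto)
  then show ?thesis by (simp add: discrepancy_def)
qed

text \<open>Embeds a sum over one row or column into a sum over ordered pairs: the pairs
  \<open>(x, z)\<close> and \<open>(y, x)\<close> are those whose jumps move a discrepancy at
  \<open>x\<close>.\<close>

lemma has_sum_line:
  fixes r :: "'a \<Rightarrow> real"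
  assumes "(r has_sum s) UNIV"
  shows "((\<lambda>(y, z). if y = x then r z else 0) has_sum s) UNIV"
    and "((\<lambda>(y, z). if z = x then r y else 0) has_sum s) UNIV"
proof -
  have "((\<lambda>(y, z). if y = x then r z else 0) has_sum s) ((\<lambda>z. (x, z)) ` UNIV)"
    using assms by (subst has_sum_reindex) (auto simp: inj_on_def comp_def)
  then show "((\<lambda>(y, z). if y = x then r z else 0) has_sum s) UNIV"
    by (rule has_sum_cong_neutral[THEN iffD1, rotated -1]) auto
  have "((\<lambda>(y, z). if z = x then r y else 0) has_sum s) ((\<lambda>y. (y, x)) ` UNIV)"
    using assms by (subst has_sum_reindex) (auto simp: inj_on_def comp_def)
  then show "((\<lambda>(y, z). if z = x then r y else 0) has_sum s) UNIV"
    by (rule has_sum_cong_neutral[THEN iffD1, rotated -1]) auto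
qed

locale exclusion_rates = bounded_rates q C + columns: bounded_rates "\<lambda>x y. q y x" C
  for q :: "'s::countable \<Rightarrow> 's \<Rightarrow> real" and C
begin

text \<open>A jump between sites outside \<open>A\<close> leaves \<open>f\<close> unchanged. The
  pairs meeting \<open>A\<close> fill finitely many rows and columns, so bounds on both row and
  column sums are called for.\<close>

lemma exclusion_terms_summable:
  assumes A: "finite A" "\<And>\<eta> \<zeta>. (\<And>x. x \<in> A \<Longrightarrow> \<eta> x = \<zeta> x) \<Longrightarrow> f \<eta> = f \<zeta>"
    and bound: "\<And>\<eta>. \<bar>f \<eta>\<bar> \<le> B"
  shows "(\<lambda>(y, z). q y z * of_bool (\<eta> y) * (1 - of_bool (\<eta> z)) * (f (exchange y z \<eta>) - f \<eta>)) summable_on UNIV"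
proof -
  define S where "S = A \<times> UNIV \<union> UNIV \<times> A"
  have "(\<lambda>(y, z). q y z) summable_on A \<times> UNIV"
    by (rule summable_on_SigmaI[where g = "\<lambda>y. \<Sum>\<^sub>\<infinity>z. q y z"])
      (auto simp: A(1) rate_nonneg row_summable)
  moreover have "(\<lambda>(y, z). q y z) summable_on UNIV \<times> A"
  proof -
    have "(\<lambda>(z, y). q y z) summable_on A \<times> UNIV"
      by (rule summable_on_SigmaI[where g = "\<lambda>z. \<Sum>\<^sub>\<infinity>y. q y z"])
        (auto simp: A(1) rate_nonneg columns.row_summable)
    then show ?thesis
      using summable_on_swap[of "\<lambda>(y, z). q y z" UNIV A] by (simp add: case_prod_unfold)
  qed
  ultimately have "(\<lambda>(y, z). q y z) summable_on S"
    unfolding S_def by (rule summable_on_union)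
  then have "(\<lambda>yz. (case yz of (y, z) \<Rightarrow> q y z) * (case yz of (y, z) \<Rightarrow>
      of_bool (\<eta> y) * (1 - of_bool (\<eta> z)) * (f (exchange y z \<eta>) - f \<eta>))) summable_on S"
  proof (rule summable_on_weighted[where K = "2 * B"])
    show "\<bar>case yz of (y, z) \<Rightarrow> of_bool (\<eta> y) * (1 - of_bool (\<eta> z)) * (f (exchange y z \<eta>) - f \<eta>)\<bar> \<le> 2 * B" for yz
    proof (cases yz)
      case (Pair y z)
      then show ?thesis using bound[of "exchange y z \<eta>"] bound[of \<eta>] by (cases "\<eta> y"; cases "\<eta> z") auto
    qed
  qed (auto simp: rate_nonneg)
  then show ?thesis
  proof (rule summable_on_cong_neutral[THEN iffD1, rotated -1])
    fix yz assume "yz \<in> UNIV - S"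
    then obtain y z where yz: "yz = (y, z)" "y \<notin> A" "z \<notin> A" by (cases yz) (auto simp: S_def)
    have "f (exchange y z \<eta>) = f \<eta>" by (rule A(2)) (use yz in \<open>auto simp: exchange_def\<close>)
    then show "(case yz of (y, z) \<Rightarrow> q y z * of_bool (\<eta> y) * (1 - of_bool (\<eta> z)) * (f (exchange y z \<eta>) - f \<eta>)) = 0"
      by (simp add: yz)
  qed (auto simp: mult.assoc)
qed

text \<open>The basic coupling, as an inequality between the terms of two sums. A jump involving
  \<open>x\<close> moves the discrepancy, and maximality at \<open>(\<eta>, x)\<close> replaces the
  change of \<open>discrepancy f\<close> by that of \<open>W\<close>. Any other jump only changes
  the environment, and maximality over environments makes its term nonpositive.\<close>

lemma discrepancy_exclusion_operator_le:
  assumes A: "finite A" "\<And>\<eta> \<zeta>. (\<And>x. x \<in> A \<Longrightarrow> \<eta> x = \<zeta> x) \<Longrightarrow> f \<eta> = f \<zeta>"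
    and bound: "\<And>\<eta>. \<bar>f \<eta>\<bar> \<le> B" and W: "\<And>x. \<bar>W x\<bar> \<le> K"
    and max: "\<And>\<zeta> y. discrepancy f \<zeta> y - W y \<le> discrepancy f \<eta> x - W x"
  shows "discrepancy (exclusion_operator q f) \<eta> x \<le> discrepancy_drift q \<eta> W x"
proof -
  define \<eta>1 where "\<eta>1 = \<eta>(x := True)"
  define \<eta>0 where "\<eta>0 = \<eta>(x := False)"
  define t where "t \<zeta> = (\<lambda>(y, z). q y z * of_bool (\<zeta> y) * (1 - of_bool (\<zeta> z)) * (f (exchange y z \<zeta>) - f \<zeta>))" for \<zeta>
  have ts: "t \<zeta> summable_on UNIV" for \<zeta>
    unfolding t_def by (rule exclusion_terms_summable[OF A bound])
  define r1 where "r1 z = q x z * (of_bool (\<not> \<eta> z) * (W z - W x))" for z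
  define r2 where "r2 y = q y x * (of_bool (\<eta> y) * (W y - W x))" for y
  have Wb: "\<bar>of_bool b * (W z - W x)\<bar> \<le> K + K" for b z
    using W[of z] W[of x] by (cases b) auto
  have r1: "r1 summable_on UNIV" unfolding r1_def by (rule row_weighted_summable[OF Wb])
  have r2: "r2 summable_on UNIV" unfolding r2_def by (rule columns.row_weighted_summable[OF Wb])
  define b where "b = (\<lambda>yz. (case yz of (y, z) \<Rightarrow> if y = x then r1 z else 0) + (case yz of (y, z) \<Rightarrow> if z = x then r2 y else 0))"
  have b: "(b has_sum (infsum r1 UNIV + infsum r2 UNIV)) UNIV"
    unfolding b_def by (intro has_sum_add has_sum_line has_sum_infsum r1 r2)
  have "infsum r1 UNIV + infsum r2 UNIV = (\<Sum>\<^sub>\<infinity>y. r1 y + r2 y)"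
    by (rule infsum_add[OF r1 r2, symmetric])
  also have "\<dots> = discrepancy_drift q \<eta> W x"
    unfolding discrepancy_drift_def by (rule infsum_cong) (simp add: r1_def r2_def algebra_simps)
  finally have b_drift: "infsum b UNIV = discrepancy_drift q \<eta> W x" using b by (simp add: infsumI)
  have le: "t \<eta>1 (y, z) - t \<eta>0 (y, z) \<le> b (y, z)" for y z
  proof (cases "y = x")
    case yx: True
    show ?thesis
    proof (cases "z = x \<or> \<eta> z")
      case True
      then show ?thesis using yx by (auto simp: t_def b_def r1_def r2_def \<eta>1_def \<eta>0_def)
    next
      case False
      \<comment> \<open>The particle at \<open>x\<close> jumps into the hole \<open>z\<close>: the
        discrepancy now sits at \<open>z\<close>, over an environment in which \<open>x\<close> is
        empty.\<close>
      then have "exchange x z \<eta>1 = \<eta>0(z := True)" "\<eta>0(z := False) = \<eta>0"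
        by (auto simp: exchange_def \<eta>1_def \<eta>0_def fun_eq_iff)
      then have "f (exchange x z \<eta>1) - f \<eta>1 = discrepancy f \<eta>0 z - discrepancy f \<eta> x"
        by (simp add: discrepancy_def \<eta>1_def \<eta>0_def)
      also have "\<dots> \<le> W z - W x" using max[of \<eta>0 z] by simp
      finally have "q x z * (f (exchange x z \<eta>1) - f \<eta>1) \<le> q x z * (W z - W x)"
        by (intro mult_left_mono rate_nonneg)
      then show ?thesis using yx False by (simp add: t_def b_def r1_def \<eta>1_def \<eta>0_def)
    qed
  next
    case yx: False
    show ?thesis
    proof (cases "z = x")
      case zx: True
      show ?thesis
      proof (cases "\<eta> y")
        case True
        \<comment> \<open>The particle at \<open>y\<close> jumps into the hole at \<open>x\<close>,
          which is possible in \<open>\<eta>0\<close> only: the discrepancy moves to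
          \<open>y\<close>, over an environment in which \<open>x\<close> is occupied.\<close>
        then have "exchange y x \<eta>0 = \<eta>1(y := False)" "\<eta>1(y := True) = \<eta>1"
          using yx by (auto simp: exchange_def \<eta>1_def \<eta>0_def fun_eq_iff)
        then have "- (f (exchange y x \<eta>0) - f \<eta>0) = discrepancy f \<eta>1 y - discrepancy f \<eta> x"
          by (simp add: discrepancy_def \<eta>1_def \<eta>0_def)
        also have "\<dots> \<le> W y - W x" using max[of \<eta>1 y] by simp
        finally have "q y x * - (f (exchange y x \<eta>0) - f \<eta>0) \<le> q y x * (W y - W x)"
          by (intro mult_left_mono rate_nonneg)
        then show ?thesis using yx zx True by (simp add: t_def b_def r2_def \<eta>1_def \<eta>0_def right_diff_distrib)
      qed (use yx zx in \<open>simp add: t_def b_def r2_def \<eta>1_def \<eta>0_def\<close>)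
    next
      case zx: False
      have "exchange y z \<eta>1 = (exchange y z \<eta>)(x := True)" "exchange y z \<eta>0 = (exchange y z \<eta>)(x := False)"
        using yx zx by (auto simp: exchange_def \<eta>1_def \<eta>0_def fun_eq_iff)
      then have "t \<eta>1 (y, z) - t \<eta>0 (y, z) = q y z * of_bool (\<eta> y) * (1 - of_bool (\<eta> z)) *
          (discrepancy f (exchange y z \<eta>) x - discrepancy f \<eta> x)"
        using yx zx by (simp add: t_def discrepancy_def \<eta>1_def \<eta>0_def algebra_simps)
      also have "\<dots> \<le> 0"
        using max[of "exchange y z \<eta>" x] by (intro mult_nonneg_nonpos mult_nonneg_nonneg rate_nonneg) auto
      finally show ?thesis using yx zx by (simp add: b_def)
    qed
  qed
  have "discrepancy (exclusion_operator q f) \<eta> x = infsum (t \<eta>1) UNIV - infsum (t \<eta>0) UNIV"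
    by (simp add: discrepancy_def exclusion_operator_def t_def \<eta>1_def \<eta>0_def)
  also have "\<dots> = (\<Sum>\<^sub>\<infinity>yz. t \<eta>1 yz + - t \<eta>0 yz)"
    using infsum_add[OF ts[of \<eta>1] summable_on_uminus[THEN iffD2, OF ts[of \<eta>0]]] by (simp add: infsum_uminus)
  also have "\<dots> \<le> infsum b UNIV"
  proof (rule infsum_mono)
    show "(\<lambda>yz. t \<eta>1 yz + - t \<eta>0 yz) summable_on UNIV"
      by (rule summable_on_add[OF ts summable_on_uminus[THEN iffD2, OF ts]])
    show "b summable_on UNIV" using b by (auto simp: summable_on_def)
    show "t \<eta>1 yz + - t \<eta>0 yz \<le> b yz" for yz using le by (cases yz) auto
  qed
  finally show ?thesis unfolding b_drift .
qed

text \<open>A finitely dependent \<open>f\<close> has finite range and no discrepancy outside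
  \<open>A\<close>, so a positive supremum of \<open>discrepancy f - W\<close> is attained and the
  generator can be evaluated there. The slack \<open>d\<close> leaves room for passing to the
  closure.\<close>

lemma core_comparison:
  assumes fg: "(f, g) \<in> exclusion_pregenerator q" and "0 < l"
    and W: "\<And>x. 0 \<le> W x" "\<And>x. W x \<le> K" and "0 \<le> d"
    and super: "\<And>\<eta> x. discrepancy (l *\<^sub>R f - g) \<eta> x \<le> l * W x - discrepancy_drift q \<eta> W x + d"
  shows "discrepancy f \<eta> x \<le> W x + d / l"
proof (cases "discrepancy f \<eta> x - W x \<le> 0")
  case True
  have "0 \<le> d / l" using \<open>0 \<le> d\<close> \<open>0 < l\<close> by simp
  with True show ?thesis by simp
next
  case False
  from fg have fd: "finitely_dependent (apply_bcontfun f)" and g: "apply_bcontfun g = exclusion_operator q (apply_bcontfun f)"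
    by (simp_all add: exclusion_pregenerator_def)
  from fd obtain A where A: "finite A" "\<And>\<eta> \<zeta>. (\<And>x. x \<in> A \<Longrightarrow> \<eta> x = \<zeta> x) \<Longrightarrow> apply_bcontfun f \<eta> = apply_bcontfun f \<zeta>"
    by (rule finitely_dependentE) blast
  define D where "D = {discrepancy f \<zeta> y - W y |\<zeta> y. y \<in> A}"
  have "finite D"
  proof (rule finite_subset)
    show "D \<subseteq> (\<lambda>(a, b, y). a - b - W y) ` (range f \<times> range f \<times> A)"
    proof
      fix m assume "m \<in> D"
      then obtain \<zeta> y where m: "y \<in> A" "m = discrepancy f \<zeta> y - W y" unfolding D_def by blast
      show "m \<in> (\<lambda>(a, b, y). a - b - W y) ` (range f \<times> range f \<times> A)"
        by (rule image_eqI[of _ _ "(f (\<zeta>(y := True)), f (\<zeta>(y := False)), y)"]) (simp_all add: m discrepancy_def)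
    qed
    show "finite ((\<lambda>(a, b, y). a - b - W y) ` (range f \<times> range f \<times> A))"
      using A(1) finite_range_finitely_dependent[OF fd] by simp
  qed
  have out: "discrepancy f \<zeta> y - W y \<le> 0" if "y \<notin> A" for \<zeta> y
    using discrepancy_outside[OF A(2) that] W(1)[of y] by simp
  have "discrepancy f \<eta> x - W x \<in> D" using False out unfolding D_def by blast
  then have "Max D \<in> D" "discrepancy f \<eta> x - W x \<le> Max D"
    using \<open>finite D\<close> by (auto intro: Max_in)
  then obtain \<zeta> y where max: "Max D = discrepancy f \<zeta> y - W y" unfolding D_def by blast
  have "discrepancy f \<zeta>' y' - W y' \<le> Max D" for \<zeta>' y'
  proof (cases "y' \<in> A")
    case True
    then have "discrepancy f \<zeta>' y' - W y' \<in> D" unfolding D_def by blast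
    then show ?thesis using \<open>finite D\<close> by simp
  next
    case notin: False
    show ?thesis using out[OF notin, of \<zeta>'] False \<open>discrepancy f \<eta> x - W x \<le> Max D\<close> by linarith
  qed
  then have "discrepancy (exclusion_operator q f) \<zeta> y \<le> discrepancy_drift q \<zeta> W y"
    using norm_bounded[of f] W unfolding max
    by (intro discrepancy_exclusion_operator_le[OF A, where B = "norm f" and K = K]) auto
  moreover have "discrepancy (l *\<^sub>R f - g) \<zeta> y = l * discrepancy f \<zeta> y - discrepancy (exclusion_operator q f) \<zeta> y"
    by (simp add: discrepancy_def g algebra_simps)
  ultimately have "l * (discrepancy f \<zeta> y - W y) \<le> d"
    using super[of \<zeta> y] by (simp add: algebra_simps)
  then have "Max D \<le> d / l" using \<open>0 < l\<close> unfolding max by (simp add: field_simps)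
  with \<open>discrepancy f \<eta> x - W x \<le> Max D\<close> show ?thesis by simp
qed

text \<open>For elements of the closure no maximiser is at hand, so the inequality is passed along
  an approximating sequence; the error in \<open>l *\<^sub>R f - g\<close> enters as the vanishing
  slack \<open>d n\<close>.\<close>

lemma comparison:
  assumes fg: "(f, g) \<in> closure (exclusion_pregenerator q)" and "0 < l"
    and W: "\<And>x. 0 \<le> W x" "\<And>x. W x \<le> K"
    and super: "\<And>\<eta> x. discrepancy (l *\<^sub>R f - g) \<eta> x \<le> l * W x - discrepancy_drift q \<eta> W x"
  shows "discrepancy f \<eta> x \<le> W x"
proof -
  from fg obtain X where X: "\<And>n. X n \<in> exclusion_pregenerator q" "X \<longlonglongrightarrow> (f, g)"
    unfolding closure_sequential by blast
  define F where "F n = fst (X n)" for n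
  define G where "G n = snd (X n)" for n
  have FG: "(F n, G n) \<in> exclusion_pregenerator q" for n using X(1)[of n] by (simp add: F_def G_def)
  have lim: "F \<longlonglongrightarrow> f" "G \<longlonglongrightarrow> g"
    using tendsto_fst[OF X(2)] tendsto_snd[OF X(2)] by (simp_all add: F_def[abs_def] G_def[abs_def])
  define d where "d n = 2 * norm ((l *\<^sub>R F n - G n) - (l *\<^sub>R f - g))" for n
  have "discrepancy (F n) \<eta> x \<le> W x + d n / l" for n
  proof (rule core_comparison[OF FG \<open>0 < l\<close> W])
    show "0 \<le> d n" by (simp add: d_def)
    fix \<zeta> y
    have "discrepancy (l *\<^sub>R F n - G n) \<zeta> y = discrepancy (l *\<^sub>R f - g) \<zeta> y
        + discrepancy ((l *\<^sub>R F n - G n) - (l *\<^sub>R f - g)) \<zeta> y"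
      by (simp add: discrepancy_def)
    also have "discrepancy ((l *\<^sub>R F n - G n) - (l *\<^sub>R f - g)) \<zeta> y \<le> d n"
      using discrepancy_bound[of "(l *\<^sub>R F n - G n) - (l *\<^sub>R f - g)" \<zeta> y] by (simp add: d_def)
    finally show "discrepancy (l *\<^sub>R F n - G n) \<zeta> y \<le> l * W y - discrepancy_drift q \<zeta> W y + d n"
      using super[of \<zeta> y] by simp
  qed
  moreover have "(\<lambda>n. discrepancy (F n) \<eta> x) \<longlonglongrightarrow> discrepancy f \<eta> x"
    by (rule bounded_linear.tendsto[OF bounded_linear_discrepancy lim(1)])
  moreover have "(\<lambda>n. W x + d n / l) \<longlonglongrightarrow> W x + 2 * norm ((l *\<^sub>R f - g) - (l *\<^sub>R f - g)) / l"
    unfolding d_def by (intro tendsto_intros lim) (use \<open>0 < l\<close> in auto)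
  ultimately show ?thesis by (auto intro: LIMSEQ_le)
qed

end

lemma discrepancy_finitely_dependent:
  fixes f :: "('s \<Rightarrow> bool) \<Rightarrow>\<^sub>C real"
  assumes "finitely_dependent (apply_bcontfun f)"
  obtains A where "finite A" "\<And>\<eta> x. discrepancy f \<eta> x \<le> 2 * norm f * of_bool (x \<in> A)"
proof -
  obtain A where A: "finite A" "\<And>\<eta> \<zeta>. (\<And>x. x \<in> A \<Longrightarrow> \<eta> x = \<zeta> x) \<Longrightarrow> apply_bcontfun f \<eta> = apply_bcontfun f \<zeta>"
    by (rule finitely_dependentE[OF assms]) blast
  have "discrepancy f \<eta> x \<le> 2 * norm f * of_bool (x \<in> A)" for \<eta> x
  proof -
    have "discrepancy f \<eta> x = 0" if "x \<notin> A" by (rule discrepancy_outside[OF A(2) that])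
    then show ?thesis using discrepancy_bound[of f \<eta> x] by (cases "x \<in> A") auto
  qed
  with A(1) show thesis by (rule that)
qed

section \<open>Order and potential bounds for the exclusion semigroup\<close>

locale exclusion_semigroup = exclusion_rates q C
  for q :: "'s::countable \<Rightarrow> 's \<Rightarrow> real" and C +
  fixes P :: "real \<Rightarrow> ('s \<Rightarrow> bool) \<Rightarrow> ('s \<Rightarrow> bool) measure"
  assumes process: "exclusion_process q P"
begin

lemma feller: "feller_process P"
  using process by (simp add: exclusion_process_def)

sublocale contraction_semigroup "feller_semigroup P"
  using feller by (rule contraction_semigroup_feller)

lemma generator_eq: "semigroup_generator (feller_semigroup P) = closure (exclusion_pregenerator q)"
  using process by (simp add: exclusion_process_def generator_def semigroup_generator_def)

lemma discrepancy_drift_const [simp]: "discrepancy_drift q \<eta> (\<lambda>_. c) x = 0"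
  by (simp add: discrepancy_drift_def)

text \<open>Attractiveness. Constants have no drift in any environment, so \<open>comparison\<close>
  for \<open>- f\<close> with \<open>l = 1 / h\<close> and \<open>W = c\<close> shows that a lower
  bound on the discrepancies of \<open>f - h *\<^sub>R g\<close> passes to \<open>f\<close>. This is
  the hypothesis under which \<open>invariant_cone\<close> preserves the increasing
  functions.\<close>

lemma monotone_preserved:
  fixes f :: "('s \<Rightarrow> bool) \<Rightarrow>\<^sub>C real"
  assumes "\<And>\<eta> x. 0 \<le> discrepancy f \<eta> x" "0 \<le> t"
  shows "0 \<le> discrepancy (feller_semigroup P t f) \<eta> x"
proof -
  define L :: "('s \<Rightarrow> bool) \<times> 's \<Rightarrow> (('s \<Rightarrow> bool) \<Rightarrow>\<^sub>C real) \<Rightarrow> real"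
    where "L i f = discrepancy f (fst i) (snd i)" for i f
  have "0 \<le> L (\<eta>, x) (feller_semigroup P t f)"
  proof (rule invariant_cone[where k = 2 and L = L])
    fix f g :: "('s \<Rightarrow> bool) \<Rightarrow>\<^sub>C real" and h c :: real and i :: "('s \<Rightarrow> bool) \<times> 's"
    assume fg: "(f, g) \<in> semigroup_generator (feller_semigroup P)" and "0 < h" "0 \<le> c"
      and lower: "\<And>i. - c \<le> L i (f - h *\<^sub>R g)"
    have "((-1) *\<^sub>R f, (-1) *\<^sub>R g) \<in> closure (exclusion_pregenerator q)"
      using generator_scaleR[OF fg, of "-1"] by (simp add: generator_eq)
    then have "discrepancy ((-1) *\<^sub>R f) \<eta> x \<le> c" for \<eta> x
    proof (rule comparison[where W = "\<lambda>_. c" and K = c and l = "1 / h"])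
      fix \<eta> x
      have "discrepancy ((1 / h) *\<^sub>R ((-1) *\<^sub>R f) - (-1) *\<^sub>R g) \<eta> x = (1 / h) * - discrepancy (f - h *\<^sub>R g) \<eta> x"
        using \<open>0 < h\<close> by (simp add: discrepancy_def field_simps)
      also have "\<dots> \<le> (1 / h) * c" using lower[of "(\<eta>, x)"] \<open>0 < h\<close>
        by (intro mult_left_mono) (auto simp: L_def)
      finally show "discrepancy ((1 / h) *\<^sub>R ((-1) *\<^sub>R f) - (-1) *\<^sub>R g) \<eta> x
          \<le> (1 / h) * c - discrepancy_drift q \<eta> (\<lambda>_. c) x" by simp
    qed (use \<open>0 < h\<close> \<open>0 \<le> c\<close> in auto)
    from this[of "fst i" "snd i"]
    show "- c \<le> L i f"
      by (simp add: L_def discrepancy_def)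
  qed (use assms linear_discrepancy discrepancy_bound in \<open>auto simp: L_def[abs_def]\<close>)
  then show ?thesis by (simp add: L_def)
qed

lemma cumulative_discrepancy:
  fixes f :: "('s \<Rightarrow> bool) \<Rightarrow>\<^sub>C real"
  assumes "0 \<le> t"
  shows "((\<lambda>r. discrepancy (feller_semigroup P r f) \<eta> x) has_integral discrepancy (cumulative t f) \<eta> x) {0..t}"
  using has_integral_linear[OF integrable_integral[OF integrable_T[of 0 f t]] bounded_linear_discrepancy[of \<eta> x]]
  by (simp add: cumulative_def comp_def)

lemma cumulative_monotone:
  fixes f :: "('s \<Rightarrow> bool) \<Rightarrow>\<^sub>C real"
  assumes "\<And>\<eta> x. 0 \<le> discrepancy f \<eta> x" "0 \<le> s" "s \<le> t"
  shows "discrepancy (cumulative s f) \<eta> x \<le> discrepancy (cumulative t f) \<eta> x"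
  by (rule has_integral_subset_le[OF _ cumulative_discrepancy cumulative_discrepancy])
    (use assms monotone_preserved in auto)

lemma cumulative_discrepancy_nonneg:
  fixes f :: "('s \<Rightarrow> bool) \<Rightarrow>\<^sub>C real"
  assumes "\<And>\<eta> x. 0 \<le> discrepancy f \<eta> x" "0 \<le> t"
  shows "0 \<le> discrepancy (cumulative t f) \<eta> x"
  using cumulative_monotone[OF assms(1), of 0 t \<eta> x] assms(2) by (simp add: discrepancy_def)

text \<open>The discounted time integral solves a resolvent equation with source
  \<open>f - exp (- l * t) *\<^sub>R feller_semigroup P t f\<close>, and attractiveness lets the
  subtracted term be dropped. Removing the discount on the horizon \<open>t\<close> costs
  \<open>exp (l * t)\<close>.\<close>

lemma cumulative_le:
  fixes f :: "('s \<Rightarrow> bool) \<Rightarrow>\<^sub>C real"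
  assumes mono: "\<And>\<eta> x. 0 \<le> discrepancy f \<eta> x" and "0 < l" "0 \<le> t"
    and W: "\<And>x. 0 \<le> W x" "\<And>x. W x \<le> K"
    and super: "\<And>\<eta> x. discrepancy f \<eta> x \<le> l * W x - discrepancy_drift q \<eta> W x"
  shows "discrepancy (cumulative t f) \<eta> x \<le> exp (l * t) * W x"
proof -
  interpret disc: contraction_semigroup "\<lambda>t f. exp (- l * t) *\<^sub>R feller_semigroup P t f"
    using \<open>0 < l\<close> by (intro discounted_semigroup) simp
  define c where "c = disc.cumulative t f"
  have "discrepancy c \<eta> x \<le> W x"
  proof (rule comparison[OF _ \<open>0 < l\<close> W])
    show "(c, exp (- l * t) *\<^sub>R feller_semigroup P t f - f + l *\<^sub>R c) \<in> closure (exclusion_pregenerator q)"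
      using discounted_generator[OF disc.cumulative_in_generator[OF \<open>0 \<le> t\<close>, of f]]
      by (simp add: generator_eq c_def)
    fix \<eta> x
    have "discrepancy (l *\<^sub>R c - (exp (- l * t) *\<^sub>R feller_semigroup P t f - f + l *\<^sub>R c)) \<eta> x
        = discrepancy f \<eta> x - exp (- l * t) * discrepancy (feller_semigroup P t f) \<eta> x"
      by (simp add: discrepancy_def algebra_simps)
    also have "\<dots> \<le> discrepancy f \<eta> x" using monotone_preserved[OF mono \<open>0 \<le> t\<close>] by simp
    also note super
    finally show "discrepancy (l *\<^sub>R c - (exp (- l * t) *\<^sub>R feller_semigroup P t f - f + l *\<^sub>R c)) \<eta> x
        \<le> l * W x - discrepancy_drift q \<eta> W x" .
  qed
  have "((\<lambda>r. discrepancy (exp (- l * r) *\<^sub>R feller_semigroup P r f) \<eta> x) has_integral discrepancy c \<eta> x) {0..t}"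
    using has_integral_linear[OF integrable_integral[OF disc.integrable_T[of 0 f t]] bounded_linear_discrepancy[of \<eta> x]]
    by (simp only: c_def disc.cumulative_def comp_def)
  then have "((\<lambda>r. exp (l * t) * discrepancy (exp (- l * r) *\<^sub>R feller_semigroup P r f) \<eta> x)
      has_integral exp (l * t) * discrepancy c \<eta> x) {0..t}"
    by (rule has_integral_mult_right)
  with cumulative_discrepancy[OF \<open>0 \<le> t\<close>]
  have "discrepancy (cumulative t f) \<eta> x \<le> exp (l * t) * discrepancy c \<eta> x"
  proof (rule has_integral_le)
    fix r assume r: "r \<in> {0..t}"
    then have "1 \<le> exp (l * t) * exp (- l * r)"
      using \<open>0 < l\<close> by (simp add: exp_add[symmetric] mult_left_mono)
    then have "1 * discrepancy (feller_semigroup P r f) \<eta> x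
        \<le> exp (l * t) * exp (- l * r) * discrepancy (feller_semigroup P r f) \<eta> x"
      using monotone_preserved[OF mono] r by (intro mult_right_mono) auto
    then show "discrepancy (feller_semigroup P r f) \<eta> x
        \<le> exp (l * t) * discrepancy (exp (- l * r) *\<^sub>R feller_semigroup P r f) \<eta> x"
      by (simp add: discrepancy_def algebra_simps)
  qed
  also have "\<dots> \<le> exp (l * t) * W x" using \<open>discrepancy c \<eta> x \<le> W x\<close> by (intro mult_left_mono) auto
  finally show ?thesis .
qed

text \<open>With \<open>l = 1 / t\<close> the cost of removing the discount is \<open>exp 1\<close>
  for every horizon. \<open>G\<close> is abstract, so one argument covers the symmetric and the
  perturbed process.\<close>

lemma potential_bound:
  fixes f :: "('s \<Rightarrow> bool) \<Rightarrow>\<^sub>C real"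
  assumes f: "finitely_dependent (apply_bcontfun f)" and mono: "\<And>\<eta> x. 0 \<le> discrepancy f \<eta> x"
    and super: "\<And>A. finite A \<Longrightarrow> \<exists>A' D. finite A' \<and> 0 \<le> D \<and>
      (\<forall>l. 0 < l \<longrightarrow> l \<le> 1 \<longrightarrow> (\<exists>W B. (\<forall>x. 0 \<le> W x \<and> W x \<le> B)
        \<and> (\<forall>\<eta> x. of_bool (x \<in> A) \<le> l * W x - discrepancy_drift q \<eta> W x)
        \<and> (\<forall>x. W x \<le> D * G l A' x)))"
  obtains A D where "finite A" "0 \<le> D"
    "\<And>t \<eta> x. 1 \<le> t \<Longrightarrow> discrepancy (cumulative t f) \<eta> x \<le> D * G (1 / t) A x"
proof -
  obtain A where A: "finite A" "\<And>\<eta> x. discrepancy f \<eta> x \<le> 2 * norm f * of_bool (x \<in> A)"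
    by (rule discrepancy_finitely_dependent[OF f]) (rule that)
  obtain A' D where D: "finite A'" "0 \<le> D" "\<And>l. 0 < l \<Longrightarrow> l \<le> 1 \<Longrightarrow> \<exists>W B. (\<forall>x. 0 \<le> W x \<and> W x \<le> B)
     \<and> (\<forall>\<eta> x. of_bool (x \<in> A) \<le> l * W x - discrepancy_drift q \<eta> W x)
     \<and> (\<forall>x. W x \<le> D * G l A' x)"
    using super[OF A(1)] by blast
  show thesis
  proof (rule that[of A' "exp 1 * (2 * norm f) * D"])
    fix t :: real and \<eta> x assume t: "1 \<le> t"
    then have l: "0 < 1 / t" "1 / t \<le> 1" by auto
    from D(3)[OF l] obtain W B where W: "\<And>x. 0 \<le> W x" "\<And>x. W x \<le> B"
      and super: "\<And>\<eta> x. of_bool (x \<in> A) \<le> 1 / t * W x - discrepancy_drift q \<eta> W x"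
      and le: "\<And>x. W x \<le> D * G (1 / t) A' x" by blast
    have "discrepancy (cumulative t f) \<eta> x \<le> exp (1 / t * t) * (2 * norm f * W x)"
    proof (rule cumulative_le[OF mono l(1)])
      show "0 \<le> 2 * norm f * W x" for x using W(1) by simp
      show "2 * norm f * W x \<le> 2 * norm f * B" for x using W(2) by (simp add: mult_left_mono)
      show "discrepancy f \<eta> x \<le> 1 / t * (2 * norm f * W x) - discrepancy_drift q \<eta> (\<lambda>x. 2 * norm f * W x) x" for \<eta> x
      proof -
        have "discrepancy f \<eta> x \<le> 2 * norm f * of_bool (x \<in> A)" by (rule A(2))
        also have "\<dots> \<le> 2 * norm f * (1 / t * W x - discrepancy_drift q \<eta> W x)"
          using super by (intro mult_left_mono) auto
        finally show ?thesis
          by (simp only: discrepancy_drift_cmult right_diff_distrib mult.left_commute[of "1 / t"])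
      qed
    qed (use t in simp)
    also have "\<dots> = exp 1 * (2 * norm f) * W x" using t by simp
    also have "\<dots> \<le> exp 1 * (2 * norm f) * (D * G (1 / t) A' x)"
      using le by (intro mult_left_mono) auto
    finally show "discrepancy (cumulative t f) \<eta> x \<le> exp 1 * (2 * norm f) * D * G (1 / t) A' x"
      by (simp only: mult.assoc)
  qed (use D in auto)
qed

end

section \<open>Invariant measures under a perturbation of one rate\<close>

lemma law_at_feller:
  fixes P :: "real \<Rightarrow> ('s::countable \<Rightarrow> bool) \<Rightarrow> ('s \<Rightarrow> bool) measure"
  assumes P: "feller_process P" and \<mu>: "prob_space \<mu>" "sets \<mu> = sets borel" and t: "0 \<le> t"
  shows "prob_space (law_at P \<mu> t)" "sets (law_at P \<mu> t) = sets borel"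
    "(\<integral>\<eta>. apply_bcontfun f \<eta> \<partial>law_at P \<mu> t) = (\<integral>\<eta>. feller_semigroup P t f \<eta> \<partial>\<mu>)"
proof -
  interpret prob_space \<mu> by fact
  have "P t \<in> borel \<rightarrow>\<^sub>M prob_algebra borel" using P t by (simp add: feller_process_def)
  then have kernel: "P t \<in> \<mu> \<rightarrow>\<^sub>M subprob_algebra borel"
    using \<mu>(2) measurable_prob_algebraD[of "P t" borel borel] by (simp cong: measurable_cong_sets)
  have prob: "prob_space (P t \<eta>)" for \<eta> by (rule contraction_semigroup_feller(3)[OF P t])
  show "prob_space (law_at P \<mu> t)"
    unfolding law_at_def using prob by (intro prob_space_bind[OF _ kernel]) simp
  show "sets (law_at P \<mu> t) = sets borel"
    unfolding law_at_def using sets_eq_imp_space_eq[OF \<mu>(2)] sets_kernel[OF kernel]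
    by (intro sets_bind) auto
  have "(\<integral>\<eta>. apply_bcontfun f \<eta> \<partial>law_at P \<mu> t) = (\<integral>\<xi>. \<integral>\<zeta>. apply_bcontfun f \<zeta> \<partial>P t \<xi> \<partial>\<mu>)"
    unfolding law_at_def
  proof (rule integral_bind[where K = borel and B = "norm f" and B' = 1])
    show "P t \<in> \<mu> \<rightarrow>\<^sub>M subprob_algebra borel" by (rule kernel)
    show "apply_bcontfun f \<in> borel_measurable borel"
      by (intro borel_measurable_continuous_onI) simp
    show "AE \<xi> in \<mu>. emeasure (P t \<xi>) (space (P t \<xi>)) \<le> ennreal 1"
      using prob_space.emeasure_space_1[OF prob] by simp
    show "finite_measure \<mu>" by (rule finite_measure_axioms)
  qed (use norm_bounded[of f] in auto)
  then show "(\<integral>\<eta>. apply_bcontfun f \<eta> \<partial>law_at P \<mu> t) = (\<integral>\<eta>. feller_semigroup P t f \<eta> \<partial>\<mu>)"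
    by (simp add: contraction_semigroup_feller(2)[OF P t])
qed

lemma invariant_measuresD:
  fixes P :: "real \<Rightarrow> ('s::countable \<Rightarrow> bool) \<Rightarrow> ('s \<Rightarrow> bool) measure"
  assumes "feller_process P" "\<mu> \<in> invariant_measures P"
  shows "prob_space \<mu>" "sets \<mu> = sets borel"
    and "0 \<le> t \<Longrightarrow> (\<integral>\<eta>. feller_semigroup P t f \<eta> \<partial>\<mu>) = (\<integral>\<eta>. apply_bcontfun f \<eta> \<partial>\<mu>)"
proof -
  show \<mu>: "prob_space \<mu>" "sets \<mu> = sets borel" using assms(2) by (auto simp: invariant_measures_def)
  show "(\<integral>\<eta>. feller_semigroup P t f \<eta> \<partial>\<mu>) = (\<integral>\<eta>. apply_bcontfun f \<eta> \<partial>\<mu>)" if "0 \<le> t"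
    using law_at_feller(3)[OF assms(1) \<mu> that, of f] assms(2) that by (simp add: invariant_measures_def)
qed

lemma invariant_generator_zero:
  fixes P :: "real \<Rightarrow> ('s::countable \<Rightarrow> bool) \<Rightarrow> ('s \<Rightarrow> bool) measure"
  assumes "feller_process P" "\<mu> \<in> invariant_measures P"
    and "(f, g) \<in> semigroup_generator (feller_semigroup P)"
  shows "(\<integral>\<eta>. apply_bcontfun g \<eta> \<partial>\<mu>) = 0"
proof -
  note \<mu> = invariant_measuresD[OF assms(1,2)]
  interpret E: bounded_linear "\<lambda>f :: ('s \<Rightarrow> bool) \<Rightarrow>\<^sub>C real. \<integral>\<eta>. f \<eta> \<partial>\<mu>"
    by (rule bounded_linear_integral_bcontfun[OF \<mu>(1,2)])
  have "((\<lambda>t. \<integral>\<eta>. apply_bcontfun ((feller_semigroup P t f - f) /\<^sub>R t) \<eta> \<partial>\<mu>)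
      \<longlongrightarrow> (\<integral>\<eta>. apply_bcontfun g \<eta> \<partial>\<mu>)) (at_right 0)"
    by (rule E.tendsto) (use assms(3) in \<open>simp add: semigroup_generator_def\<close>)
  moreover have "\<forall>\<^sub>F t in at_right 0. (\<integral>\<eta>. apply_bcontfun ((feller_semigroup P t f - f) /\<^sub>R t) \<eta> \<partial>\<mu>) = 0"
    using eventually_at_right_less[of 0]
  proof eventually_elim
    case (elim t)
    then show ?case using \<mu>(3)[of t f] unfolding E.scaleR E.diff by simp
  qed
  ultimately have "((\<lambda>t::real. 0 :: real) \<longlongrightarrow> (\<integral>\<eta>. apply_bcontfun g \<eta> \<partial>\<mu>)) (at_right 0)"
    by (rule Lim_transform_eventually)
  then show ?thesis using tendsto_unique[OF _ _ tendsto_const] trivial_limit_at_right_real by blast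
qed

lemma weak_limit_law_invariant:
  fixes P :: "real \<Rightarrow> ('s::countable \<Rightarrow> bool) \<Rightarrow> ('s \<Rightarrow> bool) measure"
  assumes P: "feller_process P" and \<mu>: "prob_space \<mu>" "sets \<mu> = sets borel"
    and lim: "weak_limit (law_at P \<mu>) \<nu> at_top"
  shows "\<nu> \<in> invariant_measures P"
proof -
  interpret contraction_semigroup "feller_semigroup P" using P by (rule contraction_semigroup_feller)
  have \<nu>: "prob_space \<nu>" "sets \<nu> = sets borel"
    and conv: "\<And>f :: ('s \<Rightarrow> bool) \<Rightarrow>\<^sub>C real. ((\<lambda>t. \<integral>\<eta>. f \<eta> \<partial>law_at P \<mu> t) \<longlongrightarrow> (\<integral>\<eta>. f \<eta> \<partial>\<nu>)) at_top"
    using lim by (auto simp: weak_limit_def)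
  have "law_at P \<nu> s = \<nu>" if s: "0 \<le> s" for s
  proof (rule measure_eqI_finitely_dependent[OF law_at_feller(1,2)[OF P \<nu> s] \<nu>])
    fix f :: "('s \<Rightarrow> bool) \<Rightarrow>\<^sub>C real"
    have "((\<lambda>t. \<integral>\<eta>. f \<eta> \<partial>law_at P \<mu> (s + t)) \<longlongrightarrow> (\<integral>\<eta>. f \<eta> \<partial>\<nu>)) at_top"
      by (rule filterlim_compose[OF conv]) (intro filterlim_tendsto_add_at_top[OF tendsto_const] filterlim_ident)
    moreover have "\<forall>\<^sub>F t in at_top. (\<integral>\<eta>. f \<eta> \<partial>law_at P \<mu> (s + t)) = (\<integral>\<eta>. feller_semigroup P s f \<eta> \<partial>law_at P \<mu> t)"
      using eventually_ge_at_top[of 0]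
    proof eventually_elim
      case (elim t)
      then show ?case
        using s T_add[of t s f] by (simp add: law_at_feller(3)[OF P \<mu>] add.commute)
    qed
    ultimately have "((\<lambda>t. \<integral>\<eta>. feller_semigroup P s f \<eta> \<partial>law_at P \<mu> t) \<longlongrightarrow> (\<integral>\<eta>. f \<eta> \<partial>\<nu>)) at_top"
      by (rule Lim_transform_eventually)
    then have "(\<integral>\<eta>. feller_semigroup P s f \<eta> \<partial>\<nu>) = (\<integral>\<eta>. f \<eta> \<partial>\<nu>)"
      using conv[of "feller_semigroup P s f"] tendsto_unique trivial_limit_at_top_linorder by blast
    then show "(\<integral>\<eta>. f \<eta> \<partial>law_at P \<nu> s) = (\<integral>\<eta>. f \<eta> \<partial>\<nu>)"
      by (simp add: law_at_feller(3)[OF P \<nu> s])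
  qed
  with \<nu> show ?thesis by (simp add: invariant_measures_def)
qed

section \<open>The bond operator and bounded perturbation of the generator\<close>

lemma continuous_configuration_map:
  fixes F :: "('s \<Rightarrow> bool) \<Rightarrow> ('s \<Rightarrow> bool)"
  assumes "\<And>x. (\<exists>b. \<forall>\<eta>. F \<eta> x = b) \<or> (\<exists>y. \<forall>\<eta>. F \<eta> x = \<eta> y)"
  shows "continuous_on UNIV F"
proof (rule continuous_on_coordinatewise_then_product)
  fix x
  from assms[of x] show "continuous_on UNIV (\<lambda>\<eta>. F \<eta> x)"
  proof (elim disjE exE)
    fix b assume "\<forall>\<eta>. F \<eta> x = b"
    then have "(\<lambda>\<eta>. F \<eta> x) = (\<lambda>_. b)" by blast
    then show ?thesis
      by (rule ssubst[where P = "continuous_on UNIV"]) (rule continuous_on_const)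
  next
    fix y assume "\<forall>\<eta>. F \<eta> x = \<eta> y"
    then have "(\<lambda>\<eta>. F \<eta> x) = (\<lambda>\<eta>. \<eta> y)" by blast
    then show ?thesis
      by (rule ssubst[where P = "continuous_on UNIV"]) (rule continuous_on_product_coordinates)
  qed
qed

lemma continuous_exchange: "continuous_on UNIV (exchange u v)"
proof (rule continuous_configuration_map)
  fix x
  have "\<forall>\<eta>. exchange u v \<eta> x = \<eta> (if x = v then u else if x = u then v else x)"
    by (simp add: exchange_def)
  then show "(\<exists>b. \<forall>\<eta>. exchange u v \<eta> x = b) \<or> (\<exists>y. \<forall>\<eta>. exchange u v \<eta> x = \<eta> y)" by blast
qed

lemma continuous_upd: "continuous_on UNIV (\<lambda>\<eta>::'s \<Rightarrow> bool. \<eta>(u := b))"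
proof (rule continuous_configuration_map)
  fix x
  show "(\<exists>c. \<forall>\<eta>. (\<eta>(u := b)) x = c) \<or> (\<exists>y. \<forall>\<eta>. (\<eta>(u := b)) x = \<eta> y)"
    by (cases "x = u") (simp, metis fun_upd_other)
qed

lemma continuous_bcontfun_compose:
  fixes f :: "('s \<Rightarrow> bool) \<Rightarrow>\<^sub>C real"
  shows "continuous_on UNIV F \<Longrightarrow> continuous_on UNIV (\<lambda>\<eta>. apply_bcontfun f (F \<eta>))"
  by (rule continuous_on_compose2[of UNIV "apply_bcontfun f"]) auto

lemma continuous_exchange_weight: "continuous_on UNIV (\<lambda>\<eta>::'s \<Rightarrow> bool. of_bool (\<eta> u \<and> \<not> \<eta> v) :: real)"
  by (rule finitely_dependent_continuous) (auto simp: finitely_dependent_def intro!: exI[of _ "{u, v}"])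

definition bond_operator :: "real \<Rightarrow> 's \<Rightarrow> 's \<Rightarrow> (('s \<Rightarrow> bool) \<Rightarrow>\<^sub>C real) \<Rightarrow> (('s \<Rightarrow> bool) \<Rightarrow>\<^sub>C real)" where
  "bond_operator \<epsilon> u v f =
     Bcontfun (\<lambda>\<eta>. \<epsilon> * of_bool (\<eta> u \<and> \<not> \<eta> v) * (apply_bcontfun f (exchange u v \<eta>) - apply_bcontfun f \<eta>))"

lemma bond_operator_pointwise_bound:
  "\<bar>\<epsilon> * of_bool (\<eta> u \<and> \<not> \<eta> v) * (apply_bcontfun f (exchange u v \<eta>) - apply_bcontfun f \<eta>)\<bar> \<le> 2 * \<bar>\<epsilon>\<bar> * norm f"
proof -
  have "\<bar>apply_bcontfun f (exchange u v \<eta>) - apply_bcontfun f \<eta>\<bar> \<le> 2 * norm f"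
    using norm_bounded[of f "exchange u v \<eta>"] norm_bounded[of f \<eta>] by simp
  from mult_left_mono[OF this, of "\<bar>\<epsilon>\<bar>"] show ?thesis by (cases "\<eta> u \<and> \<not> \<eta> v") (auto simp: abs_mult)
qed

lemma apply_bond_operator:
  "apply_bcontfun (bond_operator \<epsilon> u v f) \<eta>
    = \<epsilon> * of_bool (\<eta> u \<and> \<not> \<eta> v) * (apply_bcontfun f (exchange u v \<eta>) - apply_bcontfun f \<eta>)"
  unfolding bond_operator_def
proof (subst Bcontfun_inverse)
  show "(\<lambda>\<eta>. \<epsilon> * of_bool (\<eta> u \<and> \<not> \<eta> v) * (apply_bcontfun f (exchange u v \<eta>) - apply_bcontfun f \<eta>)) \<in> bcontfun"
    using bond_operator_pointwise_bound[of \<epsilon> _ u v f]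
    by (intro bcontfun_normI[where b = "2 * \<bar>\<epsilon>\<bar> * norm f"] continuous_intros continuous_exchange_weight
        continuous_bcontfun_compose continuous_exchange) auto
qed simp

lemma bounded_linear_bond_operator: "bounded_linear (bond_operator \<epsilon> u v)"
proof (rule bounded_linear_intro[where K = "2 * \<bar>\<epsilon>\<bar>"])
  fix f g :: "('a \<Rightarrow> bool) \<Rightarrow>\<^sub>C real" and r :: real
  show "bond_operator \<epsilon> u v (f + g) = bond_operator \<epsilon> u v f + bond_operator \<epsilon> u v g"
    by (rule bcontfun_eqI) (simp add: apply_bond_operator algebra_simps)
  show "bond_operator \<epsilon> u v (r *\<^sub>R f) = r *\<^sub>R bond_operator \<epsilon> u v f"
    by (rule bcontfun_eqI) (simp add: apply_bond_operator algebra_simps)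
  show "norm (bond_operator \<epsilon> u v f) \<le> norm f * (2 * \<bar>\<epsilon>\<bar>)"
    using bond_operator_pointwise_bound[of \<epsilon> _ u v f]
    by (intro norm_bound) (simp add: apply_bond_operator mult_ac)
qed

text \<open>Moving a particle from \<open>u\<close> to \<open>v\<close> adds one at \<open>v\<close>
  and removes one at \<open>u\<close>, both relative to the configuration with the two sites empty.
  So the operator sees a function only through its discrepancies at the ends of the bond.\<close>

lemma bond_operator_discrepancy:
  "apply_bcontfun (bond_operator \<epsilon> u v f) \<eta> = \<epsilon> *
    (of_bool (\<eta> u \<and> \<not> \<eta> v) * discrepancy f (\<eta>(u := False)) v
     - of_bool (\<eta> u \<and> \<not> \<eta> v) * discrepancy f (\<eta>(u := False)) u)"
proof (cases "\<eta> u \<and> \<not> \<eta> v")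
  case True
  then have "exchange u v \<eta> = \<eta>(u := False, v := True)" "\<eta>(u := False, v := False) = \<eta>(u := False)"
      "\<eta>(u := False, u := True) = \<eta>"
    by (auto simp: exchange_def fun_eq_iff)
  then show ?thesis using True by (simp add: apply_bond_operator discrepancy_def)
qed (auto simp: apply_bond_operator)

lemma exclusion_operator_perturbed:
  fixes q q' :: "'s::countable \<Rightarrow> 's \<Rightarrow> real"
  assumes "exclusion_rates q C" and q': "\<And>x y. q' x y = q x y + (if x = u \<and> y = v then \<epsilon> else 0)"
    and "finitely_dependent (apply_bcontfun f)"
  shows "exclusion_operator q' f \<eta> = exclusion_operator q f \<eta> + apply_bcontfun (bond_operator \<epsilon> u v f) \<eta>"
proof -
  interpret exclusion_rates q C by fact
  define t where "t = (\<lambda>(y, z). q y z * of_bool (\<eta> y) * (1 - of_bool (\<eta> z)) * (f (exchange y z \<eta>) - f \<eta>))"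
  define s where "s = (\<lambda>yz. if yz = (u, v) then apply_bcontfun (bond_operator \<epsilon> u v f) \<eta> else 0)"
  obtain A where A: "finite A" "\<And>\<eta> \<zeta>. (\<And>x. x \<in> A \<Longrightarrow> \<eta> x = \<zeta> x) \<Longrightarrow> apply_bcontfun f \<eta> = apply_bcontfun f \<zeta>"
    by (rule finitely_dependentE[OF assms(3)]) blast
  have ts: "t summable_on UNIV"
    unfolding t_def by (rule exclusion_terms_summable[OF A, where B = "norm f"]) (use norm_bounded[of f] in auto)
  have s: "s summable_on UNIV" "infsum s UNIV = apply_bcontfun (bond_operator \<epsilon> u v f) \<eta>"
    using infsum_single[of "(u, v)" s] by (auto simp: s_def)
  have "exclusion_operator q' f \<eta> = (\<Sum>\<^sub>\<infinity>yz. t yz + s yz)"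
    unfolding exclusion_operator_def
    by (rule infsum_cong) (auto simp: t_def s_def q' apply_bond_operator of_bool_def distrib_right split: if_splits)
  also have "\<dots> = infsum t UNIV + infsum s UNIV" by (rule infsum_add[OF ts s(1)])
  finally show ?thesis by (simp add: s(2) t_def exclusion_operator_def)
qed

text \<open>Both pregenerators live on the finitely dependent functions and differ by a bounded
  operator. Adding that operator is a continuous map of graphs, so it carries one closure into the
  other.\<close>

lemma generator_perturbed:
  fixes q q' :: "'s::countable \<Rightarrow> 's \<Rightarrow> real"
  assumes "exclusion_rates q C" and q': "\<And>x y. q' x y = q x y + (if x = u \<and> y = v then \<epsilon> else 0)"
    and fg: "(f, g) \<in> closure (exclusion_pregenerator q)"
  shows "(f, g + bond_operator \<epsilon> u v f) \<in> closure (exclusion_pregenerator q')"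
proof -
  interpret B: bounded_linear "bond_operator \<epsilon> u v" by (rule bounded_linear_bond_operator)
  define \<Phi> where "\<Phi> = (\<lambda>(f, g). (f, g + bond_operator \<epsilon> u v f))"
  have "\<Phi> ` closure (exclusion_pregenerator q) \<subseteq> closure (exclusion_pregenerator q')"
  proof (rule image_closure_subset)
    show "continuous_on (closure (exclusion_pregenerator q)) \<Phi>"
      unfolding \<Phi>_def case_prod_unfold by (intro continuous_intros B.continuous_on)
    show "\<Phi> ` exclusion_pregenerator q \<subseteq> closure (exclusion_pregenerator q')"
    proof (rule image_subsetI)
      fix x assume x: "x \<in> exclusion_pregenerator q"
      obtain f g where fg: "x = (f, g)" by (cases x)
      have "\<Phi> x \<in> exclusion_pregenerator q'"
        using x exclusion_operator_perturbed[OF assms(1) q', of f]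
        by (auto simp: fg \<Phi>_def exclusion_pregenerator_def fun_eq_iff)
      then show "\<Phi> x \<in> closure (exclusion_pregenerator q')" using closure_subset by blast
    qed
  qed simp
  with fg show ?thesis by (force simp: \<Phi>_def)
qed

lemma mono_bounded_convergent:
  fixes a :: "real \<Rightarrow> real"
  assumes mono: "\<And>s t. 1 \<le> s \<Longrightarrow> s \<le> t \<Longrightarrow> a s \<le> a t" and bdd: "\<And>t. 1 \<le> t \<Longrightarrow> a t \<le> K"
  obtains l where "(a \<longlongrightarrow> l) at_top" "\<And>t. 1 \<le> t \<Longrightarrow> a t \<le> l"
proof
  define l where "l = Sup (a ` {1..})"
  have B: "bdd_above (a ` {1..})" using bdd by (auto intro!: bdd_aboveI2)
  show le: "a t \<le> l" if "1 \<le> t" for t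
    unfolding l_def using that B by (intro cSup_upper) auto
  show "(a \<longlongrightarrow> l) at_top"
  proof (rule order_tendstoI)
    fix y assume "y < l"
    then obtain s where s: "1 \<le> s" "y < a s"
      unfolding l_def using less_cSup_iff[OF _ B] by auto
    show "\<forall>\<^sub>F t in at_top. y < a t"
      using eventually_ge_at_top[of s] by eventually_elim (use s mono in \<open>meson less_le_trans\<close>)
  next
    fix y assume "l < y"
    show "\<forall>\<^sub>F t in at_top. a t < y"
      using eventually_ge_at_top[of 1] by eventually_elim (use le \<open>l < y\<close> in \<open>meson le_less_trans\<close>)
  qed
qed

text \<open>The discrepancies of \<open>f\<close> are at least \<open>- 2 * norm f\<close> on
  \<open>A\<close> and vanish elsewhere, so adding \<open>2 * norm f\<close> times the number of
  particles in \<open>A\<close> makes \<open>f\<close> increasing. Weak convergence is thereby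
  reduced to increasing functions.\<close>

lemma finitely_dependent_diff_monotone:
  fixes f :: "('s \<Rightarrow> bool) \<Rightarrow>\<^sub>C real"
  assumes "finitely_dependent (apply_bcontfun f)"
  obtains g h :: "('s \<Rightarrow> bool) \<Rightarrow>\<^sub>C real"
  where "f = g - h"
    and "finitely_dependent (apply_bcontfun g)" "\<And>\<eta> x. 0 \<le> discrepancy g \<eta> x"
    and "finitely_dependent (apply_bcontfun h)" "\<And>\<eta> x. 0 \<le> discrepancy h \<eta> x"
proof -
  obtain A where A: "finite A" "\<And>\<eta> \<zeta>. (\<And>x. x \<in> A \<Longrightarrow> \<eta> x = \<zeta> x) \<Longrightarrow> apply_bcontfun f \<eta> = apply_bcontfun f \<zeta>"
    by (rule finitely_dependentE[OF assms]) blast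
  define N where "N \<eta> = 2 * norm f * (\<Sum>x\<in>A. of_bool (\<eta> x))" for \<eta> :: "'s \<Rightarrow> bool"
  have Nfd: "finitely_dependent N"
    unfolding finitely_dependent_def N_def using A(1) by (intro exI[of _ A]) auto
  have app: "apply_bcontfun (Bcontfun N) = N"
    using finitely_dependent_bcontfun[OF Nfd] by (rule Bcontfun_inverse)
  have N: "discrepancy N \<eta> x = 2 * norm f * of_bool (x \<in> A)" for \<eta> x
  proof -
    have "discrepancy N \<eta> x = 2 * norm f * (\<Sum>y\<in>A. of_bool ((\<eta>(x := True)) y) - of_bool ((\<eta>(x := False)) y))"
      by (simp add: discrepancy_def N_def sum_subtractf right_diff_distrib)
    also have "(\<Sum>y\<in>A. of_bool ((\<eta>(x := True)) y) - of_bool ((\<eta>(x := False)) y) :: real) = (\<Sum>y\<in>A. if y = x then 1 else 0)"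
      by (intro sum.cong) auto
    also have "\<dots> = of_bool (x \<in> A)" using A(1) by simp
    finally show ?thesis .
  qed
  show thesis
  proof (rule that[of "f + Bcontfun N" "Bcontfun N"])
    show "finitely_dependent (apply_bcontfun (Bcontfun N))" using Nfd by (simp add: app)
    show "0 \<le> discrepancy (Bcontfun N) \<eta> x" for \<eta> x by (simp add: app N)
    show "finitely_dependent (apply_bcontfun (f + Bcontfun N))"
      unfolding finitely_dependent_def
    proof (intro exI conjI allI impI)
      fix \<eta> \<zeta> :: "'s \<Rightarrow> bool" assume "\<forall>x\<in>A. \<eta> x = \<zeta> x"
      then have "apply_bcontfun f \<eta> = apply_bcontfun f \<zeta>" "N \<eta> = N \<zeta>"
        by (auto intro: A(2) simp: N_def)
      then show "apply_bcontfun (f + Bcontfun N) \<eta> = apply_bcontfun (f + Bcontfun N) \<zeta>" by (simp add: app)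
    qed fact
    show "0 \<le> discrepancy (f + Bcontfun N) \<eta> x" for \<eta> x
    proof -
      have "discrepancy (f + Bcontfun N) \<eta> x = discrepancy f \<eta> x + discrepancy N \<eta> x"
        by (simp add: discrepancy_def app)
      moreover have "discrepancy f \<eta> x = 0" if "x \<notin> A" by (rule discrepancy_outside[OF A(2) that])
      ultimately show ?thesis using discrepancy_bound[of f \<eta> x] by (cases "x \<in> A") (auto simp: N)
    qed
  qed simp
qed

section \<open>Invariant measures of one process evolved under the other\<close>

locale bond_perturbation =
  S1: exclusion_semigroup q1 C1 P1 + S2: exclusion_semigroup q2 C2 P2
  for q1 q2 :: "'s::countable \<Rightarrow> 's \<Rightarrow> real" and C1 C2 P1 P2 +
  fixes u v :: 's and \<epsilon> :: real
  assumes q2: "q2 x y = q1 x y + (if x = u \<and> y = v then \<epsilon> else 0)"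
begin

text \<open>The time integral \<open>\<phi>\<close> is mapped by the second generator to
  \<open>feller_semigroup P2 t f - f\<close>; subtracting the bond operator gives its image under
  the first generator, which has mean 0 under \<open>\<mu>\<close>.\<close>

lemma invariant_increment:
  fixes f :: "('s \<Rightarrow> bool) \<Rightarrow>\<^sub>C real"
  assumes \<mu>: "\<mu> \<in> invariant_measures P1" and t: "0 \<le> t"
  shows "(\<integral>\<eta>. feller_semigroup P2 t f \<eta> \<partial>\<mu>) - (\<integral>\<eta>. apply_bcontfun f \<eta> \<partial>\<mu>)
    = (\<integral>\<eta>. bond_operator \<epsilon> u v (S2.cumulative t f) \<eta> \<partial>\<mu>)"
proof -
  note \<mu>' = invariant_measuresD[OF S1.feller \<mu>]
  interpret E: bounded_linear "\<lambda>f :: ('s \<Rightarrow> bool) \<Rightarrow>\<^sub>C real. \<integral>\<eta>. f \<eta> \<partial>\<mu>"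
    by (rule bounded_linear_integral_bcontfun[OF \<mu>'(1,2)])
  have q1: "q1 x y = q2 x y + (if x = u \<and> y = v then - \<epsilon> else 0)" for x y by (simp add: q2)
  define \<phi> where "\<phi> = S2.cumulative t f"
  have "(\<phi>, feller_semigroup P2 t f - f + bond_operator (- \<epsilon>) u v \<phi>) \<in> closure (exclusion_pregenerator q1)"
    using S2.cumulative_in_generator[OF t, of f] unfolding S2.generator_eq \<phi>_def
    by (rule generator_perturbed[OF S2.exclusion_rates_axioms q1])
  then have zero: "(\<integral>\<eta>. apply_bcontfun (feller_semigroup P2 t f - f + bond_operator (- \<epsilon>) u v \<phi>) \<eta> \<partial>\<mu>) = 0"
    unfolding S1.generator_eq[symmetric] by (rule invariant_generator_zero[OF S1.feller \<mu>])
  have neg: "bond_operator (- \<epsilon>) u v \<phi> = - bond_operator \<epsilon> u v \<phi>"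
    by (rule bcontfun_eqI) (simp add: apply_bond_operator)
  show ?thesis
    using zero unfolding neg E.add E.diff E.neg by (simp add: \<phi>_def)
qed

text \<open>The time integral of an increasing function is increasing, so both discrepancies lie in
  \<open>[0, K]\<close> and their difference costs \<open>K\<close> rather than
  \<open>2 * K\<close>.\<close>

lemma increment_le:
  fixes f :: "('s \<Rightarrow> bool) \<Rightarrow>\<^sub>C real"
  assumes \<mu>: "\<mu> \<in> invariant_measures P1" and t: "0 \<le> t"
    and mono: "\<And>\<eta> x. 0 \<le> discrepancy f \<eta> x"
    and K: "\<And>\<eta>. discrepancy (S2.cumulative t f) \<eta> u \<le> K" "\<And>\<eta>. discrepancy (S2.cumulative t f) \<eta> v \<le> K"
  shows "\<bar>(\<integral>\<eta>. feller_semigroup P2 t f \<eta> \<partial>\<mu>) - (\<integral>\<eta>. apply_bcontfun f \<eta> \<partial>\<mu>)\<bar> \<le> \<bar>\<epsilon>\<bar> * K"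
proof -
  note \<mu>' = invariant_measuresD[OF S1.feller \<mu>]
  note c0 = S2.cumulative_discrepancy_nonneg[OF mono t]
  have "norm (bond_operator \<epsilon> u v (S2.cumulative t f)) \<le> \<bar>\<epsilon>\<bar> * K"
  proof (rule norm_bound)
    fix \<eta>
    have "\<bar>of_bool (\<eta> u \<and> \<not> \<eta> v) * discrepancy (S2.cumulative t f) (\<eta>(u := False)) v
        - of_bool (\<eta> u \<and> \<not> \<eta> v) * discrepancy (S2.cumulative t f) (\<eta>(u := False)) u\<bar> \<le> K"
      using K[of "\<eta>(u := False)"] c0[of "\<eta>(u := False)" u] c0[of "\<eta>(u := False)" v]
      by (cases "\<eta> u \<and> \<not> \<eta> v") auto
    from mult_left_mono[OF this, of "\<bar>\<epsilon>\<bar>"]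
    show "norm (apply_bcontfun (bond_operator \<epsilon> u v (S2.cumulative t f)) \<eta>) \<le> \<bar>\<epsilon>\<bar> * K"
      unfolding bond_operator_discrepancy real_norm_def abs_mult by simp
  qed
  then show ?thesis
    unfolding invariant_increment[OF \<mu> t]
    using integral_bcontfun_bound[OF \<mu>'(1,2)] order_trans by blast
qed

text \<open>The increment is a difference of a term for \<open>v\<close> and a term for
  \<open>u\<close> and need not be monotone in \<open>t\<close>; each term separately is increasing
  and bounded, so both converge.\<close>

lemma monotone_converges:
  fixes f :: "('s \<Rightarrow> bool) \<Rightarrow>\<^sub>C real"
  assumes \<mu>: "\<mu> \<in> invariant_measures P1"
    and mono: "\<And>\<eta> x. 0 \<le> discrepancy f \<eta> x"
    and K: "\<And>t \<eta> x. 1 \<le> t \<Longrightarrow> discrepancy (S2.cumulative t f) \<eta> x \<le> K x"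
  shows "\<exists>l. ((\<lambda>t. \<integral>\<eta>. feller_semigroup P2 t f \<eta> \<partial>\<mu>) \<longlongrightarrow> l) at_top"
proof -
  note \<mu>' = invariant_measuresD[OF S1.feller \<mu>]
  interpret prob_space \<mu> by (rule \<mu>'(1))
  define G where "G t x \<eta> = of_bool (\<eta> u \<and> \<not> \<eta> v) * discrepancy (S2.cumulative t f) (\<eta>(u := False)) x" for t x \<eta>
  note c0 = S2.cumulative_discrepancy_nonneg[OF mono]
  have int: "integrable \<mu> (G t x)" for t x
  proof (rule integrable_const_bound[where B = "2 * norm (S2.cumulative t f)"])
    have "continuous_on UNIV (G t x)"
      unfolding G_def discrepancy_def
      by (intro continuous_intros continuous_exchange_weight continuous_bcontfun_compose
          continuous_on_compose2[OF continuous_upd continuous_upd]) auto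
    then have "G t x \<in> borel_measurable borel" by (rule borel_measurable_continuous_onI)
    then show "G t x \<in> borel_measurable \<mu>" using \<mu>'(2) by (simp cong: measurable_cong_sets)
    have "norm (G t x \<eta>) \<le> 2 * norm (S2.cumulative t f)" for \<eta>
      using discrepancy_bound[of "S2.cumulative t f" "\<eta>(u := False)" x]
      unfolding G_def by (cases "\<eta> u \<and> \<not> \<eta> v") auto
    then show "AE \<eta> in \<mu>. norm (G t x \<eta>) \<le> 2 * norm (S2.cumulative t f)" by simp
  qed
  define a where "a x t = (\<integral>\<eta>. G t x \<eta> \<partial>\<mu>)" for x t
  have "\<exists>l. (a x \<longlongrightarrow> l) at_top" for x
  proof -
    have "a x s \<le> a x t" if "1 \<le> s" "s \<le> t" for s t
      unfolding a_def using S2.cumulative_monotone[OF mono, of s t] that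
      by (intro integral_mono int) (auto simp: G_def)
    moreover have "a x t \<le> K x" if t: "1 \<le> t" for t
    proof -
      have "a x t \<le> (\<integral>\<eta>. K x \<partial>\<mu>)"
        unfolding a_def
      proof (rule integral_mono[OF int])
        show "G t x \<eta> \<le> K x" for \<eta>
          using K[OF t, of "\<eta>(u := False)" x] c0[of t "\<eta>(u := False)" x] t
          unfolding G_def by (cases "\<eta> u \<and> \<not> \<eta> v") auto
      qed simp
      then show ?thesis by (simp add: prob_space)
    qed
    ultimately obtain l where "(a x \<longlongrightarrow> l) at_top"
      by (rule mono_bounded_convergent[of "a x"]) blast
    then show ?thesis ..
  qed
  then have "\<exists>l. \<forall>x. (a x \<longlongrightarrow> l x) at_top" by (intro choice allI)
  then obtain l where l: "\<And>x. (a x \<longlongrightarrow> l x) at_top" by blast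
  have "((\<lambda>t. (\<integral>\<eta>. apply_bcontfun f \<eta> \<partial>\<mu>) + \<epsilon> * (a v t - a u t)) \<longlongrightarrow>
      (\<integral>\<eta>. apply_bcontfun f \<eta> \<partial>\<mu>) + \<epsilon> * (l v - l u)) at_top"
    by (intro tendsto_intros l)
  moreover have "\<forall>\<^sub>F t in at_top. (\<integral>\<eta>. apply_bcontfun f \<eta> \<partial>\<mu>) + \<epsilon> * (a v t - a u t)
      = (\<integral>\<eta>. feller_semigroup P2 t f \<eta> \<partial>\<mu>)"
    using eventually_ge_at_top[of 0]
  proof eventually_elim
    case (elim t)
    have "(\<integral>\<eta>. bond_operator \<epsilon> u v (S2.cumulative t f) \<eta> \<partial>\<mu>) = \<epsilon> * (a v t - a u t)"
      unfolding bond_operator_discrepancy G_def[symmetric] a_def using int by simp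
    with invariant_increment[OF \<mu> elim, of f] show ?case by simp
  qed
  ultimately show ?thesis by (intro exI) (rule Lim_transform_eventually)
qed

lemma law_converges:
  assumes \<mu>: "\<mu> \<in> invariant_measures P1"
    and K: "\<And>f :: ('s \<Rightarrow> bool) \<Rightarrow>\<^sub>C real. finitely_dependent (apply_bcontfun f) \<Longrightarrow> (\<And>\<eta> x. 0 \<le> discrepancy f \<eta> x) \<Longrightarrow>
      \<exists>K. \<forall>t \<eta> x. 1 \<le> t \<longrightarrow> discrepancy (S2.cumulative t f) \<eta> x \<le> K x"
  shows "\<exists>\<nu>. weak_limit (law_at P2 \<mu>) \<nu> at_top"
proof -
  note \<mu>' = invariant_measuresD[OF S1.feller \<mu>]
  interpret E: bounded_linear "\<lambda>f :: ('s \<Rightarrow> bool) \<Rightarrow>\<^sub>C real. \<integral>\<eta>. f \<eta> \<partial>\<mu>"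
    by (rule bounded_linear_integral_bcontfun[OF \<mu>'(1,2)])
  have mono_conv: "\<exists>l. ((\<lambda>t. \<integral>\<eta>. feller_semigroup P2 t g \<eta> \<partial>\<mu>) \<longlongrightarrow> l) at_top"
    if g: "finitely_dependent (apply_bcontfun g)" "\<And>\<eta> x. 0 \<le> discrepancy g \<eta> x"
    for g :: "('s \<Rightarrow> bool) \<Rightarrow>\<^sub>C real"
  proof -
    obtain K where "\<forall>t \<eta> x. 1 \<le> t \<longrightarrow> discrepancy (S2.cumulative t g) \<eta> x \<le> K x"
      using K[OF g] by blast
    then show ?thesis by (intro monotone_converges[OF \<mu> g(2), where K = K]) blast
  qed
  show ?thesis
  proof (rule weak_limit_exists)
    show "\<forall>\<^sub>F t in at_top. prob_space (law_at P2 \<mu> t) \<and> sets (law_at P2 \<mu> t) = sets borel"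
      using eventually_ge_at_top[of 0]
      by eventually_elim (simp add: law_at_feller[OF S2.feller \<mu>'(1,2)])
    fix f :: "('s \<Rightarrow> bool) \<Rightarrow>\<^sub>C real" assume "finitely_dependent (apply_bcontfun f)"
    then obtain g h where f: "f = g - h"
      and g: "finitely_dependent (apply_bcontfun g)" "\<And>\<eta> x. 0 \<le> discrepancy g \<eta> x"
      and h: "finitely_dependent (apply_bcontfun h)" "\<And>\<eta> x. 0 \<le> discrepancy h \<eta> x"
      by (rule finitely_dependent_diff_monotone) (rule that)
    from mono_conv[OF g] mono_conv[OF h] obtain a b
      where ab: "((\<lambda>t. \<integral>\<eta>. feller_semigroup P2 t g \<eta> \<partial>\<mu>) \<longlongrightarrow> a) at_top"
        "((\<lambda>t. \<integral>\<eta>. feller_semigroup P2 t h \<eta> \<partial>\<mu>) \<longlongrightarrow> b) at_top" by blast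
    have "\<forall>\<^sub>F t in at_top. (\<integral>\<eta>. feller_semigroup P2 t g \<eta> \<partial>\<mu>) - (\<integral>\<eta>. feller_semigroup P2 t h \<eta> \<partial>\<mu>)
        = (\<integral>\<eta>. f \<eta> \<partial>law_at P2 \<mu> t)"
      using eventually_ge_at_top[of 0]
    proof eventually_elim
      case (elim t)
      have "feller_semigroup P2 t f = feller_semigroup P2 t g - feller_semigroup P2 t h"
        unfolding f by (rule linear_diff[OF S2.linear_T[OF elim]])
      then show ?case
        using E.diff[of "feller_semigroup P2 t g" "feller_semigroup P2 t h"]
        by (simp add: law_at_feller(3)[OF S2.feller \<mu>'(1,2) elim])
    qed
    with tendsto_diff[OF ab] show "\<exists>l. ((\<lambda>t. \<integral>\<eta>. f \<eta> \<partial>law_at P2 \<mu> t) \<longlongrightarrow> l) at_top"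
      by (intro exI) (rule Lim_transform_eventually)
  qed simp
qed

end

lemma cesaro_mean_tendsto:
  fixes m :: "real \<Rightarrow> real"
  assumes cont: "continuous_on {0..} m" and lim: "(m \<longlongrightarrow> l) at_top"
  shows "((\<lambda>t. integral {0..t} m / t) \<longlongrightarrow> l) at_top"
proof (rule lhospital_at_top_at_top)
  show "filterlim (\<lambda>t::real. t) at_top at_top" by (rule filterlim_ident)
  show "\<forall>\<^sub>F t in at_top. (1::real) \<noteq> 0" by simp
  show "\<forall>\<^sub>F t in at_top. ((\<lambda>t. integral {0..t} m) has_real_derivative m t) (at t)"
    using eventually_gt_at_top[of 0]
  proof eventually_elim
    case (elim t)
    have "((\<lambda>t. integral {0..t} m) has_real_derivative m t) (at t within {0..t + 1})"
      using elim by (intro integral_has_real_derivative continuous_on_subset[OF cont]) auto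
    moreover have "at t within {0..t + 1} = at t" using elim by (intro at_within_interior) simp
    ultimately show ?case by simp
  qed
  show "\<forall>\<^sub>F t in at_top. ((\<lambda>t::real. t) has_real_derivative 1) (at t)" by simp
  show "((\<lambda>t. m t / 1) \<longlongrightarrow> l) at_top" using lim by simp
qed

section \<open>Comparison of the symmetric and the perturbed process\<close>

locale perturbed_exclusion = single_perturbation p C pbar u v \<epsilon>
    + S: exclusion_semigroup p C P + Sbar: exclusion_semigroup pbar C Pbar
  for p :: "'s::countable \<Rightarrow> 's \<Rightarrow> real" and C pbar u v \<epsilon> P Pbar +
  assumes transient: "transient_kernel pbar" and irreducible: "irreducible_kernel p"
begin

lemma forward: "bond_perturbation p pbar C C P Pbar u v \<epsilon>"
  by unfold_locales (rule pbar_eq)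

lemma backward: "bond_perturbation pbar p C C Pbar P u v (- \<epsilon>)"
  by unfold_locales (simp add: pbar_eq)

lemma green_sum_uniform_bound:
  assumes "finite A"
  obtains K where "\<And>l x. 0 < l \<Longrightarrow> l \<le> 1 \<Longrightarrow> green_sum l A x \<le> K"
proof -
  have "\<forall>a. \<exists>D. \<forall>l. 0 < l \<longrightarrow> l \<le> 1 \<longrightarrow> (\<forall>x. green l x a \<le> D)"
    using green_uniform_bound[OF transient irreducible] by blast
  then have "\<exists>D. \<forall>a. \<forall>l. 0 < l \<longrightarrow> l \<le> 1 \<longrightarrow> (\<forall>x. green l x a \<le> D a)" by (rule choice)
  then obtain D where D: "\<And>a l x. 0 < l \<Longrightarrow> l \<le> 1 \<Longrightarrow> green l x a \<le> D a" by blast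
  show thesis
    by (rule that[of "\<Sum>a\<in>A. D a"]) (simp add: green_sum_def sum_mono D)
qed

lemma potential_bound_perturbed:
  fixes f :: "('s \<Rightarrow> bool) \<Rightarrow>\<^sub>C real"
  assumes f: "finitely_dependent (apply_bcontfun f)" "\<And>\<eta> x. 0 \<le> discrepancy f \<eta> x"
  obtains A D where "finite A" "0 \<le> D"
    "\<And>t \<eta> x. 1 \<le> t \<Longrightarrow> discrepancy (Sbar.cumulative t f) \<eta> x \<le> D * green_sum (1 / t) A x"
proof (rule Sbar.potential_bound[OF f])
  show "\<exists>A' D. finite A' \<and> 0 \<le> D \<and> (\<forall>l. 0 < l \<longrightarrow> l \<le> 1 \<longrightarrow> (\<exists>W B. (\<forall>x. 0 \<le> W x \<and> W x \<le> B)
     \<and> (\<forall>\<eta> x. of_bool (x \<in> A) \<le> l * W x - discrepancy_drift pbar \<eta> W x)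
     \<and> (\<forall>x. W x \<le> D * green_sum l A' x)))" if "finite A" for A
    using discrepancy_supersolution[OF transient irreducible that] that
    by (intro exI[of _ "A \<union> {u, v}"]) simp
qed (rule that)

lemma potential_bound_symmetric:
  fixes f :: "('s \<Rightarrow> bool) \<Rightarrow>\<^sub>C real"
  assumes f: "finitely_dependent (apply_bcontfun f)" "\<And>\<eta> x. 0 \<le> discrepancy f \<eta> x"
  obtains A D where "finite A" "0 \<le> D"
    "\<And>t \<eta> x. 1 \<le> t \<Longrightarrow> discrepancy (S.cumulative t f) \<eta> x \<le> D * green_sum (1 / t) A x"
proof (rule S.potential_bound[OF f])
  show "\<exists>A' D. finite A' \<and> 0 \<le> D \<and> (\<forall>l. 0 < l \<longrightarrow> l \<le> 1 \<longrightarrow> (\<exists>W B. (\<forall>x. 0 \<le> W x \<and> W x \<le> B)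
     \<and> (\<forall>\<eta> x. of_bool (x \<in> A) \<le> l * W x - discrepancy_drift p \<eta> W x)
     \<and> (\<forall>x. W x \<le> D * green_sum l A' x)))" if A: "finite A" for A
  proof (intro exI[of _ A] exI[of _ 1] conjI allI impI)
    fix l :: real assume l: "0 < l"
    show "\<exists>W B. (\<forall>x. 0 \<le> W x \<and> W x \<le> B)
       \<and> (\<forall>\<eta> x. of_bool (x \<in> A) \<le> l * W x - discrepancy_drift p \<eta> W x)
       \<and> (\<forall>x. W x \<le> 1 * green_sum l A x)"
      using green_sum_nonneg[OF l] green_sum_le[OF l] green_sum_equation[OF l A]
      by (intro exI[of _ "green_sum l A"] exI[of _ "card A * (1 / l)"])
        (simp add: discrepancy_drift_symmetric)
  qed (use A in simp_all)
qed (rule that)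

lemma bounded_if_green_sum_bounded:
  assumes "finite A" "0 \<le> D" and F: "\<And>t \<eta> x. 1 \<le> t \<Longrightarrow> F t \<eta> x \<le> D * green_sum (1 / t) A x"
  shows "\<exists>K. \<forall>t \<eta> x. 1 \<le> t \<longrightarrow> F t \<eta> x \<le> K x"
proof -
  obtain K where K: "\<And>l x. 0 < l \<Longrightarrow> l \<le> 1 \<Longrightarrow> green_sum l A x \<le> K"
    by (rule green_sum_uniform_bound[OF assms(1)]) (rule that)
  have "F t \<eta> x \<le> D * K" if "1 \<le> t" for t \<eta> x
    using that by (intro order_trans[OF F[OF that] mult_left_mono[OF K assms(2)]]) auto
  then show ?thesis by (intro exI[of _ "\<lambda>_. D * K"]) blast
qed

lemma perturbed_limit_exists:
  assumes "\<mu> \<in> invariant_measures P"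
  shows "\<exists>\<nu>. weak_limit (law_at Pbar \<mu>) \<nu> at_top"
proof (rule bond_perturbation.law_converges[OF forward assms])
  fix f :: "('s \<Rightarrow> bool) \<Rightarrow>\<^sub>C real"
  assume f: "finitely_dependent (apply_bcontfun f)" "\<And>\<eta> x. 0 \<le> discrepancy f \<eta> x"
  show "\<exists>K. \<forall>t \<eta> x. 1 \<le> t \<longrightarrow> discrepancy (Sbar.cumulative t f) \<eta> x \<le> K x"
    by (rule potential_bound_perturbed[OF f]) (rule bounded_if_green_sum_bounded)
qed

lemma symmetric_limit_exists:
  assumes "\<nu> \<in> invariant_measures Pbar"
  shows "\<exists>\<mu>. weak_limit (law_at P \<nu>) \<mu> at_top"
proof (rule bond_perturbation.law_converges[OF backward assms])
  fix f :: "('s \<Rightarrow> bool) \<Rightarrow>\<^sub>C real"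
  assume f: "finitely_dependent (apply_bcontfun f)" "\<And>\<eta> x. 0 \<le> discrepancy f \<eta> x"
  show "\<exists>K. \<forall>t \<eta> x. 1 \<le> t \<longrightarrow> discrepancy (S.cumulative t f) \<eta> x \<le> K x"
    by (rule potential_bound_symmetric[OF f]) (rule bounded_if_green_sum_bounded)
qed

text \<open>If \<open>W = 2 D (G\<^bsub>1/s\<^esub> - G\<^bsub>1/t\<^esub>)\<close>, with \<open>G\<close> the resolvent Green function of the set \<open>A\<close>, then the resolvent
  equation makes \<open>W\<close> a supersolution for the Cesaro mean of the perturbed semigroup up to time \<open>t\<close>.\<close>

lemma symmetric_cumulative_mean_le:
  fixes g :: "('s \<Rightarrow> bool) \<Rightarrow>\<^sub>C real"
  assumes A: "finite A" and D: "0 \<le> D" and t: "1 \<le> t" and s: "2 * t \<le> s"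
    and mono: "\<And>\<eta> x. 0 \<le> discrepancy g \<eta> x"
    and g: "\<And>\<eta> x. discrepancy g \<eta> x \<le> D / t * green_sum (1 / t) A x"
  shows "discrepancy (S.cumulative s g) \<eta> x
    \<le> 2 * exp 1 * D * (green_sum (1 / s) A x - green_sum (1 / t) A x)"
proof -
  have ls: "0 < 1 / s" and lt: "0 < 1 / t" and l_le: "1 / s \<le> 1 / (2 * t)"
    using t s by (auto intro: divide_left_mono)
  have le: "1 / s \<le> 1 / t" using t s by (auto intro!: divide_left_mono)
  define W where "W x = 2 * D * (green_sum (1 / s) A x + (-1) * green_sum (1 / t) A x)" for x
  have W0: "0 \<le> W x" for x
    using green_sum_antimono[OF ls le, of A x] D by (simp add: W_def)
  have WK: "W x \<le> 2 * D * (card A * (1 / (1 / s)))" for x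
    unfolding W_def using green_sum_le[OF ls, of A x] green_sum_nonneg[OF lt, of A x] D
    by (intro mult_left_mono) auto
  have dW: "drift p W x = 2 * D * (drift p (green_sum (1 / s) A) x - drift p (green_sum (1 / t) A) x)" for x
  proof -
    have b: "\<bar>green_sum (1 / s) A y\<bar> \<le> card A * (1 / (1 / s))"
      "\<bar>(-1) * green_sum (1 / t) A y\<bar> \<le> card A * (1 / (1 / t))" for y
      using green_sum_le[OF ls, of A y] green_sum_nonneg[OF ls, of A y]
        green_sum_le[OF lt, of A y] green_sum_nonneg[OF lt, of A y] by auto
    show ?thesis
      unfolding W_def drift_cmult drift_add[OF b] by simp
  qed
  have "discrepancy (S.cumulative s g) \<eta> x \<le> exp (1 / s * s) * W x"
  proof (rule S.cumulative_le[OF mono ls _ W0 WK])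
    fix \<eta> x
    have "1 / s * W x - discrepancy_drift p \<eta> W x
        = 2 * D * ((1 / s * green_sum (1 / s) A x - drift p (green_sum (1 / s) A) x)
          - (1 / t * green_sum (1 / t) A x - drift p (green_sum (1 / t) A) x)
          + (1 / t - 1 / s) * green_sum (1 / t) A x)"
      unfolding discrepancy_drift_symmetric dW by (simp add: W_def algebra_simps)
    \<comment> \<open>Both potentials have the same source \<open>of_bool (x \<in> A)\<close>, so
      the two bracketed terms cancel.\<close>
    also have "\<dots> = 2 * D * ((1 / t - 1 / s) * green_sum (1 / t) A x)"
      unfolding green_sum_equation[OF ls A] green_sum_equation[OF lt A] by simp
    finally have eq: "1 / s * W x - discrepancy_drift p \<eta> W x = 2 * D * ((1 / t - 1 / s) * green_sum (1 / t) A x)" .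
    \<comment> \<open>As \<open>2 * t \<le> s\<close>, the parameters differ by at least half of
      \<open>1 / t\<close>; the factor 2 in \<open>W\<close> makes up for that half.\<close>
    have "1 / (2 * t) \<le> 1 / t - 1 / s" using l_le t by (simp add: field_simps)
    then have "2 * D * (1 / (2 * t) * green_sum (1 / t) A x) \<le> 2 * D * ((1 / t - 1 / s) * green_sum (1 / t) A x)"
      using D green_sum_nonneg[OF lt] by (intro mult_left_mono mult_right_mono) auto
    then have "D / t * green_sum (1 / t) A x \<le> 2 * D * ((1 / t - 1 / s) * green_sum (1 / t) A x)"
      by simp
    with g[of \<eta> x] show "discrepancy g \<eta> x \<le> 1 / s * W x - discrepancy_drift p \<eta> W x"
      unfolding eq by (rule order_trans)
  qed (use t s in simp)
  also have "\<dots> = 2 * exp 1 * D * (green_sum (1 / s) A x - green_sum (1 / t) A x)"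
    using t s by (simp add: W_def)
  finally show ?thesis .
qed

text \<open>The limits are taken in a fixed order: with \<open>t\<close> held fixed,
  \<open>s\<close> tends to infinity and turns \<open>law_at P \<nu> s\<close> into
  \<open>\<mu>\<close>; only then does \<open>t\<close> grow. Averaging over \<open>t\<close> loses
  nothing, since the limit \<open>\<nu>'\<close> is known to exist and its integrals agree with the
  limits of the Cesaro means.\<close>

lemma limit_recovers_invariant_measure:
  assumes \<nu>: "\<nu> \<in> invariant_measures Pbar"
    and \<mu>: "weak_limit (law_at P \<nu>) \<mu> at_top" and \<nu>': "weak_limit (law_at Pbar \<mu>) \<nu>' at_top"
  shows "\<nu>' = \<nu>"
proof -
  note \<nu>_inv = invariant_measuresD[OF Sbar.feller \<nu>]
  have \<mu>_prob: "prob_space \<mu>" "sets \<mu> = sets borel" and \<nu>'_prob: "prob_space \<nu>'" "sets \<nu>' = sets borel"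
    using \<mu> \<nu>' by (auto simp: weak_limit_def)
  interpret E\<nu>: bounded_linear "\<lambda>f :: ('s \<Rightarrow> bool) \<Rightarrow>\<^sub>C real. \<integral>\<eta>. f \<eta> \<partial>\<nu>"
    by (rule bounded_linear_integral_bcontfun[OF \<nu>_inv(1,2)])
  interpret E\<mu>: bounded_linear "\<lambda>f :: ('s \<Rightarrow> bool) \<Rightarrow>\<^sub>C real. \<integral>\<eta>. f \<eta> \<partial>\<mu>"
    by (rule bounded_linear_integral_bcontfun[OF \<mu>_prob])
  interpret E\<nu>': bounded_linear "\<lambda>f :: ('s \<Rightarrow> bool) \<Rightarrow>\<^sub>C real. \<integral>\<eta>. f \<eta> \<partial>\<nu>'"
    by (rule bounded_linear_integral_bcontfun[OF \<nu>'_prob])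
  have monotone_eq: "(\<integral>\<eta>. f \<eta> \<partial>\<nu>') = (\<integral>\<eta>. f \<eta> \<partial>\<nu>)"
    if f: "finitely_dependent (apply_bcontfun f)" "\<And>\<eta> x. 0 \<le> discrepancy f \<eta> x"
    for f :: "('s \<Rightarrow> bool) \<Rightarrow>\<^sub>C real"
  proof -
    obtain A D where A: "finite A" and D: "0 \<le> D"
      and AD: "\<And>t \<eta> x. 1 \<le> t \<Longrightarrow> discrepancy (Sbar.cumulative t f) \<eta> x \<le> D * green_sum (1 / t) A x"
      by (rule potential_bound_perturbed[OF f]) (rule that)
    obtain K where K: "\<And>l x. 0 < l \<Longrightarrow> l \<le> 1 \<Longrightarrow> green_sum l A x \<le> K"
      by (rule green_sum_uniform_bound[OF A]) (rule that)
    \<comment> \<open>The potential of \<open>A\<close> at parameter 0 is obtained as an increasing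
      limit of resolvent potentials, finite because of the uniform bound \<open>K\<close>.\<close>
    have "\<exists>l. ((\<lambda>t. green_sum (1 / t) A x) \<longlongrightarrow> l) at_top \<and> (\<forall>t\<ge>1. green_sum (1 / t) A x \<le> l)" for x
    proof -
      obtain l where "((\<lambda>t. green_sum (1 / t) A x) \<longlongrightarrow> l) at_top" "\<And>t. 1 \<le> t \<Longrightarrow> green_sum (1 / t) A x \<le> l"
      proof (rule mono_bounded_convergent)
        show "green_sum (1 / s) A x \<le> green_sum (1 / t) A x" if "1 \<le> s" "s \<le> t" for s t
          using that by (intro green_sum_antimono divide_left_mono) auto
        show "green_sum (1 / t) A x \<le> K" if "1 \<le> t" for t using that by (intro K) auto
      qed (rule that)
      then show ?thesis by blast
    qed
    then have "\<exists>G. \<forall>x. ((\<lambda>t. green_sum (1 / t) A x) \<longlongrightarrow> G x) at_top \<and> (\<forall>t\<ge>1. green_sum (1 / t) A x \<le> G x)"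
      by (intro choice allI)
    then obtain G where G: "\<And>x. ((\<lambda>t. green_sum (1 / t) A x) \<longlongrightarrow> G x) at_top"
        "\<And>x t. 1 \<le> t \<Longrightarrow> green_sum (1 / t) A x \<le> G x" by blast
    \<comment> \<open>The part of the potential not yet reached by the resolvent at
      \<open>1 / t\<close>, at the two ends of the bond. Both gaps are nonnegative, so their sum
      dominates each, and it vanishes as \<open>t\<close> tends to infinity.\<close>
    define R where "R t = 2 * exp 1 * D * ((G u - green_sum (1 / t) A u) + (G v - green_sum (1 / t) A v))" for t
    define m where "m r = (\<integral>\<eta>. feller_semigroup Pbar r f \<eta> \<partial>\<mu>)" for r
    have mean: "\<bar>integral {0..t} m / t - (\<integral>\<eta>. f \<eta> \<partial>\<nu>)\<bar> \<le> \<bar>\<epsilon>\<bar> * R t" if t: "1 \<le> t" for t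
    proof -
      define g where "g = (1 / t) *\<^sub>R Sbar.cumulative t f"
      have disc_g: "discrepancy g \<eta> x = discrepancy (Sbar.cumulative t f) \<eta> x / t" for \<eta> x
        by (simp add: g_def discrepancy_def diff_divide_distrib)
      have g0: "0 \<le> discrepancy g \<eta> x" for \<eta> x
        using Sbar.cumulative_discrepancy_nonneg[OF f(2), of t \<eta> x] t by (simp add: disc_g)
      have g_le: "discrepancy g \<eta> x \<le> D / t * green_sum (1 / t) A x" for \<eta> x
        using AD[OF t, of \<eta> x] t by (simp add: disc_g divide_right_mono)
      have "\<bar>(\<integral>\<eta>. feller_semigroup P s g \<eta> \<partial>\<nu>) - (\<integral>\<eta>. g \<eta> \<partial>\<nu>)\<bar> \<le> \<bar>- \<epsilon>\<bar> * R t" if s: "2 * t \<le> s" for s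
      proof (rule bond_perturbation.increment_le[OF backward \<nu> _ g0])
        have gap: "0 \<le> G x - green_sum (1 / t) A x" for x using G(2)[OF t, of x] by simp
        have "discrepancy (S.cumulative s g) \<eta> x \<le> 2 * exp 1 * D * (G x - green_sum (1 / t) A x)" for \<eta> x
        proof (rule order_trans[OF symmetric_cumulative_mean_le[OF A D t s g0 g_le]])
          show "2 * exp 1 * D * (green_sum (1 / s) A x - green_sum (1 / t) A x) \<le> 2 * exp 1 * D * (G x - green_sum (1 / t) A x)"
            using D G(2)[of s x] t s by (intro mult_left_mono) auto
        qed
        moreover have "2 * exp 1 * D * (G x - green_sum (1 / t) A x) \<le> R t" if "x \<in> {u, v}" for x
          unfolding R_def using D gap[of u] gap[of v] that by (intro mult_left_mono) auto
        ultimately show "discrepancy (S.cumulative s g) \<eta> u \<le> R t" "discrepancy (S.cumulative s g) \<eta> v \<le> R t" for \<eta>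
          by (meson insertI1 insertI2 order_trans)+
      qed (use t s in auto)
      note bound = this
      have "\<forall>\<^sub>F s in at_top. \<bar>(\<integral>\<eta>. g \<eta> \<partial>law_at P \<nu> s) - (\<integral>\<eta>. g \<eta> \<partial>\<nu>)\<bar> \<le> \<bar>\<epsilon>\<bar> * R t"
        using eventually_ge_at_top[of "2 * t"]
      proof eventually_elim
        case (elim s)
        then show ?case
          using bound[OF elim] t by (simp add: law_at_feller(3)[OF S.feller \<nu>_inv(1,2)])
      qed
      moreover have "((\<lambda>s. \<bar>(\<integral>\<eta>. g \<eta> \<partial>law_at P \<nu> s) - (\<integral>\<eta>. g \<eta> \<partial>\<nu>)\<bar>)
          \<longlongrightarrow> \<bar>(\<integral>\<eta>. g \<eta> \<partial>\<mu>) - (\<integral>\<eta>. g \<eta> \<partial>\<nu>)\<bar>) at_top"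
        using \<mu> by (intro tendsto_intros) (simp add: weak_limit_def)
      ultimately have "\<bar>(\<integral>\<eta>. g \<eta> \<partial>\<mu>) - (\<integral>\<eta>. g \<eta> \<partial>\<nu>)\<bar> \<le> \<bar>\<epsilon>\<bar> * R t"
        by (intro tendsto_upperbound[of _ _ at_top]) auto
      moreover have "(\<integral>\<eta>. g \<eta> \<partial>\<mu>) = integral {0..t} m / t"
        using integral_linear[OF Sbar.integrable_T[of 0 f t] E\<mu>.bounded_linear_axioms]
        by (simp add: g_def E\<mu>.scaleR Sbar.cumulative_def m_def[abs_def] comp_def)
      moreover have "(\<integral>\<eta>. g \<eta> \<partial>\<nu>) = (\<integral>\<eta>. f \<eta> \<partial>\<nu>)"
      proof -
        have "(\<integral>\<eta>. Sbar.cumulative t f \<eta> \<partial>\<nu>) = integral {0..t} (\<lambda>r. \<integral>\<eta>. feller_semigroup Pbar r f \<eta> \<partial>\<nu>)"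
          using integral_linear[OF Sbar.integrable_T[of 0 f t] E\<nu>.bounded_linear_axioms]
          by (simp add: Sbar.cumulative_def comp_def)
        also have "\<dots> = integral {0..t} (\<lambda>r. \<integral>\<eta>. f \<eta> \<partial>\<nu>)"
          by (rule integral_cong) (simp add: \<nu>_inv(3))
        also have "\<dots> = t * (\<integral>\<eta>. f \<eta> \<partial>\<nu>)" using t by simp
        finally show ?thesis using t by (simp add: g_def)
      qed
      ultimately show ?thesis by simp
    qed
    have "(m \<longlongrightarrow> (\<integral>\<eta>. f \<eta> \<partial>\<nu>')) at_top"
    proof (rule Lim_transform_eventually)
      show "((\<lambda>t. \<integral>\<eta>. f \<eta> \<partial>law_at Pbar \<mu> t) \<longlongrightarrow> (\<integral>\<eta>. f \<eta> \<partial>\<nu>')) at_top"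
        using \<nu>' by (simp add: weak_limit_def)
      show "\<forall>\<^sub>F t in at_top. (\<integral>\<eta>. f \<eta> \<partial>law_at Pbar \<mu> t) = m t"
        using eventually_ge_at_top[of 0]
        by eventually_elim (simp add: m_def law_at_feller(3)[OF Sbar.feller \<mu>_prob])
    qed
    moreover have "continuous_on {0..} m"
      unfolding m_def by (rule E\<mu>.continuous_on[OF Sbar.continuous_T])
    ultimately have "((\<lambda>t. integral {0..t} m / t) \<longlongrightarrow> (\<integral>\<eta>. f \<eta> \<partial>\<nu>')) at_top"
      by (rule cesaro_mean_tendsto[rotated])
    then have "((\<lambda>t. \<bar>integral {0..t} m / t - (\<integral>\<eta>. f \<eta> \<partial>\<nu>)\<bar>)
        \<longlongrightarrow> \<bar>(\<integral>\<eta>. f \<eta> \<partial>\<nu>') - (\<integral>\<eta>. f \<eta> \<partial>\<nu>)\<bar>) at_top"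
      by (intro tendsto_intros)
    moreover have "((\<lambda>t. \<bar>\<epsilon>\<bar> * R t) \<longlongrightarrow> \<bar>\<epsilon>\<bar> * (2 * exp 1 * D * ((G u - G u) + (G v - G v)))) at_top"
      unfolding R_def by (intro tendsto_intros G)
    moreover have "\<forall>\<^sub>F t in at_top. \<bar>integral {0..t} m / t - (\<integral>\<eta>. f \<eta> \<partial>\<nu>)\<bar> \<le> \<bar>\<epsilon>\<bar> * R t"
      using eventually_ge_at_top[of 1] by eventually_elim (rule mean)
    ultimately have "\<bar>(\<integral>\<eta>. f \<eta> \<partial>\<nu>') - (\<integral>\<eta>. f \<eta> \<partial>\<nu>)\<bar> \<le> \<bar>\<epsilon>\<bar> * (2 * exp 1 * D * ((G u - G u) + (G v - G v)))"
      by (intro tendsto_le[of at_top]) auto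
    then show ?thesis by simp
  qed
  show ?thesis
  proof (rule measure_eqI_finitely_dependent[OF \<nu>'_prob \<nu>_inv(1,2)])
    fix f :: "('s \<Rightarrow> bool) \<Rightarrow>\<^sub>C real" assume "finitely_dependent (apply_bcontfun f)"
    then obtain g h where f: "f = g - h"
      and g: "finitely_dependent (apply_bcontfun g)" "\<And>\<eta> x. 0 \<le> discrepancy g \<eta> x"
      and h: "finitely_dependent (apply_bcontfun h)" "\<And>\<eta> x. 0 \<le> discrepancy h \<eta> x"
      by (rule finitely_dependent_diff_monotone) (rule that)
    show "(\<integral>\<eta>. f \<eta> \<partial>\<nu>') = (\<integral>\<eta>. f \<eta> \<partial>\<nu>)"
      unfolding f E\<nu>'.diff E\<nu>.diff using monotone_eq[OF g] monotone_eq[OF h] by simp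
  qed
qed

lemma invariant_measures_eq:
  "invariant_measures Pbar = {\<nu>. \<exists>\<mu>\<in>invariant_measures P. weak_limit (law_at Pbar \<mu>) \<nu> at_top}"
proof (intro set_eqI iffI CollectI)
  fix \<nu> assume \<nu>: "\<nu> \<in> invariant_measures Pbar"
  note \<nu>_prob = invariant_measuresD(1,2)[OF Sbar.feller \<nu>]
  obtain \<mu> where \<mu>: "weak_limit (law_at P \<nu>) \<mu> at_top" using symmetric_limit_exists[OF \<nu>] by blast
  have \<mu>_inv: "\<mu> \<in> invariant_measures P" by (rule weak_limit_law_invariant[OF S.feller \<nu>_prob \<mu>])
  obtain \<nu>' where \<nu>': "weak_limit (law_at Pbar \<mu>) \<nu>' at_top" using perturbed_limit_exists[OF \<mu>_inv] by blast
  have "\<nu>' = \<nu>" by (rule limit_recovers_invariant_measure[OF \<nu> \<mu> \<nu>'])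
  with \<nu>' \<mu>_inv show "\<exists>\<mu>\<in>invariant_measures P. weak_limit (law_at Pbar \<mu>) \<nu> at_top" by blast
next
  fix \<nu> assume "\<nu> \<in> {\<nu>. \<exists>\<mu>\<in>invariant_measures P. weak_limit (law_at Pbar \<mu>) \<nu> at_top}"
  then obtain \<mu> where \<mu>: "\<mu> \<in> invariant_measures P" "weak_limit (law_at Pbar \<mu>) \<nu> at_top" by blast
  show "\<nu> \<in> invariant_measures Pbar"
    by (rule weak_limit_law_invariant[OF Sbar.feller invariant_measuresD(1,2)[OF S.feller \<mu>(1)] \<mu>(2)])
qed

end

section \<open>Reduction of the theorem to the setting of one modified bond\<close>

lemma transition_kernel_bounded_rates:
  assumes "transition_kernel p"
  obtains C where "\<And>B. C \<le> B \<Longrightarrow> bounded_rates p B" "\<And>B. C \<le> B \<Longrightarrow> bounded_rates (\<lambda>x y. p y x) B"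
proof -
  from assms obtain C C' where p: "\<And>x y. 0 \<le> p x y"
      "\<And>y. (\<lambda>x. p x y) summable_on UNIV" "\<And>x. (\<lambda>y. p x y) summable_on UNIV"
    and le: "\<And>y. (\<Sum>\<^sub>\<infinity>x. p x y) \<le> C" "\<And>x. (\<Sum>\<^sub>\<infinity>y. p x y) \<le> C'"
    unfolding transition_kernel_def by blast
  show thesis
    by (rule that[of "max C C'"])
      (auto simp: bounded_rates_def p intro: order_trans[OF le(1)] order_trans[OF le(2)])
qed

theorem theorem1p3:
  fixes p pbar :: "'s::countable \<Rightarrow> 's \<Rightarrow> real"
    and u v :: 's
    and P Pbar :: "real \<Rightarrow> ('s \<Rightarrow> bool) \<Rightarrow> ('s \<Rightarrow> bool) measure"
  assumes "quasi_symmetric p pbar"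
    and "irreducible_kernel pbar"
    and "transient_kernel pbar"
    and "{(x, y). pbar x y \<noteq> p x y} = {(u, v)}"
    and "exclusion_process p P"
    and "exclusion_process pbar Pbar"
  shows "(\<forall>\<mu>\<in>invariant_measures P. \<exists>\<nu>. weak_limit (law_at Pbar \<mu>) \<nu> at_top) \<and>
    invariant_measures Pbar =
      {\<nu>. \<exists>\<mu>\<in>invariant_measures P. weak_limit (law_at Pbar \<mu>) \<nu> at_top}"
proof -
  have sym: "p x y = p y x" for x y
    using assms(1) by (simp add: quasi_symmetric_def symmetric_kernel_def)
  have kernels: "transition_kernel p" "transition_kernel pbar" and irred: "irreducible_kernel p"
    and pos: "\<And>x y. 0 < pbar x y \<longleftrightarrow> 0 < p x y"
    using assms(1) by (simp_all add: quasi_symmetric_def perturbation_def)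
  have nonneg: "0 \<le> p x y" "0 \<le> pbar x y" for x y using kernels by (simp_all add: transition_kernel_def)
  have diff: "pbar x y \<noteq> p x y \<longleftrightarrow> (x, y) = (u, v)" for x y using assms(4) by blast
  define \<epsilon> where "\<epsilon> = pbar u v - p u v"
  have "pbar u v \<noteq> p u v" using diff by simp
  \<comment> \<open>The two rates are nonnegative and different, so one of them is positive; since
    positivity is shared, both are.\<close>
  then have "0 < p u v" "0 < pbar u v" using pos[of u v] nonneg[of u v] by linarith+
  obtain C1 where C1: "\<And>B. C1 \<le> B \<Longrightarrow> bounded_rates p B" "\<And>B. C1 \<le> B \<Longrightarrow> bounded_rates (\<lambda>x y. p y x) B"
    by (rule transition_kernel_bounded_rates[OF kernels(1)]) (rule that)
  obtain C2 where C2: "\<And>B. C2 \<le> B \<Longrightarrow> bounded_rates pbar B" "\<And>B. C2 \<le> B \<Longrightarrow> bounded_rates (\<lambda>x y. pbar y x) B"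
    by (rule transition_kernel_bounded_rates[OF kernels(2)]) (rule that)
  define C where "C = max C1 C2"
  have rates: "bounded_rates p C" "bounded_rates (\<lambda>x y. p y x) C"
    "bounded_rates pbar C" "bounded_rates (\<lambda>x y. pbar y x) C"
    using C1 C2 by (simp_all add: C_def)
  interpret perturbed_exclusion p C pbar u v \<epsilon> P Pbar
  proof (intro perturbed_exclusion.intro single_perturbation.intro symmetric_rates.intro
      exclusion_semigroup.intro exclusion_rates.intro rates)
    show "symmetric_rates_axioms p" by unfold_locales (rule sym)
    have "pbar x y = p x y + (if x = u \<and> y = v then \<epsilon> else 0)" for x y
      using diff[of x y] by (auto simp: \<epsilon>_def)
    moreover have "0 < p u v + \<epsilon>" using \<open>0 < pbar u v\<close> by (simp add: \<epsilon>_def)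
    ultimately show "single_perturbation_axioms p C pbar u v \<epsilon>"
      using \<open>0 < p u v\<close> rates(3) by (simp add: single_perturbation_axioms_def)
    show "exclusion_semigroup_axioms p P" "exclusion_semigroup_axioms pbar Pbar"
      using assms(5,6) by (simp_all add: exclusion_semigroup_axioms_def)
    show "perturbed_exclusion_axioms p pbar"
      using assms(3) irred by (simp add: perturbed_exclusion_axioms_def)
  qed
  show ?thesis using perturbed_limit_exists invariant_measures_eq by blast
qed

end
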